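(* Consider a family of random trees indexed by size $n$, with profile $Y_{n,k}$ (number of nodes at level $k$), $\mu_{n,k}:=\mathbb{E}\{Y_{n,k}\}$ and $\Xi_n(u):=\sum_k\mu_{n,k}u^k$. Assume the following three conditions. (I) There are $\varepsilon_0>0$, $\varepsilon>0$ and functions $f,g$ analytic in $|u-1|\le\varepsilon_0$ with $f(1)=g(1)=1$ such that $$\Xi_n(u)=g(u)\,n^{f(u)}\bigl(1+O(n^{-\varepsilon})\bigr)$$ uniformly for $u\in\mathbb{C}$, $|u-1|\le\varepsilon_0$. (II) There are $0<\varepsilon_1<\varepsilon_0$ and $\varepsilon>0$ such that $|\Xi_n(u)|=O(n^{1-\varepsilon})$ uniformly for $u\in\{u\in\mathbb{C}:1-\varepsilon_1\le|u|\le1+\varepsilon_1\}\setminus\{u\in\mathbb{C}:|u-1|\le\varepsilon_0\}$. (III) For every integer $m\ge0$, with $\Delta:=k-f'(1)L_n$, $$\mathbb{E}\{(Y_{n,k}-\mu_{n,k})^m\}=O\bigl(|\Delta|^mL_n^{-m}\mu_{n,k}^m\bigr)$$ uniformly for $|\Delta|=o(L_n)$. Let $\sigma:=\sqrt{f'(1)+f''(1)}$, let $W_n:=\max_kY_{n,k}$ be the width, and let $k^*$ be one of the levels with $Y_{n,k^*}=W_n$. Then, as $n\to\infty$, $$\mathbb{E}\{W_n\}=\frac{n}{\sqrt{2\pi\sigma^2L_n}}\bigl(1+O(L_n^{-1})\bigr),$$ $$\mathbb{E}\{|W_n-\mathbb{E}\{W_n\}|^s\}=O\bigl(n^sL_n^{-3s/2}\bigr)\qquad(s\ge0),$$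 and, for every $B>0$, there is $T_0>1$ such that for $T>T_0$ $$\mathbb{P}(|k^*-f'(1)L_n|\ge T)=O(T^{-B}),$$ with implied constant independent of $n$ and $T$. Furthermore, if inserting a new node to the tree changes the width by at most a bounded quantity, then $$\frac{W_n}{\mathbb{E}\{W_n\}}\longrightarrow1\qquad\text{almost surely}.$$
   Context: $L_n:=\max\{\log n,1\}$ (natural logarithm). The random variables $Y_{n,k}$ are nonnegative integer valued, with the root at level $0$, and $\Xi_n(u)$ is a polynomial in $u$ (the levels $k$ range over $0,\dots,n$). It is understood that $\sigma^2=f'(1)+f''(1)>0$. The almost sure statement concerns a sequential growth model: the trees for $n=1,2,\dots$ are defined on one probability space, the tree of size $n+1$ being obtained from that of size $n$ by one insertion, and the hypothesis is $|W_{n+1}-W_n|\le C$ for a constant $C$.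
   Formalization: Adds that ε0 is small enough that Re f(u)<1 for |u|=1, u≠1, |u−1|≤ε0 (automatic for small ε0; without it the claim fails, e.g. f(u)=u², ε0=3, with means oscillating between even and odd levels). "Size n" is read as: at most Kn nodes for a constant K, levels in 0..n. *)

theory Defs
  imports "HOL-Probability.Probability" "HOL-Complex_Analysis.Complex_Analysis"
begin

text \<open>
  Finite rooted trees. Labels and the left/right position of children play no role for the
  profile, so only the shape is kept (unordered trees are represented by any ordering).
\<close>

datatype rtree = Node "rtree list"

fun num_nodes :: "rtree \<Rightarrow> nat" where
  "num_nodes (Node ts) = Suc (\<Sum>t\<leftarrow>ts. num_nodes t)"

fun profile :: "rtree \<Rightarrow> nat \<Rightarrow> nat" where
  "profile (Node ts) 0 = 1"
| "profile (Node ts) (Suc k) = (\<Sum>t\<leftarrow>ts. profile t k)"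

definition width :: "rtree \<Rightarrow> nat" where
  "width t = Max (range (profile t))"

definition Lg :: "nat \<Rightarrow> real" where
  "Lg n = max (ln (real n)) 1"

text \<open>
  The tree of size \<open>n \<ge> 1\<close> is a random variable on its own probability space \<open>M n\<close>. ``Size'' need
  not be the number of nodes (it may be the number of stored keys, say): a tree of size \<open>n\<close> has
  its levels in \<open>{0..n}\<close> and at most \<open>K * n\<close> nodes for a fixed \<open>K\<close>. Trees with exactly \<open>n\<close> nodes
  are the case \<open>K = 1\<close>.
\<close>

definition random_tree_family ::
    "(nat \<Rightarrow> 'a measure) \<Rightarrow> (nat \<Rightarrow> 'a \<Rightarrow> rtree) \<Rightarrow> bool" where
  "random_tree_family M T \<longleftrightarrow>
     (\<forall>n\<ge>1. prob_space (M n) \<and> T n \<in> measurable (M n) (count_space UNIV)) \<and>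
     (\<forall>n\<ge>1. \<forall>\<omega>\<in>space (M n). \<forall>k>n. profile (T n \<omega>) k = 0) \<and>
     (\<exists>K. \<forall>n\<ge>1. \<forall>\<omega>\<in>space (M n). num_nodes (T n \<omega>) \<le> K * n)"

definition mean_profile ::
    "(nat \<Rightarrow> 'a measure) \<Rightarrow> (nat \<Rightarrow> 'a \<Rightarrow> rtree) \<Rightarrow> nat \<Rightarrow> nat \<Rightarrow> real" where
  "mean_profile M T n k = (\<integral>\<omega>. real (profile (T n \<omega>) k) \<partial>M n)"

definition mean_width ::
    "(nat \<Rightarrow> 'a measure) \<Rightarrow> (nat \<Rightarrow> 'a \<Rightarrow> rtree) \<Rightarrow> nat \<Rightarrow> real" where
  "mean_width M T n = (\<integral>\<omega>. real (width (T n \<omega>)) \<partial>M n)"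

definition Xi ::
    "(nat \<Rightarrow> 'a measure) \<Rightarrow> (nat \<Rightarrow> 'a \<Rightarrow> rtree) \<Rightarrow> nat \<Rightarrow> complex \<Rightarrow> complex" where
  "Xi M T n u = (\<Sum>k\<le>n. complex_of_real (mean_profile M T n k) * u ^ k)"

text \<open>
  The numbers \<open>f'(1)\<close> and \<open>f''(1)\<close> are real whenever \<open>cond_I\<close> holds (\<open>Xi M T n\<close> is real and
  positive at positive reals), so taking real parts below only changes the type.
\<close>

definition fp1 :: "(complex \<Rightarrow> complex) \<Rightarrow> real" where
  "fp1 f = Re (deriv f 1)"

definition fpp1 :: "(complex \<Rightarrow> complex) \<Rightarrow> real" where
  "fpp1 f = Re (deriv (deriv f) 1)"

definition sigma_prof :: "(complex \<Rightarrow> complex) \<Rightarrow> real" where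
  "sigma_prof f = sqrt (fp1 f + fpp1 f)"

definition Dlt :: "(complex \<Rightarrow> complex) \<Rightarrow> nat \<Rightarrow> nat \<Rightarrow> real" where
  "Dlt f n k = real k - fp1 f * Lg n"

definition cond_I ::
    "(nat \<Rightarrow> 'a measure) \<Rightarrow> (nat \<Rightarrow> 'a \<Rightarrow> rtree) \<Rightarrow>
     (complex \<Rightarrow> complex) \<Rightarrow> (complex \<Rightarrow> complex) \<Rightarrow> real \<Rightarrow> bool" where
  "cond_I M T f g \<epsilon>0 \<longleftrightarrow>
     \<epsilon>0 > 0 \<and> f analytic_on cball 1 \<epsilon>0 \<and> g analytic_on cball 1 \<epsilon>0 \<and> f 1 = 1 \<and> g 1 = 1 \<and>
     (\<exists>\<epsilon>>0. \<exists>C. \<forall>\<^sub>F n in sequentially. \<forall>u. cmod (u - 1) \<le> \<epsilon>0 \<longrightarrow>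
        (\<exists>r. cmod r \<le> C * real n powr (-\<epsilon>) \<and>
             Xi M T n u = g u * (of_nat n powr f u) * (1 + r)))"

text \<open>
  The radius \<open>\<epsilon>0\<close> is understood to be small: \<open>u = 1\<close> is the only point of the unit circle in the
  disc at which \<open>n powr f u\<close> has the full order \<open>n\<close>. Under \<open>cond_I\<close>, \<open>Re (f (cis t))\<close> is
  \<open>1 - (fp1 f + fpp1 f) * t\<^sup>2 / 2 + O(t^3)\<close>, so if \<open>fp1 f + fpp1 f > 0\<close> every sufficiently small
  radius has this property. For a large radius \<open>cond_I\<close> and \<open>cond_II\<close> do not exclude mean profiles
  that oscillate between even and odd levels (\<open>f u = u\<^sup>2\<close>, \<open>\<epsilon>0 = 3\<close>: every unit \<open>u\<close> lies in the
  disc, and \<open>f (-1) = 1\<close>); their width is asymptotically different.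
\<close>

definition small_radius :: "(complex \<Rightarrow> complex) \<Rightarrow> real \<Rightarrow> bool" where
  "small_radius f \<epsilon>0 \<longleftrightarrow>
     (\<forall>u. cmod u = 1 \<and> u \<noteq> 1 \<and> cmod (u - 1) \<le> \<epsilon>0 \<longrightarrow> Re (f u) < 1)"

definition cond_II ::
    "(nat \<Rightarrow> 'a measure) \<Rightarrow> (nat \<Rightarrow> 'a \<Rightarrow> rtree) \<Rightarrow> real \<Rightarrow> bool" where
  "cond_II M T \<epsilon>0 \<longleftrightarrow>
     (\<exists>\<epsilon>1 \<epsilon>. 0 < \<epsilon>1 \<and> \<epsilon>1 < \<epsilon>0 \<and> \<epsilon> > 0 \<and>
        (\<exists>C. \<forall>\<^sub>F n in sequentially.
           \<forall>u \<in> {u. 1 - \<epsilon>1 \<le> cmod u \<and> cmod u \<le> 1 + \<epsilon>1} - {u. cmod (u - 1) \<le> \<epsilon>0}.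
             cmod (Xi M T n u) \<le> C * real n powr (1 - \<epsilon>)))"

text \<open>
  ``Uniformly for \<open>\<bar>\<Delta>\<bar> = o(L_n)\<close>'': for every null sequence \<open>\<eta>\<close>, the bound is uniform over all
  levels with \<open>\<bar>\<Delta>\<bar> \<le> \<eta> n * L_n\<close>; the implied constant may depend on \<open>m\<close> and \<open>\<eta>\<close>.
\<close>

definition cond_III ::
    "(nat \<Rightarrow> 'a measure) \<Rightarrow> (nat \<Rightarrow> 'a \<Rightarrow> rtree) \<Rightarrow> (complex \<Rightarrow> complex) \<Rightarrow> bool" where
  "cond_III M T f \<longleftrightarrow>
     (\<forall>m::nat. \<forall>\<eta>::nat \<Rightarrow> real. \<eta> \<longlonglongrightarrow> 0 \<longrightarrow>
        (\<exists>C. \<forall>\<^sub>F n in sequentially. \<forall>k. \<bar>Dlt f n k\<bar> \<le> \<eta> n * Lg n \<longrightarrow>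
           \<bar>\<integral>\<omega>. (real (profile (T n \<omega>) k) - mean_profile M T n k) ^ m \<partial>M n\<bar>
             \<le> C * (\<bar>Dlt f n k\<bar> ^ m / Lg n ^ m * mean_profile M T n k ^ m)))"

end

theory Submission
  imports Defs "HOL-Real_Asymp.Real_Asymp"
begin

text \<open>
  Write \<open>L = Lg n\<close> and \<open>scale n = n * L powr (-3/2)\<close>. Fourier inversion of \<open>Xi\<close> on the unit circle
  gives \<open>mu k = peak n * exp (- d\<^sup>2 / (2 \<sigma>\<^sup>2 L)) + O((\<bar>d\<bar> + 1) * scale n)\<close> for the level at distance \<open>d\<close>
  from \<open>f'(1) L\<close>, where \<open>peak n = n / sqrt (2 \<pi> \<sigma>\<^sup>2 L)\<close>. So a level with \<open>\<bar>d\<bar> \<le> L powr (2/3)\<close> has its mean at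
  least \<open>c * \<bar>d\<bar> powr (3/2) * scale n\<close> below the peak, while by (III) its profile deviates from the mean by
  \<open>O(\<bar>d\<bar> * scale n)\<close> only; the levels farther out are negligible by a Chernoff bound. Hence the width
  is \<open>peak n + O(scale n)\<close> in every \<open>L\<^sup>p\<close> and is attained at bounded \<open>d\<close>. Since the relative error is
  \<open>O(1 / L)\<close> with all moments, Borel--Cantelli along the sequence \<open>exp (sqrt j)\<close> together with the bounded
  increments yields almost sure convergence.
\<close>

section \<open>Taylor bounds and Gaussian integrals\<close>

text \<open>A relative error \<open>1 / L\<close> leaves no room for corrections of order
  \<open>1 / sqrt L\<close>. The cubic term of \<open>f (exp z)\<close> and the linear term of
  \<open>g (exp z)\<close> would produce them, but at \<open>z = i t\<close> both are purely
  imaginary once their coefficients are real, and then they only meet the sine of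
  \<open>d * t\<close>, which costs a factor \<open>d\<close> and gains a factor \<open>t\<close>.
  That \<open>f\<close> and \<open>g\<close> are real on the reals near 1 is extracted from (I). The
  true gap between peak and mean is of order \<open>scale n\<close> times the smaller of
  \<open>d^2\<close> and \<open>L\<close>. The power 3/2 of \<open>d\<close> stays below both up to
  \<open>d = L powr (2/3)\<close>, which fixes the cutoff, and it exceeds the power 1 of the
  fluctuations: a high moment therefore gains any desired power of \<open>d powr (-1/2)\<close> at
  each level, enough to sum over the levels. The cutoff is \<open>o(L)\<close>, as (III) requires,
  and of larger order than the standard deviation \<open>sqrt L\<close>, as the Chernoff bound
  requires. Along \<open>exp (sqrt j)\<close> the logarithm grows like \<open>sqrt j\<close>, so one
  fixed moment already gives summable probabilities, while neighbouring terms differ by a factor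
  tending to 1.\<close>

text \<open>On the closed disc of half the radius, which is compact inside the domain, the next
  derivative is bounded, and this bounds the remainder.\<close>

lemma higher_deriv_Taylor_bound:
  fixes h :: "complex \<Rightarrow> complex"
  assumes hol: "h holomorphic_on ball 0 r" and r: "r > 0"
  shows "\<exists>C\<ge>0. \<forall>z. cmod z \<le> r / 2 \<longrightarrow>
    cmod (h z - (\<Sum>i\<le>n. (deriv ^^ i) h 0 * z ^ i / fact i)) \<le> C * cmod z ^ Suc n"
proof -
  have hd: "(deriv ^^ i) h holomorphic_on ball 0 r" for i
    by (rule holomorphic_higher_deriv[OF hol]) simp
  have "continuous_on (cball 0 (r/2)) ((deriv ^^ Suc n) h)"
    by (rule continuous_on_subset[OF holomorphic_on_imp_continuous_on[OF hd[of "Suc n"]]]) (use r in auto)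
  then have "bounded ((deriv ^^ Suc n) h ` cball 0 (r/2))"
    by (intro compact_imp_bounded compact_continuous_image) auto
  then obtain B where B: "\<And>x. x \<in> cball 0 (r/2) \<Longrightarrow> cmod ((deriv ^^ Suc n) h x) \<le> B"
    unfolding bounded_iff by blast
  have B0: "B \<ge> 0"
    using B[of 0] r norm_ge_zero[of "(deriv ^^ Suc n) h 0"] by (auto simp del: norm_ge_zero)
  have der: "((deriv ^^ i) h has_field_derivative (deriv ^^ Suc i) h x) (at x within cball 0 (r/2))"
    if "x \<in> cball 0 (r/2)" for i x
  proof -
    have "x \<in> ball 0 r" using that r by auto
    then have "((deriv ^^ i) h has_field_derivative deriv ((deriv ^^ i) h) x) (at x)"
      using holomorphic_derivI[OF hd, of x i] by auto
    then show ?thesis by (auto intro: has_field_derivative_at_within)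
  qed
  have "cmod (h z - (\<Sum>i\<le>n. (deriv ^^ i) h 0 * z ^ i / fact i)) \<le> (B / fact n) * cmod z ^ Suc n"
    if "cmod z \<le> r / 2" for z
    using complex_Taylor[of "cball 0 (r/2)" n "\<lambda>i. (deriv ^^ i) h" B 0 z] der B r that by auto
  moreover have "B / fact n \<ge> 0" using B0 by simp
  ultimately show ?thesis by blast
qed

text \<open>Along the real axis the imaginary part of \<open>h\<close> is constantly 0, so its
  derivative in the real direction is 0; that derivative is the imaginary part of
  \<open>deriv h\<close>.\<close>

lemma deriv_real_on_reals:
  fixes h :: "complex \<Rightarrow> complex"
  assumes hol: "h holomorphic_on ball 0 r"
    and re: "\<And>x. \<bar>x\<bar> < r \<Longrightarrow> h (complex_of_real x) \<in> \<real>" and x: "\<bar>x\<bar> < r"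
  shows "deriv h (complex_of_real x) \<in> \<real>"
proof -
  have xb: "complex_of_real x \<in> ball 0 r" using x by simp
  have d: "(h has_field_derivative deriv h (of_real x)) (at (complex_of_real x))"
    using holomorphic_derivI[OF hol _ xb] by auto
  have "((\<lambda>t. h (complex_of_real t)) has_vector_derivative deriv h (of_real x)) (at x)"
    using has_vector_derivative_real_field[OF d] by simp
  then have "((\<lambda>t. Im (h (complex_of_real t))) has_vector_derivative Im (deriv h (of_real x))) (at x)"
    by (rule bounded_linear.has_vector_derivative[OF bounded_linear_Im])
  moreover have "((\<lambda>t. Im (h (complex_of_real t))) has_vector_derivative 0) (at x)"
    by (rule has_vector_derivative_transform_within_open[of "\<lambda>_. 0" 0 x "{-r<..<r}"])
       (use re x in \<open>auto simp: complex_is_Real_iff abs_less_iff\<close>)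
  ultimately show ?thesis
    by (metis vector_derivative_unique_at complex_is_Real_iff)
qed

lemma higher_deriv_real_on_reals:
  fixes h :: "complex \<Rightarrow> complex"
  assumes hol: "h holomorphic_on ball 0 r"
    and re: "\<And>x. \<bar>x\<bar> < r \<Longrightarrow> h (complex_of_real x) \<in> \<real>" and x: "\<bar>x\<bar> < r"
  shows "(deriv ^^ i) h (complex_of_real x) \<in> \<real>"
  using x
proof (induction i arbitrary: x)
  case 0
  then show ?case using re by simp
next
  case (Suc i)
  show ?case
    using deriv_real_on_reals[OF holomorphic_higher_deriv[OF hol open_ball, of i] Suc.IH Suc.prems]
    by simp
qed

lemma gaussian_has_bochner_integral:
  fixes c :: real
  assumes "c > 0"
  shows "has_bochner_integral lborel (\<lambda>t. exp (- c * t\<^sup>2)) (sqrt (pi / c))"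
proof -
  have "has_bochner_integral lborel (\<lambda>x. exp (- x\<^sup>2)) (sqrt pi)"
    using has_bochner_integral_even_function[OF gaussian_moment_0] by simp
  then have "has_bochner_integral lborel (\<lambda>t. exp (- (0 + sqrt c * t)\<^sup>2)) (sqrt pi /\<^sub>R \<bar>sqrt c\<bar>)"
    by (rule lborel_has_bochner_integral_real_affine_iff[THEN iffD1, rotated]) (use assms in auto)
  then show ?thesis using assms
    by (simp add: power_mult_distrib real_sqrt_divide field_simps)
qed

text \<open>This is the characteristic function of the standard normal law at
  \<open>d / sqrt b\<close>, rescaled by \<open>sqrt b\<close>. It supplies the main term of the
  Fourier inversion.\<close>

lemma gaussian_cos_has_bochner_integral:
  fixes b d :: real
  assumes b: "b > 0"
  shows "has_bochner_integral lborel (\<lambda>t. exp (- b * t\<^sup>2 / 2) * cos (d * t))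
           (sqrt (2 * pi / b) * exp (- d\<^sup>2 / (2 * b)))"
proof -
  define s where "s = d / sqrt b"
  have int: "integrable lborel (\<lambda>x. std_normal_density x * cos (s * x))"
    by (rule Bochner_Integration.integrable_bound[OF integrable_normal_density[of 1 0]])
       (auto simp: abs_mult intro!: mult_left_le)
  have "complex_of_real (exp (- (s^2) / 2)) = (CLINT x|std_normal_distribution. iexp (s * x))"
    using char_std_normal_distribution[THEN fun_cong, of s] by (simp add: char_def)
  also have "\<dots> = (CLBINT x. std_normal_density x *\<^sub>R iexp (s * x))"
    by (subst integral_density) auto
  finally have "exp (- (s^2) / 2) = Re (CLBINT x. std_normal_density x *\<^sub>R iexp (s * x))"
    by (metis Re_complex_of_real)
  also have "\<dots> = (LBINT x. Re (std_normal_density x *\<^sub>R iexp (s * x)))"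
  proof (rule integral_Re[symmetric])
    show "complex_integrable lborel (\<lambda>x. std_normal_density x *\<^sub>R iexp (s * x))"
      by (rule Bochner_Integration.integrable_bound[OF integrable_normal_density[of 1 0]]) (auto simp: )
  qed
  also have "\<dots> = (LBINT x. std_normal_density x * cos (s * x))"
    by (simp add: Re_exp)
  finally have "has_bochner_integral lborel (\<lambda>x. std_normal_density x * cos (s * x)) (exp (- (s^2) / 2))"
    using int by (simp add: has_bochner_integral_iff)
  then have "has_bochner_integral lborel (\<lambda>x. sqrt (2 * pi) * (std_normal_density x * cos (s * x)))
     (sqrt (2*pi) * exp (- (s^2) / 2))"
    by (rule has_bochner_integral_mult_right)
  then have "has_bochner_integral lborel (\<lambda>x. exp (- x\<^sup>2 / 2) * cos (s * x)) (sqrt (2*pi) * exp (- (s^2) / 2))"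
    by (simp add: std_normal_density_def)
  then have "has_bochner_integral lborel (\<lambda>t. exp (- (0 + sqrt b * t)\<^sup>2 / 2) * cos (s * (0 + sqrt b * t)))
     ((sqrt (2*pi) * exp (- (s^2) / 2)) /\<^sub>R \<bar>sqrt b\<bar>)"
    by (rule lborel_has_bochner_integral_real_affine_iff[THEN iffD1, rotated]) (use assms in auto)
  moreover have "s * sqrt b = d" using b by (simp add: s_def)
  moreover have "(0 + sqrt b * t)\<^sup>2 = b * t\<^sup>2" for t using b by (simp add: power_mult_distrib)
  moreover have "s\<^sup>2 / 2 = d\<^sup>2 / (2 * b)" using b by (simp add: s_def power_divide)
  ultimately show ?thesis using b
    by (simp add: real_sqrt_divide real_sqrt_mult field_simps)
qed

section \<open>Mean profiles near \<open>u = 1\<close>\<close>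

lemma profile_le_num_nodes: "profile t k \<le> num_nodes t"
proof (induction t arbitrary: k)
  case (Node ts)
  have "(\<Sum>t\<leftarrow>ts. profile t j) \<le> (\<Sum>t\<leftarrow>ts. num_nodes t)" for j
    using Node by (intro sum_list_mono) auto
  then show ?case by (cases k) (simp, simp add: le_SucI)
qed

lemma finite_range_profile: "finite (range (profile t))"
  using profile_le_num_nodes[of t] by (auto intro!: finite_subset[of _ "{..num_nodes t}"])

lemma profile_le_width: "profile t k \<le> width t"
  unfolding width_def using finite_range_profile by (intro Max_ge) auto

lemma width_attained: "\<exists>k. profile t k = width t"
  using Max_in[OF finite_range_profile[of t]] unfolding width_def by auto

lemma width_ge_1: "width t \<ge> 1"
proof -
  have "profile t 0 = 1" by (cases t) simp
  then show ?thesis using profile_le_width[of t 0] by simp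
qed

lemma width_le_num_nodes: "width t \<le> num_nodes t"
  using width_attained[of t] profile_le_num_nodes[of t] by metis

lemma Lg_ge_1 [simp]: "Lg n \<ge> 1" and Lg_pos [simp]: "Lg n > 0"
  by (auto simp: Lg_def intro: less_le_trans[of 0 1])

lemma Lg_eq_ln: "n \<ge> 3 \<Longrightarrow> Lg n = ln (real n)"
proof -
  assume "n \<ge> 3"
  then have "exp 1 \<le> real n" using exp_le by linarith
  then have "1 \<le> ln (real n)" using \<open>n \<ge> 3\<close> by (subst ln_ge_iff) auto
  then show ?thesis by (simp add: Lg_def)
qed

lemma exp_Lg: "n \<ge> 3 \<Longrightarrow> exp (Lg n) = real n"
  by (simp add: Lg_eq_ln)

lemma Lg_mono: "1 \<le> m \<Longrightarrow> m \<le> n \<Longrightarrow> Lg m \<le> Lg n"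
  unfolding Lg_def by (intro max.mono) auto

lemma eventually_Lg_eq_ln: "\<forall>\<^sub>F n in sequentially. Lg n = ln (real n)"
  using eventually_ge_at_top[of 3] by eventually_elim (rule Lg_eq_ln)

lemma Lg_at_top: "filterlim Lg at_top sequentially"
proof -
  have "filterlim (\<lambda>n. ln (real n)) at_top sequentially" by real_asymp
  then show ?thesis
    by (rule filterlim_mono_eventually) (use eventually_Lg_eq_ln in \<open>auto elim: eventually_mono\<close>)
qed

lemma eventually_Lg_comp: "\<forall>\<^sub>F x in at_top. P x \<Longrightarrow> \<forall>\<^sub>F n in sequentially. P (Lg n)"
  using Lg_at_top by (auto simp: filterlim_iff)

section \<open>The random tree family under conditions (I), (II) and (III)\<close>

locale profile_family =
  fixes M :: "nat \<Rightarrow> 'a measure" and T :: "nat \<Rightarrow> 'a \<Rightarrow> rtree"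
    and f g :: "complex \<Rightarrow> complex" and \<epsilon>0 :: real
  assumes family: "random_tree_family M T"
    and cond_I: "cond_I M T f g \<epsilon>0"
    and small_radius: "small_radius f \<epsilon>0"
    and cond_II: "cond_II M T \<epsilon>0"
    and cond_III: "cond_III M T f"
    and variance_pos: "fp1 f + fpp1 f > 0"
begin

abbreviation "mu \<equiv> mean_profile M T"
abbreviation "s2 \<equiv> fp1 f + fpp1 f"
abbreviation "Y n k \<omega> \<equiv> real (profile (T n \<omega>) k)"
abbreviation "W n \<omega> \<equiv> real (width (T n \<omega>))"
abbreviation "D \<equiv> Dlt f"

lemma prob_space_M: "n \<ge> 1 \<Longrightarrow> prob_space (M n)"
  and T_measurable [measurable]: "n \<ge> 1 \<Longrightarrow> T n \<in> measurable (M n) (count_space UNIV)"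
  and profile_eq_0: "n \<ge> 1 \<Longrightarrow> \<omega> \<in> space (M n) \<Longrightarrow> k > n \<Longrightarrow> profile (T n \<omega>) k = 0"
  using family unfolding random_tree_family_def by auto

text \<open>\<open>random_tree_family\<close> only asserts that a bound exists; one is fixed here
  for the whole locale. It makes powers of the profile and of the width integrable, and it pays for
  the far levels in the moments of the width.\<close>

definition node_bound :: real where
  "node_bound = real (SOME K. \<forall>n\<ge>1. \<forall>\<omega>\<in>space (M n). num_nodes (T n \<omega>) \<le> K * n)"

lemma num_nodes_le: "n \<ge> 1 \<Longrightarrow> \<omega> \<in> space (M n) \<Longrightarrow> real (num_nodes (T n \<omega>)) \<le> node_bound * real n"
proof -
  assume *: "n \<ge> 1" "\<omega> \<in> space (M n)"
  have "\<exists>K. \<forall>n\<ge>1. \<forall>\<omega>\<in>space (M n). num_nodes (T n \<omega>) \<le> K * n"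
    using family unfolding random_tree_family_def by auto
  from someI_ex[OF this] have "num_nodes (T n \<omega>) \<le> (SOME K. \<forall>n\<ge>1. \<forall>\<omega>\<in>space (M n). num_nodes (T n \<omega>) \<le> K * n) * n"
    using * by blast
  then show ?thesis unfolding node_bound_def
    by (simp only: of_nat_mult[symmetric] of_nat_le_iff)
qed

lemma Y_le: "n \<ge> 1 \<Longrightarrow> \<omega> \<in> space (M n) \<Longrightarrow> Y n k \<omega> \<le> node_bound * real n"
  using num_nodes_le[of n \<omega>] profile_le_num_nodes[of "T n \<omega>" k] by linarith

lemma W_le: "n \<ge> 1 \<Longrightarrow> \<omega> \<in> space (M n) \<Longrightarrow> W n \<omega> \<le> node_bound * real n"
  using num_nodes_le[of n \<omega>] width_le_num_nodes[of "T n \<omega>"] by linarith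

lemma node_bound_nonneg: "node_bound \<ge> 0"
  by (simp add: node_bound_def)

lemma integrable_of_tree:
  fixes F :: "rtree \<Rightarrow> real"
  assumes "n \<ge> 1" and "\<And>\<omega>. \<omega> \<in> space (M n) \<Longrightarrow> \<bar>F (T n \<omega>)\<bar> \<le> B"
  shows "integrable (M n) (\<lambda>\<omega>. F (T n \<omega>))"
proof -
  interpret prob_space "M n" by (rule prob_space_M[OF assms(1)])
  have "(\<lambda>\<omega>. F (T n \<omega>)) \<in> borel_measurable (M n)"
    using measurable_compose[OF T_measurable[OF assms(1)], of F borel] by simp
  then show ?thesis
    by (intro integrable_const_bound[where B=B]) (use assms in auto)
qed

lemma measurable_of_tree [measurable]:
  fixes F :: "rtree \<Rightarrow> real"
  shows "n \<ge> 1 \<Longrightarrow> (\<lambda>\<omega>. F (T n \<omega>)) \<in> borel_measurable (M n)"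
  using measurable_compose[OF T_measurable, of n F borel] by simp

lemma integrable_Y_power:
  assumes "n \<ge> 1" shows "integrable (M n) (\<lambda>\<omega>. \<bar>Y n k \<omega> - c\<bar> ^ m)"
proof (rule integrable_of_tree[OF assms, where F="\<lambda>t. \<bar>real (profile t k) - c\<bar> ^ m"])
  fix \<omega> assume "\<omega> \<in> space (M n)"
  then have "\<bar>Y n k \<omega> - c\<bar> \<le> node_bound * real n + \<bar>c\<bar>"
    using Y_le[OF assms, of \<omega> k] by linarith
  then show "\<bar>\<bar>Y n k \<omega> - c\<bar> ^ m\<bar> \<le> (node_bound * real n + \<bar>c\<bar>) ^ m"
    by (simp add: power_mono)
qed

lemma integrable_W_power:
  assumes "n \<ge> 1" shows "integrable (M n) (\<lambda>\<omega>. \<bar>W n \<omega> - c\<bar> ^ m)"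
proof (rule integrable_of_tree[OF assms, where F="\<lambda>t. \<bar>real (width t) - c\<bar> ^ m"])
  fix \<omega> assume "\<omega> \<in> space (M n)"
  then have "\<bar>W n \<omega> - c\<bar> \<le> node_bound * real n + \<bar>c\<bar>"
    using W_le[OF assms, of \<omega>] by linarith
  then show "\<bar>\<bar>W n \<omega> - c\<bar> ^ m\<bar> \<le> (node_bound * real n + \<bar>c\<bar>) ^ m"
    by (simp add: power_mono)
qed

lemma integrable_Y: "n \<ge> 1 \<Longrightarrow> integrable (M n) (Y n k)"
  using integrable_Y_power[of n k 0 1] by simp

lemma integrable_W: "n \<ge> 1 \<Longrightarrow> integrable (M n) (W n)"
  using integrable_W_power[of n 0 1] by simp

lemma mu_nonneg: "mu n k \<ge> 0"
  unfolding mean_profile_def by (rule Bochner_Integration.integral_nonneg) auto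

lemma mu_eq_0: "n \<ge> 1 \<Longrightarrow> k > n \<Longrightarrow> mu n k = 0"
  unfolding mean_profile_def
  by (subst Bochner_Integration.integral_cong[of "M n" "M n" _ "\<lambda>_. 0"]) (auto simp: profile_eq_0)

lemma Xi_of_real: "Xi M T n (complex_of_real x) = complex_of_real (\<Sum>k\<le>n. mu n k * x ^ k)"
  by (simp add: Xi_def)

lemma eps0_pos: "\<epsilon>0 > 0" and f_analytic: "f analytic_on cball 1 \<epsilon>0"
  and g_analytic: "g analytic_on cball 1 \<epsilon>0" and f_1: "f 1 = 1" and g_1: "g 1 = 1"
  using cond_I unfolding cond_I_def by auto

lemma powr_eq_exp: "n \<ge> 3 \<Longrightarrow> (of_nat n :: complex) powr w = exp (w * of_real (Lg n))"
  by (simp add: powr_def Lg_eq_ln Ln_of_nat)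

text \<open>Condition (I) with complex powers of \<open>n\<close> turned into exponentials of
  \<open>Lg n\<close>, which is \<open>ln n\<close> from 3 on, and with a nonnegative
  constant.\<close>

lemma Xi_asymp:
  obtains e C where "e > 0" "C \<ge> 0"
    "\<forall>\<^sub>F n in sequentially. \<forall>u. cmod (u - 1) \<le> \<epsilon>0 \<longrightarrow>
       (\<exists>r. cmod r \<le> C * exp (- e * Lg n) \<and> Xi M T n u = g u * exp (f u * of_real (Lg n)) * (1 + r))"
proof -
  obtain e C where e: "e > 0" and ev: "\<forall>\<^sub>F n in sequentially. \<forall>u. cmod (u - 1) \<le> \<epsilon>0 \<longrightarrow>
        (\<exists>r. cmod r \<le> C * real n powr (-e) \<and> Xi M T n u = g u * (of_nat n powr f u) * (1 + r))"
    using cond_I unfolding cond_I_def by blast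
  have "\<forall>\<^sub>F n in sequentially. \<forall>u. cmod (u - 1) \<le> \<epsilon>0 \<longrightarrow>
       (\<exists>r. cmod r \<le> max C 0 * exp (- e * Lg n) \<and> Xi M T n u = g u * exp (f u * of_real (Lg n)) * (1 + r))"
    using ev eventually_ge_at_top[of 3]
  proof eventually_elim
    case (elim n)
    have *: "real n powr (-e) = exp (- e * Lg n)"
      using elim(2) by (simp add: powr_def Lg_eq_ln)
    have "C * exp (- e * Lg n) \<le> max C 0 * exp (- e * Lg n)"
      by (intro mult_right_mono) auto
    then show ?case using elim(1) unfolding * powr_eq_exp[OF elim(2)] by (meson order_trans)
  qed
  then show ?thesis using e that[of e "max C 0"] by simp
qed

text \<open>Mean profiles are real, so at a real point \<open>x\<close> near 1 the quotients of
  \<open>Xi M T (2 * n)\<close> by \<open>Xi M T n\<close> are real. Since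
  \<open>Lg (2 * n) = Lg n + ln 2\<close> and \<open>g x\<close> cancels, they tend to
  \<open>exp (f x * ln 2)\<close>, which is therefore real; the imaginary part of \<open>f x\<close>
  is then a multiple of \<open>pi / ln 2\<close>, and it is too small to be a nonzero one. With
  \<open>f x\<close> real, \<open>g x\<close> is a limit of real numbers.\<close>

lemma f_g_real_near_1:
  obtains \<rho> where "\<rho> > 0" "\<rho> \<le> \<epsilon>0"
    "\<And>x. \<bar>x - 1\<bar> < \<rho> \<Longrightarrow> f (complex_of_real x) \<in> \<real>"
    "\<And>x. \<bar>x - 1\<bar> < \<rho> \<Longrightarrow> g (complex_of_real x) \<in> \<real>"
proof -
  have cf: "isCont f 1" and cg: "isCont g 1"
    using f_analytic g_analytic eps0_pos
    by (auto intro!: analytic_at_imp_isCont intro: analytic_on_subset)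
  have "\<forall>\<^sub>F u in nhds 1. g u \<noteq> 0"
    using cg unfolding isCont_def tendsto_at_iff_tendsto_nhds
    by (rule tendsto_imp_eventually_ne) (simp add: g_1)
  moreover have "\<forall>\<^sub>F u in nhds 1. \<bar>Im (f u)\<bar> < 1"
  proof -
    have "((\<lambda>u. \<bar>Im (f u)\<bar>) \<longlongrightarrow> \<bar>Im (f 1)\<bar>) (nhds 1)"
      using cf unfolding isCont_def tendsto_at_iff_tendsto_nhds by (intro tendsto_intros)
    then show ?thesis by (rule order_tendstoD) (simp add: f_1)
  qed
  ultimately have "\<forall>\<^sub>F u in nhds 1. g u \<noteq> 0 \<and> \<bar>Im (f u)\<bar> < 1"
    by (rule eventually_conj)
  \<comment> \<open>Nonvanishing of \<open>g\<close> permits the divisions below; the bound on the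
    imaginary part selects the zero of the sine at 0.\<close>
  then obtain d where d: "d > 0" "\<And>u. dist u 1 < d \<Longrightarrow> g u \<noteq> 0 \<and> \<bar>Im (f u)\<bar> < 1"
    by (auto simp: eventually_nhds_metric)
  obtain e C where eC: "e > 0" "C \<ge> 0"
    "\<forall>\<^sub>F n in sequentially. \<forall>u. cmod (u - 1) \<le> \<epsilon>0 \<longrightarrow>
       (\<exists>r. cmod r \<le> C * exp (- e * Lg n) \<and> Xi M T n u = g u * exp (f u * of_real (Lg n)) * (1 + r))"
    by (rule Xi_asymp)
  have lim0: "(\<lambda>n. C * exp (- e * Lg n)) \<longlonglongrightarrow> 0"
  proof -
    have "((\<lambda>x. C * exp (- e * x)) \<longlongrightarrow> 0) at_top" using eC(1) by real_asymp
    then show ?thesis by (rule filterlim_compose[OF _ Lg_at_top])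
  qed
  have key: "f (complex_of_real x) \<in> \<real> \<and> g (complex_of_real x) \<in> \<real>"
    if x: "\<bar>x - 1\<bar> < min d \<epsilon>0" for x
  proof -
    let ?u = "complex_of_real x"
    have nx: "cmod (?u - 1) = \<bar>x - 1\<bar>"
      by (metis norm_of_real of_real_1 of_real_diff)
    have g0: "g ?u \<noteq> 0" and im: "\<bar>Im (f ?u)\<bar> < 1" using d(2)[of ?u] x nx by (auto simp: dist_norm)
    have "\<forall>\<^sub>F n in sequentially. \<exists>r. cmod r \<le> C * exp (- e * Lg n) \<and>
            Xi M T n ?u = g ?u * exp (f ?u * of_real (Lg n)) * (1 + r)"
      using eC(3) by eventually_elim (use x nx in auto)
    then have "\<forall>\<^sub>F n in sequentially. 
       cmod (Xi M T n ?u / (g ?u * exp (f ?u * of_real (Lg n))) - 1) \<le> C * exp (- e * Lg n)"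
      by eventually_elim (use g0 in auto)
    then have "(\<lambda>n. Xi M T n ?u / (g ?u * exp (f ?u * of_real (Lg n))) - 1) \<longlonglongrightarrow> 0"
      by (rule Lim_null_comparison[OF _ lim0])
    then have "(\<lambda>n. (Xi M T n ?u / (g ?u * exp (f ?u * of_real (Lg n))) - 1) + 1) \<longlonglongrightarrow> 0 + 1"
      by (intro tendsto_intros)
    then have lim: "(\<lambda>n. Xi M T n ?u / (g ?u * exp (f ?u * of_real (Lg n)))) \<longlonglongrightarrow> 1"
      by simp
    have lim2: "(\<lambda>n. Xi M T (2 * n) ?u / (g ?u * exp (f ?u * of_real (Lg (2 * n))))) \<longlonglongrightarrow> 1"
      using filterlim_compose[OF lim, of "\<lambda>n. 2 * n" sequentially]
      by (simp add: mult_nat_left_at_top)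
    have "(\<lambda>n. exp (f ?u * of_real (ln 2)) *
         ((Xi M T (2 * n) ?u / (g ?u * exp (f ?u * of_real (Lg (2 * n))))) /
          (Xi M T n ?u / (g ?u * exp (f ?u * of_real (Lg n)))))) \<longlonglongrightarrow> exp (f ?u * of_real (ln 2)) * (1 / 1)"
      by (intro tendsto_intros lim lim2) simp
    then have "(\<lambda>n. Xi M T (2 * n) ?u / Xi M T n ?u) \<longlonglongrightarrow> exp (f ?u * of_real (ln 2)) * (1 / 1)"
    proof (rule Lim_transform_eventually)
      show "\<forall>\<^sub>F n in sequentially. exp (f ?u * of_real (ln 2)) *
         ((Xi M T (2 * n) ?u / (g ?u * exp (f ?u * of_real (Lg (2 * n))))) /
          (Xi M T n ?u / (g ?u * exp (f ?u * of_real (Lg n))))) = Xi M T (2 * n) ?u / Xi M T n ?u"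
        using eventually_ge_at_top[of 3]
      proof eventually_elim
        case (elim n)
        have "Lg (2 * n) = Lg n + ln 2" using elim by (simp add: Lg_eq_ln ln_mult)
        then have "exp (f ?u * of_real (Lg (2 * n))) = exp (f ?u * of_real (ln 2)) * exp (f ?u * of_real (Lg n))"
          by (simp add: algebra_simps exp_add)
        then show ?case using g0 by (simp add: field_simps)
      qed
    qed
    then have "exp (f ?u * of_real (ln 2)) * (1 / 1) \<in> \<real>"
      by (rule closed_sequentially[OF closed_complex_Reals, rotated])
         (unfold Xi_of_real, auto)
    then have "sin (Im (f ?u) * ln 2) = 0" 
      by (simp add: complex_is_Real_iff Im_exp)
    moreover have "\<bar>Im (f ?u) * ln 2\<bar> < pi"
    proof -
      have "\<bar>Im (f ?u) * ln 2\<bar> \<le> 1 * 1"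
        unfolding abs_mult by (intro mult_mono) (use im ln_2_less_1 in auto)
      then show ?thesis using pi_gt3 by linarith
    qed
    ultimately have "Im (f ?u) * ln 2 = 0"
      by (metis abs_less_iff sin_eq_0_pi minus_less_iff)
    then have fr: "f ?u \<in> \<real>" by (simp add: complex_is_Real_iff)
    have "(\<lambda>n. (Xi M T n ?u / (g ?u * exp (f ?u * of_real (Lg n)))) * g ?u) \<longlonglongrightarrow> 1 * g ?u"
      by (intro tendsto_intros lim)
    then have glim: "(\<lambda>n. Xi M T n ?u / exp (f ?u * of_real (Lg n))) \<longlonglongrightarrow> g ?u"
      using g0 by simp
    have "exp (f ?u * of_real (Lg n)) \<in> \<real>" for n
      using fr by (simp add: complex_is_Real_iff Im_exp)
    then have "\<forall>n. Xi M T n ?u / exp (f ?u * of_real (Lg n)) \<in> \<real>"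
      unfolding Xi_of_real by (intro allI Reals_divide) auto
    then have "g ?u \<in> \<real>"
      by (intro closed_sequentially[OF closed_complex_Reals _ glim]) auto
    with fr show ?thesis ..
  qed
  show ?thesis
    by (rule that[of "min d \<epsilon>0"]) (use key d(1) eps0_pos in auto)
qed

text \<open>The variable \<open>z = ln u\<close> serves both uses: \<open>z = i t\<close> for
  Fourier inversion, \<open>z\<close> real for exponential moments. What matters is that
  \<open>a\<close> and \<open>b\<close> are real, so that on the imaginary axis the odd terms are
  purely imaginary.\<close>

lemma Taylor_at_1:
  obtains \<delta> C a b :: real where "\<delta> > 0" "C \<ge> 0"
    "\<And>z::complex. cmod z \<le> \<delta> \<Longrightarrow> cmod (exp z - 1) \<le> \<epsilon>0"
    "\<And>z::complex. cmod z \<le> \<delta> \<Longrightarrow>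
       cmod (f (exp z) - (1 + fp1 f * z + s2 / 2 * z ^ 2 + a * z ^ 3)) \<le> C * cmod z ^ 4"
    "\<And>z::complex. cmod z \<le> \<delta> \<Longrightarrow> cmod (g (exp z) - (1 + b * z)) \<le> C * cmod z ^ 2"
proof -
  obtain \<rho> where \<rho>: "\<rho> > 0" "\<rho> \<le> \<epsilon>0"
    "\<And>x. \<bar>x - 1\<bar> < \<rho> \<Longrightarrow> f (complex_of_real x) \<in> \<real>"
    "\<And>x. \<bar>x - 1\<bar> < \<rho> \<Longrightarrow> g (complex_of_real x) \<in> \<real>"
    by (rule f_g_real_near_1) blast
  have "isCont (exp :: complex \<Rightarrow> complex) 0" by simp
  then obtain r where r: "r > 0" "\<And>z::complex. cmod z < r \<Longrightarrow> cmod (exp z - 1) < \<rho>"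
    using \<rho>(1) unfolding continuous_at_eps_delta by (auto simp: dist_norm)
  define h where "h = (\<lambda>z. f (exp z))"
  define G where "G = (\<lambda>z. g (exp z))"
  have fh: "f holomorphic_on ball 1 \<rho>" and gh: "g holomorphic_on ball 1 \<rho>"
    by (rule holomorphic_on_subset[OF analytic_imp_holomorphic[OF f_analytic]], use \<rho>(2) in force)
       (rule holomorphic_on_subset[OF analytic_imp_holomorphic[OF g_analytic]], use \<rho>(2) in force)
  have sub: "exp ` ball 0 r \<subseteq> ball (1::complex) \<rho>"
    using r by (auto simp: dist_norm norm_minus_commute)
  have hh: "h holomorphic_on ball 0 r" and Gh: "G holomorphic_on ball 0 r"
    unfolding h_def G_def
    using holomorphic_on_compose_gen[OF holomorphic_on_exp fh sub]
      holomorphic_on_compose_gen[OF holomorphic_on_exp gh sub] by (auto simp: o_def)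
  have re: "\<bar>exp x - 1\<bar> < \<rho>" if "\<bar>x\<bar> < r" for x :: real
  proof -
    have "exp (complex_of_real x) - 1 = complex_of_real (exp x - 1)" by (simp add: exp_of_real)
    then have "cmod (exp (complex_of_real x) - 1) = \<bar>exp x - 1\<bar>" by (simp only: norm_of_real)
    then show ?thesis using r(2)[of "of_real x"] that by simp
  qed
  have hr: "h (complex_of_real x) \<in> \<real>" and Gr: "G (complex_of_real x) \<in> \<real>" if "\<bar>x\<bar> < r" for x
    using \<rho>(3,4)[OF re[OF that]] by (simp_all add: h_def G_def exp_of_real)
  have hdr: "(deriv ^^ i) h 0 \<in> \<real>" and Gdr: "(deriv ^^ i) G 0 \<in> \<real>" for i
    using higher_deriv_real_on_reals[OF hh hr, of 0 i] higher_deriv_real_on_reals[OF Gh Gr, of 0 i] r(1)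
    by auto
  have fd: "(f has_field_derivative deriv f u) (at u)"
    and fdd: "(deriv f has_field_derivative deriv (deriv f) u) (at u)" if "u \<in> ball 1 \<rho>" for u
    using holomorphic_derivI[OF fh _ that] holomorphic_derivI[OF holomorphic_deriv[OF fh] _ that] by auto
  have dh: "deriv h z = deriv f (exp z) * exp z" if "z \<in> ball 0 r" for z
    unfolding h_def
  proof (rule DERIV_imp_deriv)
    have "exp z \<in> ball 1 \<rho>" using sub that by blast
    from DERIV_chain2[OF fd[OF this] DERIV_exp]
    show "((\<lambda>z. f (exp z)) has_field_derivative deriv f (exp z) * exp z) (at z)" .
  qed
  \<comment> \<open>The chain rule adds \<open>deriv f 1\<close> to the second derivative of
    \<open>f\<close>; this is where the variance constant \<open>fp1 f + fpp1 f\<close> comes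
    from.\<close>
  have ddh: "deriv (deriv h) 0 = deriv (deriv f) 1 + deriv f 1"
  proof -
    have "deriv (deriv h) 0 = deriv (\<lambda>z. deriv f (exp z) * exp z) 0"
    proof (rule deriv_cong_ev)
      show "\<forall>\<^sub>F z in nhds 0. deriv h z = deriv f (exp z) * exp z"
        unfolding eventually_nhds using dh r(1) by (intro exI[of _ "ball 0 r"]) auto
    qed simp
    also have "\<dots> = deriv (deriv f) 1 + deriv f 1"
    proof (rule DERIV_imp_deriv)
      have "((\<lambda>z. deriv f (exp z)) has_field_derivative deriv (deriv f) (exp 0) * exp 0) (at (0::complex))"
        by (rule DERIV_chain2[OF fdd DERIV_exp]) (use \<rho>(1) in simp)
      from DERIV_mult[OF this DERIV_exp]
      show "((\<lambda>z. deriv f (exp z) * exp z) has_field_derivative deriv (deriv f) 1 + deriv f 1) (at 0)"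
        by simp
    qed
    finally show ?thesis .
  qed
  have d1: "deriv h 0 = of_real (fp1 f)"
    using hdr[of 1] dh[of 0] r(1) by (simp add: fp1_def of_real_Re)
  have d2: "deriv (deriv h) 0 = of_real s2"
  proof -
    have "deriv (deriv h) 0 = of_real (Re (deriv (deriv h) 0))"
      using hdr[of 2] by (simp add: numeral_2_eq_2 of_real_Re)
    also have "\<dots> = of_real s2" unfolding ddh by (simp add: fp1_def fpp1_def)
    finally show ?thesis .
  qed
  define a where "a = Re ((deriv ^^ 3) h 0) / 6"
  define b where "b = Re ((deriv ^^ 1) G 0)"
  have d3: "deriv (deriv (deriv h)) 0 = of_real (6 * a)"
    using hdr[of 3] by (simp add: a_def of_real_Re numeral_3_eq_3)
  have e1: "deriv G 0 = of_real b"
    using Gdr[of 1] by (simp add: b_def of_real_Re)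
  obtain C1 where C1: "C1 \<ge> 0" "\<And>z. cmod z \<le> r / 2 \<Longrightarrow>
      cmod (h z - (\<Sum>i\<le>3. (deriv ^^ i) h 0 * z ^ i / fact i)) \<le> C1 * cmod z ^ Suc 3"
    using higher_deriv_Taylor_bound[OF hh r(1), of 3] by blast
  obtain C2 where C2: "C2 \<ge> 0" "\<And>z. cmod z \<le> r / 2 \<Longrightarrow>
      cmod (G z - (\<Sum>i\<le>1. (deriv ^^ i) G 0 * z ^ i / fact i)) \<le> C2 * cmod z ^ Suc 1"
    using higher_deriv_Taylor_bound[OF Gh r(1), of 1] by blast
  have s1: "(\<Sum>i\<le>3. (deriv ^^ i) h 0 * z ^ i / fact i) = 1 + fp1 f * z + s2 / 2 * z ^ 2 + a * z ^ 3" for z :: complex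
    by (simp add: numeral_3_eq_3 d1 d2 d3 h_def[THEN fun_cong] f_1 fact_numeral field_simps power2_eq_square)
  have s2: "(\<Sum>i\<le>1. (deriv ^^ i) G 0 * z ^ i / fact i) = 1 + b * z" for z :: complex
    by (simp add: e1) (simp add: G_def g_1)
  show ?thesis
  proof (rule that[of "r / 2" "max C1 C2" a b])
    fix z :: complex assume z: "cmod z \<le> r / 2"
    show "cmod (exp z - 1) \<le> \<epsilon>0" using r(2)[of z] z r(1) \<rho>(2) by linarith
    show "cmod (f (exp z) - (1 + fp1 f * z + s2 / 2 * z ^ 2 + a * z ^ 3)) \<le> max C1 C2 * cmod z ^ 4"
      using C1(2)[OF z] unfolding s1
      by (simp add: h_def) (meson max.cobounded1 mult_right_mono norm_ge_zero order_trans zero_le_power)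
    show "cmod (g (exp z) - (1 + b * z)) \<le> max C1 C2 * cmod z ^ 2"
      using C2(2)[OF z] unfolding s2
      by (simp add: G_def power2_eq_square) (meson max.cobounded2 mult_right_mono mult_nonneg_nonneg norm_ge_zero order_trans)
  qed (use r C1 C2 in auto)
qed

end

section \<open>Local limit theorem for the mean profile\<close>

text \<open>For \<open>j > 0\<close>, raise \<open>x <= exp x\<close> at
  \<open>x = c * y / j\<close> to the power \<open>j\<close>.\<close>

lemma power_le_exp_mult:
  fixes c :: real
  assumes "c > 0"
  shows "\<exists>B\<ge>0. \<forall>y\<ge>0. y ^ j \<le> B * exp (c * y)"
proof (cases "j = 0")
  case True
  then show ?thesis using assms by (intro exI[of _ 1]) auto
next
  case False
  have "y ^ j \<le> (real j / c) ^ j * exp (c * y)" if "y \<ge> 0" for y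
  proof -
    have "c * y / real j \<le> exp (c * y / real j)"
      using exp_ge_add_one_self[of "c * y / real j"] by linarith
    then have "y \<le> real j / c * exp (c * y / real j)"
      using assms False by (simp add: field_simps)
    then have "y ^ j \<le> (real j / c * exp (c * y / real j)) ^ j"
      using that by (rule power_mono)
    also have "\<dots> = (real j / c) ^ j * exp (c * y)"
    proof -
      have "exp (c * y / real j) ^ j = exp (c * y)"
        using False by (simp add: exp_of_nat_mult[symmetric])
      then show ?thesis by (simp only: power_mult_distrib)
    qed
    finally show ?thesis .
  qed
  then show ?thesis using assms by (intro exI[of _ "(real j / c) ^ j"]) auto
qed

text \<open>The first-order terms of \<open>exp q * G\<close> are purely imaginary, so they contribute to the real
  part only through \<open>sin x\<close>, which is \<open>O(x)\<close>.\<close>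

lemma Re_perturbed_cis_bound:
  fixes q G r R4 R2 :: complex and p b x :: real
  assumes q: "q = \<i> * p + R4" and G: "G = 1 + \<i> * b + R2"
  shows "\<bar>Re (cis (- x) * (exp q * G * (1 + r))) - cos x\<bar>
    \<le> \<bar>x\<bar> * (\<bar>p\<bar> + \<bar>b\<bar>) + (cmod R4 + cmod R2 + cmod q * cmod (G - 1)
        + (cmod q)\<^sup>2 * exp (cmod q) * cmod G) + exp (cmod q) * cmod G * cmod r"
proof -
  define E where "E = exp q - (1 + q)"
  have E: "cmod E \<le> (cmod q)\<^sup>2 * exp (cmod q)"
  proof -
    have "cmod (exp q - (\<Sum>i\<le>1. q ^ i / fact i)) \<le> exp \<bar>Re q\<bar> * (cmod q) ^ Suc 1 / fact 1"
      by (rule Taylor_exp)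
    then have "cmod E \<le> exp \<bar>Re q\<bar> * (cmod q)\<^sup>2" by (simp add: E_def power2_eq_square)
    also have "\<dots> \<le> exp (cmod q) * (cmod q)\<^sup>2"
      by (intro mult_right_mono) (auto simp: abs_Re_le_cmod)
    finally show ?thesis by (simp add: mult.commute)
  qed
  \<comment> \<open>\<open>S\<close> is what remains of \<open>exp q * G\<close> after 1 and the
    imaginary first-order part \<open>i (p + b)\<close> have been split off.\<close>
  define S where "S = R4 + R2 + q * (G - 1) + E * G"
  have "exp q * G * (1 + r) = 1 + \<i> * of_real (p + b) + (S + exp q * G * r)"
    by (simp add: S_def E_def q G algebra_simps)
  then have "Re (cis (- x) * (exp q * G * (1 + r))) - cos x
      = Re (cis (- x) * (\<i> * of_real (p + b))) + Re (cis (- x) * (S + exp q * G * r))"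
    by (simp only: distrib_left plus_complex.sel) (simp add: cis.sel)
  also have "\<bar>\<dots>\<bar> \<le> \<bar>x\<bar> * (\<bar>p\<bar> + \<bar>b\<bar>) + (cmod S + cmod (exp q * G * r))"
  proof (intro order.trans[OF abs_triangle_ineq] add_mono)
    have "\<bar>Re (cis (- x) * (\<i> * of_real (p + b)))\<bar> = \<bar>sin x\<bar> * \<bar>p + b\<bar>"
      by (simp add: abs_mult)
    also have "\<dots> \<le> \<bar>x\<bar> * (\<bar>p\<bar> + \<bar>b\<bar>)"
      by (intro mult_mono abs_sin_x_le_abs_x) auto
    finally show "\<bar>Re (cis (- x) * (\<i> * of_real (p + b)))\<bar> \<le> \<bar>x\<bar> * (\<bar>p\<bar> + \<bar>b\<bar>)" .
    have "\<bar>Re (cis (- x) * (S + exp q * G * r))\<bar> \<le> cmod (cis (- x) * (S + exp q * G * r))"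
      by (rule abs_Re_le_cmod)
    also have "\<dots> \<le> cmod S + cmod (exp q * G * r)"
      using norm_triangle_ineq[of S "exp q * G * r"] by (simp add: norm_mult)
    finally show "\<bar>Re (cis (- x) * (S + exp q * G * r))\<bar> \<le> cmod S + cmod (exp q * G * r)" .
  qed
  also have "cmod S \<le> cmod R4 + cmod R2 + cmod q * cmod (G - 1) + (cmod q)\<^sup>2 * exp (cmod q) * cmod G"
    unfolding S_def
    by (intro order.trans[OF norm_triangle_ineq] add_mono order_refl)
       (auto simp: norm_mult intro!: mult_right_mono E)
  also have "cmod (exp q * G * r) \<le> exp (cmod q) * cmod G * cmod r"
    unfolding norm_mult by (intro mult_right_mono norm_exp) auto
  finally show ?thesis by simp
qed

lemma Re_of_real_mult: "Re (complex_of_real a * w) = a * Re w"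
  by simp

lemma exp_neg_le_powr:
  assumes "c > 0"
  shows "\<forall>\<^sub>F n in sequentially. C * exp (- c * Lg n) \<le> Lg n powr (- p)"
proof -
  have "\<forall>\<^sub>F x in at_top. C * exp (- c * x) \<le> x powr (- p)"
    using assms by real_asymp
  then show ?thesis by (rule eventually_Lg_comp)
qed

lemma cos_has_bochner_integral_period:
  "has_bochner_integral lborel (\<lambda>t. indicator {-pi..pi} t * cos (of_int m * t)) (if m = 0 then 2 * pi else 0)"
proof (cases "m = 0")
  case True
  then show ?thesis
    using has_bochner_integral_real_indicator[of "{-pi..pi}" lborel] by simp
next
  case False
  have "has_bochner_integral lborel (\<lambda>t. cos (of_int m * t) * indicator {-pi..pi} t)
          (sin (of_int m * pi) / of_int m - sin (of_int m * (-pi)) / of_int m)"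
    using False
    by (intro has_bochner_integral_FTC_Icc_real) (auto intro!: derivative_eq_intros)
  moreover have "sin (of_int m * pi) = 0" by (metis sin_times_pi_eq_0 Ints_of_int)
  ultimately show ?thesis using False by (simp add: mult.commute)
qed

section \<open>Fourier inversion and tails of the mean profile\<close>

context profile_family
begin

definition scale :: "nat \<Rightarrow> real" where "scale n = real n * Lg n powr (- 3 / 2)"
definition peak :: "nat \<Rightarrow> real" where "peak n = real n / sqrt (2 * pi * s2 * Lg n)"

text \<open>Inside the disc of (I), \<open>small_radius\<close> gives \<open>Re (f u) < 1\<close> at
  each point of the arc away from 1, and compactness makes this a uniform bound
  \<open>1 - c1\<close>. Outside the disc, (II) applies. Either way a power of \<open>n\<close> is
  saved.\<close>

lemma Xi_off_peak:
  assumes "\<delta> > 0"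
  obtains C c where "C \<ge> 0" "c > 0"
    "\<forall>\<^sub>F n in sequentially. \<forall>t. \<delta> < \<bar>t\<bar> \<and> \<bar>t\<bar> \<le> pi \<longrightarrow> cmod (Xi M T n (cis t)) \<le> C * exp ((1 - c) * Lg n)"
proof -
  define S where "S = cis ` ({-pi..pi} - {-\<delta><..<\<delta>}) \<inter> cball 1 \<epsilon>0"
  have "compact ({-pi..pi} - {-\<delta><..<\<delta>})" by (intro compact_diff) auto
  then have compS: "compact S"
    unfolding S_def by (intro compact_Int_closed compact_continuous_image continuous_intros) auto
  have fcont: "continuous_on (cball 1 \<epsilon>0) f" and gcont: "continuous_on (cball 1 \<epsilon>0) g"
    using f_analytic g_analytic by (auto intro: analytic_imp_holomorphic holomorphic_on_imp_continuous_on)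
  have lt1: "Re (f u) < 1" if "u \<in> S" for u
  proof -
    obtain t where t: "u = cis t" "\<delta> \<le> \<bar>t\<bar>" "\<bar>t\<bar> \<le> pi"
    proof -
      obtain t where "u = cis t" "t \<in> {-pi..pi} - {-\<delta><..<\<delta>}" using \<open>u \<in> S\<close> unfolding S_def by blast
      then show ?thesis by (intro that[of t]) auto
    qed
    have "cos \<bar>t\<bar> < cos 0" using t assms by (intro cos_monotone_0_pi) auto
    then have "u \<noteq> 1" using t by (auto simp: complex_eq_iff)
    then show ?thesis using small_radius t(1) that
      unfolding small_radius_def S_def by (auto simp: dist_norm norm_minus_commute)
  qed
  obtain c1 where c1: "c1 > 0" "\<And>u. u \<in> S \<Longrightarrow> Re (f u) \<le> 1 - c1"
  proof (cases "S = {}")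
    case True
    then show ?thesis using that[of 1] by simp
  next
    case False
    have "continuous_on S (\<lambda>u. Re (f u))"
      by (intro continuous_intros continuous_on_subset[OF fcont]) (auto simp: S_def)
    from continuous_attains_sup[OF compS False this] obtain v where
      "v \<in> S" "\<forall>u\<in>S. Re (f u) \<le> Re (f v)" by blast
    then show ?thesis using that[of "1 - Re (f v)"] lt1[of v] by auto
  qed
  have "bounded (g ` cball 1 \<epsilon>0)"
    by (intro compact_imp_bounded compact_continuous_image gcont) auto
  then obtain Bg where Bg: "\<And>u. u \<in> cball 1 \<epsilon>0 \<Longrightarrow> cmod (g u) \<le> Bg"
    unfolding bounded_iff by blast
  have Bg0: "Bg \<ge> 0" using Bg[of 1] eps0_pos norm_ge_zero[of "g 1"] by (auto simp del: norm_ge_zero)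
  obtain e C where eC: "e > 0" "C \<ge> 0"
    "\<forall>\<^sub>F n in sequentially. \<forall>u. cmod (u - 1) \<le> \<epsilon>0 \<longrightarrow>
       (\<exists>r. cmod r \<le> C * exp (- e * Lg n) \<and> Xi M T n u = g u * exp (f u * of_real (Lg n)) * (1 + r))"
    by (rule Xi_asymp)
  obtain \<epsilon>1 e2 C2 where II: "0 < \<epsilon>1" "e2 > 0"
    "\<forall>\<^sub>F n in sequentially. \<forall>u \<in> {u. 1 - \<epsilon>1 \<le> cmod u \<and> cmod u \<le> 1 + \<epsilon>1} - {u. cmod (u - 1) \<le> \<epsilon>0}.
             cmod (Xi M T n u) \<le> C2 * real n powr (1 - e2)"
    using cond_II unfolding cond_II_def by blast
  define c where "c = min c1 e2"
  define K where "K = max (Bg * (1 + C)) (max C2 0)"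
  have "\<forall>\<^sub>F n in sequentially. \<forall>t. \<delta> < \<bar>t\<bar> \<and> \<bar>t\<bar> \<le> pi \<longrightarrow> cmod (Xi M T n (cis t)) \<le> K * exp ((1 - c) * Lg n)"
    using eC(3) II(3) eventually_ge_at_top[of 3]
  proof eventually_elim
    case (elim n)
    show ?case
    proof (intro allI impI)
      fix t assume t: "\<delta> < \<bar>t\<bar> \<and> \<bar>t\<bar> \<le> pi"
      show "cmod (Xi M T n (cis t)) \<le> K * exp ((1 - c) * Lg n)"
      proof (cases "cmod (cis t - 1) \<le> \<epsilon>0")
        case True
        then obtain r where r: "cmod r \<le> C * exp (- e * Lg n)"
          "Xi M T n (cis t) = g (cis t) * exp (f (cis t) * of_real (Lg n)) * (1 + r)"
          using elim(1) by blast
        have inS: "cis t \<in> S" unfolding S_def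
          using t True by (intro IntI imageI) (auto simp: dist_norm norm_minus_commute)
        have "C * exp (- e * Lg n) \<le> C * 1" using eC(1,2) by (intro mult_left_mono) (auto simp: less_imp_le)
        then have r1: "cmod (1 + r) \<le> 1 + C" using norm_triangle_ineq[of 1 r] r(1) by simp
        have "cmod (Xi M T n (cis t)) = cmod (g (cis t)) * exp (Re (f (cis t)) * Lg n) * cmod (1 + r)"
          unfolding r(2) by (simp add: norm_mult)
        also have "\<dots> \<le> Bg * exp ((1 - c) * Lg n) * (1 + C)"
        proof (intro mult_mono r1)
          show "cmod (g (cis t)) \<le> Bg" using Bg inS by (simp add: S_def)
          have "Re (f (cis t)) \<le> 1 - c" using c1(2)[OF inS] by (simp add: c_def)
          then show "exp (Re (f (cis t)) * Lg n) \<le> exp ((1 - c) * Lg n)"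
            by (simp add: mult_right_mono less_imp_le)
        qed (use Bg0 in auto)
        also have "\<dots> = (Bg * (1 + C)) * exp ((1 - c) * Lg n)" by simp
        also have "\<dots> \<le> K * exp ((1 - c) * Lg n)"
          by (intro mult_right_mono) (auto simp: K_def)
        finally show ?thesis .
      next
        case False
        then have "cmod (Xi M T n (cis t)) \<le> C2 * real n powr (1 - e2)"
          using elim(2) II(1) by auto
        also have "real n powr (1 - e2) = exp ((1 - e2) * Lg n)"
          using elim(3) by (simp add: powr_def Lg_eq_ln)
        also have "C2 * exp ((1 - e2) * Lg n) \<le> K * exp ((1 - c) * Lg n)"
        proof (rule mult_mono)
          have "(1 - e2) * Lg n \<le> (1 - c) * Lg n"
            by (intro mult_right_mono) (auto simp: c_def less_imp_le)
          then show "exp ((1 - e2) * Lg n) \<le> exp ((1 - c) * Lg n)" by simp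
        qed (auto simp: K_def)
        finally show ?thesis .
      qed
    qed
  qed
  then show ?thesis using that[of K c] c1(1) II(2) by (auto simp: K_def c_def)
qed

text \<open>Real coefficients reduce the inversion formula to orthogonality of cosines. It also
  holds for levels \<open>k > n\<close>: no summand matches \<open>k\<close>, and
  \<open>mu n k\<close> is 0.\<close>

lemma mu_Fourier:
  assumes "n \<ge> 1"
  shows "has_bochner_integral lborel
    (\<lambda>t. indicator {-pi..pi} t * Re (Xi M T n (cis t) * cis (- (real k * t)))) (2 * pi * mu n k)"
proof -
  have eq: "Re (Xi M T n (cis t) * cis (- (real k * t))) = (\<Sum>j\<le>n. mu n j * cos (of_int (int j - int k) * t))" for t
  proof -
    have "Xi M T n (cis t) * cis (- (real k * t)) = (\<Sum>j\<le>n. of_real (mu n j) * cis (real_of_int (int j - int k) * t))"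
      unfolding Xi_def sum_distrib_right
    proof (rule sum.cong)
      fix j :: nat
      have "cis t ^ j * cis (- (real k * t)) = cis (real j * t + - (real k * t))"
        by (simp only: Complex.DeMoivre cis_mult)
      also have "real j * t + - (real k * t) = real_of_int (int j - int k) * t"
        by (simp add: algebra_simps)
      finally show "of_real (mu n j) * cis t ^ j * cis (- (real k * t)) =
          of_real (mu n j) * cis (real_of_int (int j - int k) * t)" by simp
    qed simp
    then show ?thesis by (simp add: cis.sel)
  qed
  have "has_bochner_integral lborel
     (\<lambda>t. \<Sum>j\<le>n. mu n j * (indicator {-pi..pi} t * cos (of_int (int j - int k) * t)))
     (\<Sum>j\<le>n. mu n j * (if int j - int k = 0 then 2 * pi else 0))"
    by (intro has_bochner_integral_sum has_bochner_integral_mult_right cos_has_bochner_integral_period)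
  moreover have "(\<Sum>j\<le>n. mu n j * (if int j - int k = 0 then 2 * pi else 0)) = 2 * pi * mu n k"
  proof -
    have "(\<Sum>j\<le>n. mu n j * (if int j - int k = 0 then 2 * pi else 0)) = (\<Sum>j\<le>n. if j = k then 2 * pi * mu n k else 0)"
      by (rule sum.cong) auto
    also have "\<dots> = 2 * pi * mu n k" using mu_eq_0[OF assms, of k] by (simp add: not_le)
    finally show ?thesis .
  qed
  ultimately show ?thesis
    unfolding eq by (simp add: sum_distrib_left mult.left_commute)
qed

text \<open>The bound is shaped for integration over \<open>t\<close>: the Gaussian has width of
  order \<open>1 / sqrt L\<close>, so its weight \<open>(\<bar>d\<bar> + 1) / L\<close> becomes an
  error of order \<open>(\<bar>d\<bar> + 1) * L powr (- 3/2)\<close>, while the constant on the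
  period absorbs exponentially small terms. Three ranges of \<open>t\<close> are treated: near 0 by
  Taylor expansion, on the rest of the period by \<open>Xi_off_peak\<close>, and beyond it, where
  only the Gaussian is left.\<close>

lemma Fourier_integrand_bound:
  obtains C c where "C \<ge> 0" "c > 0"
    "\<forall>\<^sub>F n in sequentially. \<forall>k t.
      \<bar>indicator {-pi..pi} t * Re (Xi M T n (cis t) * cis (- (real k * t))) / real n
        - exp (- (s2 * Lg n) * t\<^sup>2 / 2) * cos (D n k * t)\<bar>
      \<le> C * ((\<bar>D n k\<bar> + 1) / Lg n) * exp (- (c * Lg n) * t\<^sup>2)
        + C * Lg n powr (- 3 / 2) * indicator {-pi..pi} t"
proof -
  obtain \<delta>0 C0 a b :: real where T: "\<delta>0 > 0" "C0 \<ge> 0"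
    "\<And>z::complex. cmod z \<le> \<delta>0 \<Longrightarrow> cmod (exp z - 1) \<le> \<epsilon>0"
    "\<And>z::complex. cmod z \<le> \<delta>0 \<Longrightarrow>
       cmod (f (exp z) - (1 + fp1 f * z + s2 / 2 * z ^ 2 + a * z ^ 3)) \<le> C0 * cmod z ^ 4"
    "\<And>z::complex. cmod z \<le> \<delta>0 \<Longrightarrow> cmod (g (exp z) - (1 + b * z)) \<le> C0 * cmod z ^ 2"
    using Taylor_at_1 by blast
  define A where "A = C0 + \<bar>a\<bar> + \<bar>b\<bar> + 1"
  have A: "A \<ge> 1" "\<bar>a\<bar> \<le> A" "\<bar>b\<bar> \<le> A" "C0 \<le> A" "\<bar>a\<bar> + C0 \<le> A" "\<bar>b\<bar> + C0 \<le> A"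
    using T(2) by (auto simp: A_def)
  \<comment> \<open>The bound \<open>s2 / (4 * A)\<close> makes the perturbation \<open>q\<close> of
    the exponent at most \<open>s2 / 4 * y\<close>, half of the Gaussian exponent
    \<open>s2 / 2 * y\<close>, where \<open>y\<close> is \<open>L\<close> times the square of
    \<open>t\<close>.\<close>
  define \<delta> where "\<delta> = min \<delta>0 (min 1 (s2 / (4 * A)))"
  have \<delta>: "\<delta> > 0" "\<delta> \<le> \<delta>0" "\<delta> \<le> 1" "\<delta> \<le> s2 / (4 * A)"
    using T(1) A(1) variance_pos by (auto simp: \<delta>_def)
  obtain e Ce where eC: "e > 0" "Ce \<ge> 0"
    "\<forall>\<^sub>F n in sequentially. \<forall>u. cmod (u - 1) \<le> \<epsilon>0 \<longrightarrow>
       (\<exists>r. cmod r \<le> Ce * exp (- e * Lg n) \<and> Xi M T n u = g u * exp (f u * of_real (Lg n)) * (1 + r))"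
    by (rule Xi_asymp)
  obtain Co co where off: "Co \<ge> 0" "co > 0"
    "\<forall>\<^sub>F n in sequentially. \<forall>t. \<delta> < \<bar>t\<bar> \<and> \<bar>t\<bar> \<le> pi \<longrightarrow> cmod (Xi M T n (cis t)) \<le> Co * exp ((1 - co) * Lg n)"
    by (rule Xi_off_peak[OF \<delta>(1)])
  have s8: "s2 / 8 > 0" using variance_pos by simp
  obtain B1 B2 B3 where B: "B1 \<ge> 0" "B2 \<ge> 0" "B3 \<ge> 0"
    "\<And>y. y \<ge> 0 \<Longrightarrow> y ^ 1 \<le> B1 * exp (s2 / 8 * y)"
    "\<And>y. y \<ge> 0 \<Longrightarrow> y ^ 2 \<le> B2 * exp (s2 / 8 * y)"
    "\<And>y. y \<ge> 0 \<Longrightarrow> y ^ 3 \<le> B3 * exp (s2 / 8 * y)"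
    using power_le_exp_mult[OF s8, of 1] power_le_exp_mult[OF s8, of 2] power_le_exp_mult[OF s8, of 3]
    by metis
  define B where "B = B1 + B2 + B3"
  have Bpoly: "y + y\<^sup>2 + y ^ 3 \<le> B * exp (s2 / 8 * y)" if "y \<ge> 0" for y
    using B(4-6)[OF that] by (simp add: B_def algebra_simps)
  have B0: "B \<ge> 0" "B1 \<le> B" using B by (auto simp: B_def)
  \<comment> \<open>The summands are the costs of \<open>b1\<close> to \<open>b5\<close> below:
    \<open>A\<close> three times, then the product of \<open>q\<close> with \<open>g u - 1\<close>,
    then the square of \<open>q\<close> times \<open>g u\<close>. In addition
    \<open>1 + A <= K\<close> bounds \<open>g u\<close> in the term with \<open>r\<close>.\<close>
  define K where "K = 3 * A + A\<^sup>2 + A\<^sup>2 * (1 + A)"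
  have K: "K \<ge> 0" "1 + A \<le> K"
  proof -
    have "A \<le> A\<^sup>2" using A(1) by (simp add: power2_eq_square)
    moreover have "0 \<le> A\<^sup>2 * (1 + A)" using A(1) by simp
    ultimately show "K \<ge> 0" "1 + A \<le> K" using A(1) unfolding K_def by linarith+
  qed
  define C where "C = K * B + B / \<delta>\<^sup>2 + K + 1"
  have C: "C \<ge> 0" "K * B \<le> C" "B / \<delta>\<^sup>2 \<le> C" "K \<le> C" "1 \<le> C"
    using K B0 by (auto simp: C_def)
  have "\<forall>\<^sub>F n in sequentially. \<forall>k t.
      \<bar>indicator {-pi..pi} t * Re (Xi M T n (cis t) * cis (- (real k * t))) / real n
        - exp (- (s2 * Lg n) * t\<^sup>2 / 2) * cos (D n k * t)\<bar>
      \<le> C * ((\<bar>D n k\<bar> + 1) / Lg n) * exp (- (s2 / 8 * Lg n) * t\<^sup>2)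
        + C * Lg n powr (- 3 / 2) * indicator {-pi..pi} t"
    using eC(3) off(3) exp_neg_le_powr[OF eC(1), of Ce "3 / 2"] exp_neg_le_powr[OF off(2), of Co "3 / 2"]
      eventually_ge_at_top[of 3]
  proof eventually_elim
    case (elim n)
    define L where "L = Lg n"
    have L: "L \<ge> 1" "L > 0" by (auto simp: L_def)
    have nL: "real n = exp L" using exp_Lg[OF elim(5)] by (simp add: L_def)
    show ?case unfolding L_def[symmetric]
    proof (intro allI)
      fix k t
      define d where "d = D n k"
      define y where "y = L * t\<^sup>2"
      have y0: "y \<ge> 0" using L by (simp add: y_def)
      \<comment> \<open>Away from 0, \<open>y\<close> is at least a constant times \<open>L\<close>.
        Multiplying by \<open>y / L\<close> up to a constant is thus harmless and yields the
        required factor \<open>1 / L\<close>, at the price of part of the exponent.\<close>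
      have off_gauss: "\<bar>exp (- (s2 * L) * t\<^sup>2 / 2) * cos (d * t)\<bar>
          \<le> C * ((\<bar>d\<bar> + 1) / L) * exp (- (s2 / 8 * L) * t\<^sup>2)" if t: "\<delta> < \<bar>t\<bar>"
      proof -
        have "\<delta>\<^sup>2 \<le> t\<^sup>2" using t \<delta>(1) by (simp add: abs_le_square_iff[symmetric])
        then have "1 \<le> t\<^sup>2 / \<delta>\<^sup>2" using \<delta>(1) by simp
        also have "\<dots> = y / (\<delta>\<^sup>2 * L)" using L by (simp add: y_def)
        also have "\<dots> \<le> B * exp (s2 / 8 * y) / (\<delta>\<^sup>2 * L)"
        proof (rule divide_right_mono)
          have "y \<le> B1 * exp (s2 / 8 * y)" using B(4)[OF y0] by simp
          also have "\<dots> \<le> B * exp (s2 / 8 * y)" using B0 by (intro mult_right_mono) auto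
          finally show "y \<le> B * exp (s2 / 8 * y)" .
        qed (use L in simp)
        finally have one: "1 \<le> B / \<delta>\<^sup>2 / L * exp (s2 / 8 * y)" by simp
        have "\<bar>exp (- (s2 * L) * t\<^sup>2 / 2) * cos (d * t)\<bar> \<le> exp (- (s2 * L) * t\<^sup>2 / 2) * 1"
          unfolding abs_mult by (intro mult_mono) auto
        also have "\<dots> \<le> exp (- (s2 / 4 * y)) * 1"
        proof -
          have "s2 / 4 * y \<le> s2 / 2 * y" using variance_pos y0 by (intro mult_right_mono) auto
          then show ?thesis by (simp add: y_def)
        qed
        also have "\<dots> \<le> exp (- (s2 / 4 * y)) * (B / \<delta>\<^sup>2 / L * exp (s2 / 8 * y))"
          by (intro mult_left_mono one) simp
        also have "\<dots> = (B / \<delta>\<^sup>2) * (1 / L) * (exp (- (s2 / 4 * y)) * exp (s2 / 8 * y))" by simp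
        also have "exp (- (s2 / 4 * y)) * exp (s2 / 8 * y) = exp (- (s2 / 8 * L) * t\<^sup>2)"
          unfolding exp_add[symmetric] by (simp add: y_def field_simps)
        also have "(B / \<delta>\<^sup>2) * (1 / L) * exp (- (s2 / 8 * L) * t\<^sup>2)
            \<le> C * ((\<bar>d\<bar> + 1) / L) * exp (- (s2 / 8 * L) * t\<^sup>2)"
          using L C B0 by (intro mult_right_mono mult_mono divide_right_mono) auto
        finally show ?thesis .
      qed
      consider "\<bar>t\<bar> \<le> \<delta>" | "\<delta> < \<bar>t\<bar>" "\<bar>t\<bar> \<le> pi" | "\<bar>t\<bar> > pi" by linarith
      then have "\<bar>indicator {-pi..pi} t * Re (Xi M T n (cis t) * cis (- (real k * t))) / real n
        - exp (- (s2 * L) * t\<^sup>2 / 2) * cos (d * t)\<bar>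
      \<le> C * ((\<bar>d\<bar> + 1) / L) * exp (- (s2 / 8 * L) * t\<^sup>2)
        + C * L powr (- 3 / 2) * indicator {-pi..pi} t"
      proof cases
        case 3
        then have "indicator {-pi..pi} t = (0::real)" by (auto simp: indicator_def)
        moreover have "\<delta> < \<bar>t\<bar>" using 3 \<delta>(3) pi_gt3 by linarith
        ultimately show ?thesis using off_gauss by simp
      next
        case 2
        then have ind: "indicator {-pi..pi} t = (1::real)" by (auto simp: indicator_def)
        have "\<bar>Re (Xi M T n (cis t) * cis (- (real k * t)))\<bar> \<le> cmod (Xi M T n (cis t) * cis (- (real k * t)))"
          by (rule abs_Re_le_cmod)
        also have "\<dots> = cmod (Xi M T n (cis t))" by (simp add: norm_mult)
        also have "\<dots> \<le> Co * exp ((1 - co) * L)" using elim(2) 2 by (simp add: L_def)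
        finally have "\<bar>Re (Xi M T n (cis t) * cis (- (real k * t)))\<bar> / real n \<le> Co * exp ((1 - co) * L) / exp L"
          unfolding nL by (rule divide_right_mono) simp
        also have "\<dots> = Co * exp (- co * L)" 
        proof -
          have "exp ((1 - co) * L) / exp L = exp (- co * L)"
            unfolding exp_diff[symmetric] by (simp add: algebra_simps)
          then show ?thesis by (metis times_divide_eq_right)
        qed
        also have "\<dots> \<le> L powr (- 3 / 2)" using elim(4) by (simp add: L_def)
        also have "\<dots> \<le> C * L powr (- 3 / 2)" using C(5) mult_right_mono[of 1 C "L powr (- 3 / 2)"] by simp
        finally have "\<bar>Re (Xi M T n (cis t) * cis (- (real k * t))) / real n\<bar> \<le> C * L powr (- 3 / 2)"
          by simp
        then show ?thesis using off_gauss[OF 2(1)] unfolding ind mult_1_left mult_1_right by linarith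
      next
        case 1
        have ind: "indicator {-pi..pi} t = (1::real)" using 1 \<delta>(3) pi_gt3 by (auto simp: indicator_def)
        define z where "z = \<i> * complex_of_real t"
        define u where "u = cis t"
        have u: "u = exp z" by (simp add: u_def z_def cis_conv_exp)
        have cz: "cmod z = \<bar>t\<bar>" by (simp add: z_def norm_mult)
        then have z: "cmod z \<le> \<delta>0" using 1 \<delta>(2) by simp
        obtain r where r: "cmod r \<le> Ce * exp (- e * L)"
          "Xi M T n u = g u * exp (f u * of_real L) * (1 + r)"
          using elim(1) T(3)[OF z] unfolding L_def u by blast
        define R where "R = f u - (1 + fp1 f * z + s2 / 2 * z ^ 2 + a * z ^ 3)"
        define R2 where "R2 = g u - (1 + b * z)"
        have R: "cmod R \<le> C0 * \<bar>t\<bar> ^ 4" "cmod R2 \<le> C0 * t\<^sup>2"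
          using T(4)[OF z] T(5)[OF z] unfolding R_def R2_def u cz by simp_all
        \<comment> \<open>At \<open>z = i t\<close> the cubic term of \<open>f\<close> is
          \<open>- i a t^3\<close>; so \<open>i p\<close> is the imaginary part of the perturbation
          that comes from it, and \<open>L * R\<close> is of fourth order.\<close>
        define p where "p = - a * L * t ^ 3"
        define q where "q = \<i> * p + L * R"
        have z2: "z ^ 2 = - (of_real (t\<^sup>2))" "z ^ 3 = - \<i> * of_real (t ^ 3)"
        proof -
          show z2: "z ^ 2 = - (of_real (t\<^sup>2))" by (simp add: z_def power_mult_distrib)
          have "z ^ 3 = z ^ 2 * z" by (simp add: power3_eq_cube power2_eq_square)
          then show "z ^ 3 = - \<i> * of_real (t ^ 3)"
            unfolding z2 by (simp add: z_def power2_eq_square power3_eq_cube)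
        qed
        have fu: "f u * L = L + \<i> * (fp1 f * L * t) - s2 * L * t\<^sup>2 / 2 + q"
        proof -
          have fL: "f u * L = (R + (1 + fp1 f * z + s2 / 2 * z ^ 2 + a * z ^ 3)) * L" by (simp add: R_def)
          show ?thesis unfolding fL z2 q_def p_def
            by (simp add: z_def field_simps)
        qed
        \<comment> \<open>The linear term of \<open>f\<close> recentres the level: it combines with
          the frequency \<open>k\<close> into \<open>- d\<close>, and the quadratic term is the
          Gaussian.\<close>
        have ex: "exp (f u * L) * cis (- (real k * t)) = exp L * exp (- (s2 * L) * t\<^sup>2 / 2) * (cis (- (d * t)) * exp q)"
        proof -
          have "cis (- (real k * t)) = exp (- \<i> * (real k * t))" "cis (- (d * t)) = exp (- \<i> * (d * t))"
            by (simp_all add: cis_conv_exp)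
          moreover have "f u * L + (- \<i> * (real k * t)) = of_real L + of_real (- (s2 * L) * t\<^sup>2 / 2) + (- \<i> * (d * t)) + q"
            unfolding fu
            by (simp add: d_def Dlt_def L_def[symmetric] algebra_simps add_divide_distrib diff_divide_distrib)
          ultimately show ?thesis
            by (simp only: exp_add[symmetric] mult_exp_exp exp_of_real[symmetric] of_real_add add.assoc)
        qed
        have t1: "\<bar>t\<bar> \<le> 1" using 1 \<delta>(3) by simp
        have t43: "\<bar>t\<bar> ^ 4 \<le> \<bar>t\<bar> ^ 3" and t21: "\<bar>t\<bar> ^ 2 \<le> \<bar>t\<bar> ^ 1"
          using t1 power_decreasing[of 3 4 "\<bar>t\<bar>"] power_decreasing[of 1 2 "\<bar>t\<bar>"] by simp_all
        have q: "cmod q \<le> A * L * \<bar>t\<bar> ^ 3"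
        proof -
          have "cmod q \<le> \<bar>p\<bar> + L * cmod R"
            unfolding q_def using norm_triangle_ineq[of "\<i> * p" "L * R"] L by (simp add: norm_mult)
          also have "\<dots> \<le> \<bar>a\<bar> * L * \<bar>t\<bar> ^ 3 + L * (C0 * \<bar>t\<bar> ^ 3)"
            using L R(1) t43 T(2) by (intro add_mono mult_left_mono order.trans[OF R(1)])
              (auto simp: p_def abs_mult power_abs)
          also have "\<dots> = (\<bar>a\<bar> + C0) * (L * \<bar>t\<bar> ^ 3)" by (simp add: algebra_simps)
          also have "\<dots> \<le> A * (L * \<bar>t\<bar> ^ 3)" using A L by (intro mult_right_mono) auto
          finally show ?thesis by simp
        qed
        have "A * L * \<bar>t\<bar> ^ 3 = A * \<bar>t\<bar> * y" by (simp add: y_def eval_nat_numeral)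
        also have "\<dots> \<le> s2 / 4 * y"
        proof (rule mult_right_mono[OF _ y0])
          have "A * \<bar>t\<bar> \<le> A * (s2 / (4 * A))" using 1 \<delta>(4) A by (intro mult_left_mono) auto
          then show "A * \<bar>t\<bar> \<le> s2 / 4" using A by simp
        qed
        finally have qy: "cmod q \<le> s2 / 4 * y" using q by linarith
        have "Re (Xi M T n u * cis (- (real k * t))) / real n =
            exp (- (s2 * L) * t\<^sup>2 / 2) * Re (cis (- (d * t)) * (exp q * g u * (1 + r)))"
        proof -
          have "Xi M T n u * cis (- (real k * t)) = (exp (f u * L) * cis (- (real k * t))) * (g u * (1 + r))"
            unfolding r(2) by (simp add: algebra_simps)
          also have "\<dots> = of_real (exp L * exp (- (s2 * L) * t\<^sup>2 / 2)) * (cis (- (d * t)) * (exp q * g u * (1 + r)))"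
            unfolding ex by (simp add: algebra_simps)
          finally have "Re (Xi M T n u * cis (- (real k * t)))
            = exp L * exp (- (s2 * L) * t\<^sup>2 / 2) * Re (cis (- (d * t)) * (exp q * g u * (1 + r)))"
            by (simp only: Re_of_real_mult)
          then show ?thesis by (simp add: nL)
        qed
        then have "\<bar>Re (Xi M T n u * cis (- (real k * t))) / real n - exp (- (s2 * L) * t\<^sup>2 / 2) * cos (d * t)\<bar>
          = exp (- (s2 * L) * t\<^sup>2 / 2) * \<bar>Re (cis (- (d * t)) * (exp q * g u * (1 + r))) - cos (d * t)\<bar>"
          by (simp add: abs_mult right_diff_distrib[symmetric])
        also have "\<dots> \<le> exp (- (s2 * L) * t\<^sup>2 / 2) * 
           (\<bar>d * t\<bar> * (\<bar>p\<bar> + \<bar>b * t\<bar>) + (cmod (L * R) + cmod R2 + cmod q * cmod (g u - 1)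
            + (cmod q)\<^sup>2 * exp (cmod q) * cmod (g u)) + exp (cmod q) * cmod (g u) * cmod r)"
          by (intro mult_left_mono Re_perturbed_cis_bound) (auto simp: q_def R2_def z_def)
        also have "\<dots> \<le> exp (- (s2 * L) * t\<^sup>2 / 2) * (exp (cmod q) * (K * ((\<bar>d\<bar> + 1) / L * (y + y\<^sup>2 + y ^ 3)) + K * cmod r))"
        proof (intro mult_left_mono)
          have G1: "cmod (g u - 1) \<le> A * \<bar>t\<bar>"
          proof -
            have "g u - 1 = b * z + R2" by (simp add: R2_def)
            then have "cmod (g u - 1) \<le> \<bar>b\<bar> * \<bar>t\<bar> + cmod R2"
              using norm_triangle_ineq[of "b * z" R2] by (simp add: norm_mult cz)
            also have "\<dots> \<le> \<bar>b\<bar> * \<bar>t\<bar> + C0 * \<bar>t\<bar>"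
              using R(2) mult_left_mono[OF t21 T(2)] by simp
            also have "\<dots> = (\<bar>b\<bar> + C0) * \<bar>t\<bar>" by (simp add: algebra_simps)
            also have "\<dots> \<le> A * \<bar>t\<bar>" using A by (intro mult_right_mono) auto
            finally show ?thesis .
          qed
          have G: "cmod (g u) \<le> 1 + A"
          proof -
            have "cmod (g u) \<le> 1 + cmod (g u - 1)" using norm_triangle_ineq[of 1 "g u - 1"] by simp
            also have "A * \<bar>t\<bar> \<le> A * 1" using A t1 by (intro mult_left_mono) auto
            then have "1 + cmod (g u - 1) \<le> 1 + A" using G1 by linarith
            finally show ?thesis .
          qed
          define E where "E = exp (cmod q)"
          have E: "E \<ge> 1" by (simp add: E_def)
          \<comment> \<open>In terms of \<open>y\<close>, every surviving error carries a factor
            \<open>1 / L\<close>. This is the source of the relative error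
            \<open>O(1 / L)\<close>.\<close>
          have Lt4: "L * \<bar>t\<bar> ^ 4 = y\<^sup>2 / L" and t2: "\<bar>t\<bar>\<^sup>2 = y / L" and Lt6: "L\<^sup>2 * \<bar>t\<bar> ^ 6 = y ^ 3 / L"
            using L by (simp_all add: y_def power2_eq_square power3_eq_cube eval_nat_numeral)
          define m where "m = (\<bar>d\<bar> + 1) / L"
          have m: "1 / L \<le> m" "\<bar>d\<bar> / L \<le> m" "m \<ge> 0" using L by (auto simp: m_def divide_right_mono)
          define P where "P = y + y\<^sup>2 + y ^ 3"
          have P: "y \<le> P" "y\<^sup>2 \<le> P" "y ^ 3 \<le> P" "y + y\<^sup>2 \<le> P" "P \<ge> 0" using y0 by (auto simp: P_def)
          have mP: "x / L \<le> m * P" if "x \<le> P" "x \<ge> 0" for x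
          proof -
            have "x / L = 1 / L * x" by simp
            also have "\<dots> \<le> m * P" using that m P by (intro mult_mono) auto
            finally show ?thesis .
          qed
          \<comment> \<open>Alone, \<open>p\<close> and \<open>b * t\<close> have size
            \<open>L * t^3\<close> and \<open>t\<close>, that is \<open>1 / sqrt L\<close> on the
            Gaussian scale. The factor \<open>d * t\<close> from the sine brings them to the order
            \<open>d / L\<close>.\<close>
          have b1: "\<bar>d * t\<bar> * (\<bar>p\<bar> + \<bar>b * t\<bar>) \<le> A * (m * P)"
          proof -
            have "\<bar>d * t\<bar> * (\<bar>p\<bar> + \<bar>b * t\<bar>) = \<bar>d\<bar> * (\<bar>a\<bar> * (L * \<bar>t\<bar> ^ 4) + \<bar>b\<bar> * \<bar>t\<bar>\<^sup>2)"
              using L by (simp add: p_def abs_mult power_abs eval_nat_numeral algebra_simps)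
            also have "\<dots> \<le> \<bar>d\<bar> * (A * (L * \<bar>t\<bar> ^ 4) + A * \<bar>t\<bar>\<^sup>2)"
              using A L by (intro mult_left_mono add_mono mult_right_mono) auto
            also have "\<dots> = A * (\<bar>d\<bar> / L * (y + y\<^sup>2))" unfolding Lt4 t2
              by (simp add: algebra_simps add_divide_distrib)
            also have "\<dots> \<le> A * (m * P)" using A m P y0 by (intro mult_left_mono mult_mono) auto
            finally show ?thesis .
          qed
          have b2: "cmod (L * R) \<le> A * (m * P)"
          proof -
            have "cmod (L * R) \<le> L * (A * \<bar>t\<bar> ^ 4)" unfolding norm_mult
              using L R(1) A by (auto intro!: mult_left_mono order.trans[OF R(1)] mult_right_mono)
            also have "\<dots> = A * (L * \<bar>t\<bar> ^ 4)" by simp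
            also have "\<dots> \<le> A * (m * P)" unfolding Lt4 using A P y0 by (intro mult_left_mono mP) auto
            finally show ?thesis .
          qed
          have b3: "cmod R2 \<le> A * (m * P)"
          proof -
            have "cmod R2 \<le> A * \<bar>t\<bar>\<^sup>2" using order.trans[OF R(2) mult_right_mono[OF A(4), of "t\<^sup>2"]] by simp
            also have "\<dots> \<le> A * (m * P)" unfolding t2 using A P y0 by (intro mult_left_mono mP) auto
            finally show ?thesis .
          qed
          have b4: "cmod q * cmod (g u - 1) \<le> A\<^sup>2 * (m * P)"
          proof -
            have "cmod q * cmod (g u - 1) \<le> (A * L * \<bar>t\<bar> ^ 3) * (A * \<bar>t\<bar>)"
              using q G1 A L by (intro mult_mono) auto
            also have "\<dots> = A\<^sup>2 * (L * \<bar>t\<bar> ^ 4)" by (simp add: eval_nat_numeral)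
            also have "\<dots> \<le> A\<^sup>2 * (m * P)" unfolding Lt4 using A P y0 by (intro mult_left_mono mP) auto
            finally show ?thesis .
          qed
          have b5: "(cmod q)\<^sup>2 * E * cmod (g u) \<le> E * (A\<^sup>2 * (1 + A) * (m * P))"
          proof -
            have "(cmod q)\<^sup>2 \<le> (A * L * \<bar>t\<bar> ^ 3)\<^sup>2" using q by (intro power_mono) auto
            also have "\<dots> = A\<^sup>2 * (L\<^sup>2 * \<bar>t\<bar> ^ 6)" by (simp add: power_mult_distrib flip: power_mult)
            also have "\<dots> \<le> A\<^sup>2 * (m * P)" unfolding Lt6 using A P y0 by (intro mult_left_mono mP) auto
            finally have "(cmod q)\<^sup>2 * E * cmod (g u) \<le> A\<^sup>2 * (m * P) * E * (1 + A)"
              using E G A m P by (intro mult_mono) auto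
            then show ?thesis by (simp add: mult_ac)
          qed
          have b6: "E * cmod (g u) * cmod r \<le> E * (K * cmod r)"
            using E G K(2) by (simp add: mult.assoc mult_left_mono mult_right_mono)
          have up: "x \<le> E * x" if "x \<ge> 0" for x using mult_right_mono[OF E that] by simp
          have mP0: "m * P \<ge> 0" using m P by simp
          have "\<bar>d * t\<bar> * (\<bar>p\<bar> + \<bar>b * t\<bar>) + (cmod (L * R) + cmod R2 + cmod q * cmod (g u - 1)
              + (cmod q)\<^sup>2 * E * cmod (g u)) + E * cmod (g u) * cmod r
            \<le> E * (A * (m * P)) + (E * (A * (m * P)) + E * (A * (m * P)) + E * (A\<^sup>2 * (m * P))
              + E * (A\<^sup>2 * (1 + A) * (m * P))) + E * (K * cmod r)"
            using A mP0 by (intro add_mono b5 b6 order.trans[OF b1 up] order.trans[OF b2 up]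
              order.trans[OF b3 up] order.trans[OF b4 up]) auto
          also have "\<dots> = E * (K * (m * P) + K * cmod r)"
            unfolding K_def by (simp add: algebra_simps)
          finally show "\<bar>d * t\<bar> * (\<bar>p\<bar> + \<bar>b * t\<bar>) + (cmod (L * R) + cmod R2 + cmod q * cmod (g u - 1)
              + (cmod q)\<^sup>2 * exp (cmod q) * cmod (g u)) + exp (cmod q) * cmod (g u) * cmod r
            \<le> exp (cmod q) * (K * ((\<bar>d\<bar> + 1) / L * (y + y\<^sup>2 + y ^ 3)) + K * cmod r)"
            by (simp only: E_def m_def P_def)
        qed simp
        \<comment> \<open>Budget of the exponent \<open>s2 / 2 * y\<close>: half goes to
          \<open>exp (cmod q)\<close>, a quarter to the polynomial in \<open>y\<close>, and the last
          quarter, \<open>s2 / 8 * y\<close>, remains for integrability.\<close>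
        also have "\<dots> \<le> exp (- (s2 / 4 * y)) * (K * ((\<bar>d\<bar> + 1) / L * (B * exp (s2 / 8 * y))) + K * L powr (- 3 / 2))"
        proof -
          have "exp (- (s2 * L) * t\<^sup>2 / 2) * exp (cmod q) \<le> exp (- (s2 / 4 * y))"
            unfolding exp_add[symmetric] using qy by (simp add: y_def)
          moreover have "cmod r \<le> L powr (- 3 / 2)" using r(1) elim(3) by (simp add: L_def)
          ultimately show ?thesis unfolding mult.assoc[symmetric, of "exp (- (s2 * L) * t\<^sup>2 / 2)"]
            using Bpoly[OF y0] K L y0
            by (intro mult_mono add_mono mult_left_mono) auto
        qed
        also have "\<dots> \<le> K * B * ((\<bar>d\<bar> + 1) / L) * (exp (- (s2 / 4 * y)) * exp (s2 / 8 * y)) + K * L powr (- 3 / 2)"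
        proof -
          have "exp (- (s2 / 4 * y)) * (K * L powr (- 3 / 2)) \<le> 1 * (K * L powr (- 3 / 2))"
            using variance_pos y0 K by (intro mult_right_mono) auto
          then show ?thesis by (simp add: algebra_simps)
        qed
        also have "exp (- (s2 / 4 * y)) * exp (s2 / 8 * y) = exp (- (s2 / 8 * L) * t\<^sup>2)"
          unfolding exp_add[symmetric] by (simp add: y_def field_simps)
        also have "K * B * ((\<bar>d\<bar> + 1) / L) * exp (- (s2 / 8 * L) * t\<^sup>2) + K * L powr (- 3 / 2)
           \<le> C * ((\<bar>d\<bar> + 1) / L) * exp (- (s2 / 8 * L) * t\<^sup>2) + C * L powr (- 3 / 2)"
          using C L by (intro add_mono mult_right_mono) auto
        finally show ?thesis unfolding ind u_def by simp
      qed
      then show "\<bar>indicator {-pi..pi} t * Re (Xi M T n (cis t) * cis (- (real k * t))) / real n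
        - exp (- (s2 * L) * t\<^sup>2 / 2) * cos (D n k * t)\<bar>
      \<le> C * ((\<bar>D n k\<bar> + 1) / L) * exp (- (s2 / 8 * L) * t\<^sup>2)
        + C * L powr (- 3 / 2) * indicator {-pi..pi} t" by (simp only: d_def)
    qed
  qed
  then show ?thesis using that[of C "s2 / 8"] C s8 by simp
qed

lemma powr_minus_3_2: "L > 0 \<Longrightarrow> L powr (- 3 / 2) = 1 / (L * sqrt L)" for L :: real
proof -
  assume "L > 0"
  then have "L powr (3 / 2) = L powr 1 * L powr (1 / 2)" by (subst powr_add[symmetric]) simp
  then show ?thesis using \<open>L > 0\<close> by (simp add: powr_half_sqrt powr_minus_divide)
qed

text \<open>Integrate the pointwise estimate. Relative to the peak, which is of order
  \<open>n / sqrt L\<close>, the error is \<open>(\<bar>d\<bar> + 1) / L\<close>: sharp enough at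
  bounded \<open>d\<close>, and growing only linearly, hence eventually dominated by the
  gap.\<close>

lemma local_limit:
  obtains C where "C \<ge> 0"
    "\<forall>\<^sub>F n in sequentially. \<forall>k.
       \<bar>mu n k - peak n * exp (- (D n k)\<^sup>2 / (2 * (s2 * Lg n)))\<bar> \<le> C * (\<bar>D n k\<bar> + 1) * scale n"
proof -
  obtain C c where C: "C \<ge> 0" "c > 0"
    "\<forall>\<^sub>F n in sequentially. \<forall>k t.
      \<bar>indicator {-pi..pi} t * Re (Xi M T n (cis t) * cis (- (real k * t))) / real n
        - exp (- (s2 * Lg n) * t\<^sup>2 / 2) * cos (D n k * t)\<bar>
      \<le> C * ((\<bar>D n k\<bar> + 1) / Lg n) * exp (- (c * Lg n) * t\<^sup>2)
        + C * Lg n powr (- 3 / 2) * indicator {-pi..pi} t"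
    by (rule Fourier_integrand_bound)
  define C' where "C' = C * sqrt (pi / c) + C * (2 * pi)"
  have "\<forall>\<^sub>F n in sequentially. \<forall>k.
       \<bar>mu n k - peak n * exp (- (D n k)\<^sup>2 / (2 * (s2 * Lg n)))\<bar> \<le> C' * (\<bar>D n k\<bar> + 1) * scale n"
    using C(3) eventually_ge_at_top[of 3]
  proof eventually_elim
    case (elim n)
    define L where "L = Lg n"
    have L: "L \<ge> 1" "L > 0" by (auto simp: L_def)
    have n: "n \<ge> 1" "real n > 0" using elim(2) by auto
    show ?case
    proof
      fix k
      define d where "d = D n k"
      let ?F = "\<lambda>t. indicator {-pi..pi} t * Re (Xi M T n (cis t) * cis (- (real k * t))) / real n"
      let ?G = "\<lambda>t. exp (- (s2 * L) * t\<^sup>2 / 2) * cos (d * t)"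
      let ?H = "\<lambda>t. C * ((\<bar>d\<bar> + 1) / L) * exp (- (c * L) * t\<^sup>2)
        + C * L powr (- 3 / 2) * indicator {-pi..pi} t"
      have F: "has_bochner_integral lborel ?F (2 * pi * mu n k / real n)"
        by (intro has_bochner_integral_divide mu_Fourier n)
      have G: "has_bochner_integral lborel ?G (sqrt (2 * pi / (s2 * L)) * exp (- d\<^sup>2 / (2 * (s2 * L))))"
        using variance_pos L by (intro gaussian_cos_has_bochner_integral) auto
      have H: "has_bochner_integral lborel ?H
         (C * ((\<bar>d\<bar> + 1) / L) * sqrt (pi / (c * L)) + C * L powr (- 3 / 2) * (2 * pi))"
      proof (intro has_bochner_integral_add has_bochner_integral_mult_right)
        show "has_bochner_integral lborel (\<lambda>t. exp (- (c * L) * t\<^sup>2)) (sqrt (pi / (c * L)))"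
          using C L by (intro gaussian_has_bochner_integral) auto
        show "has_bochner_integral lborel (indicator {-pi..pi}) (2 * pi)"
          using has_bochner_integral_real_indicator[of "{-pi..pi}" lborel] by simp
      qed
      have "\<bar>2 * pi * mu n k / real n - sqrt (2 * pi / (s2 * L)) * exp (- d\<^sup>2 / (2 * (s2 * L)))\<bar>
          \<le> C * ((\<bar>d\<bar> + 1) / L) * sqrt (pi / (c * L)) + C * L powr (- 3 / 2) * (2 * pi)"
      proof -
        have "norm (LBINT t. ?F t - ?G t) \<le> (LBINT t. ?H t)"
        proof (rule Bochner_Integration.integral_norm_bound_integral)
          show "integrable lborel (\<lambda>t. ?F t - ?G t)" "integrable lborel ?H"
            using has_bochner_integral_diff[OF F G] H unfolding has_bochner_integral_iff by blast+
          show "norm (?F t - ?G t) \<le> ?H t" for t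
            using elim(1) unfolding d_def L_def real_norm_def by blast
        qed
        then show ?thesis
          unfolding has_bochner_integral_integral_eq[OF has_bochner_integral_diff[OF F G]]
            has_bochner_integral_integral_eq[OF H] real_norm_def .
      qed
      also have "C * ((\<bar>d\<bar> + 1) / L) * sqrt (pi / (c * L)) = C * sqrt (pi / c) * (\<bar>d\<bar> + 1) * L powr (- 3 / 2)"
        unfolding powr_minus_3_2[OF L(2)] by (simp add: real_sqrt_divide real_sqrt_mult mult_ac)
      also have "C * L powr (- 3 / 2) * (2 * pi) \<le> C * (2 * pi) * (\<bar>d\<bar> + 1) * L powr (- 3 / 2)"
      proof -
        have "C * L powr (- 3 / 2) * (2 * pi) * 1 \<le> C * L powr (- 3 / 2) * (2 * pi) * (\<bar>d\<bar> + 1)"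
          using C(1) by (intro mult_left_mono) auto
        then show ?thesis by (simp only: mult_ac mult_1_right)
      qed
      finally have "\<bar>2 * pi * mu n k / real n - sqrt (2 * pi / (s2 * L)) * exp (- d\<^sup>2 / (2 * (s2 * L)))\<bar>
          \<le> C' * (\<bar>d\<bar> + 1) * L powr (- 3 / 2)"
        by (simp add: C'_def algebra_simps)
      then have "real n / (2 * pi) * \<bar>2 * pi * mu n k / real n - sqrt (2 * pi / (s2 * L)) * exp (- d\<^sup>2 / (2 * (s2 * L)))\<bar>
          \<le> real n * (C' * (\<bar>d\<bar> + 1) * L powr (- 3 / 2))"
      proof (intro mult_mono)
        have "1 \<le> 2 * pi" using pi_gt3 by simp
        then show "real n / (2 * pi) \<le> real n" using n by (simp add: divide_le_eq mult_le_cancel_left1)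
      qed auto
      moreover have "real n / (2 * pi) * \<bar>2 * pi * mu n k / real n - sqrt (2 * pi / (s2 * L)) * exp (- d\<^sup>2 / (2 * (s2 * L)))\<bar>
        = \<bar>mu n k - peak n * exp (- d\<^sup>2 / (2 * (s2 * L)))\<bar>"
      proof -
        have "peak n = real n / (2 * pi) * sqrt (2 * pi / (s2 * L))"
        proof -
          have "2 * pi / (s2 * L) = (2 * pi)\<^sup>2 / (2 * pi * s2 * L)" by (simp add: power2_eq_square)
          then have "sqrt (2 * pi / (s2 * L)) = sqrt ((2 * pi)\<^sup>2 / (2 * pi * s2 * L))"
            by (rule arg_cong)
          also have "\<dots> = 2 * pi / sqrt (2 * pi * s2 * L)"
            by (simp only: real_sqrt_divide real_sqrt_abs) simp
          finally have "sqrt (2 * pi / (s2 * L)) = 2 * pi / sqrt (2 * pi * s2 * L)" .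
          then show ?thesis by (simp add: peak_def L_def)
        qed
        then have "mu n k - peak n * exp (- d\<^sup>2 / (2 * (s2 * L))) =
           real n / (2 * pi) * (2 * pi * mu n k / real n - sqrt (2 * pi / (s2 * L)) * exp (- d\<^sup>2 / (2 * (s2 * L))))"
          using n by (simp add: algebra_simps)
        then show ?thesis using n by (simp add: abs_mult)
      qed
      ultimately show "\<bar>mu n k - peak n * exp (- (D n k)\<^sup>2 / (2 * (s2 * Lg n)))\<bar> \<le> C' * (\<bar>D n k\<bar> + 1) * scale n"
        by (simp add: d_def L_def scale_def mult_ac)
    qed
  qed
  then show ?thesis using that[of C'] C by (simp add: C'_def)
qed

text \<open>Chernoff bound with the tilt \<open>\<tau> = \<kappa> / L powr (1/3)\<close>, the same
  for all \<open>t\<close>. Its quadratic cost \<open>Q * \<tau>^2 * L\<close> is of order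
  \<open>L powr (1/3)\<close>. For \<open>t >= L powr (2/3)\<close> the gain
  \<open>\<tau> * t\<close> is at least twice this cost, and also at least
  \<open>\<kappa> * sqrt t\<close>, because \<open>L powr (1/3) <= sqrt t\<close>. The resulting
  decay in \<open>sqrt t\<close> holds for arbitrarily large \<open>t\<close>, with constants
  independent of \<open>n\<close>.\<close>

lemma mean_profile_tail:
  obtains C c where "C \<ge> 0" "c > 0"
    "\<forall>\<^sub>F n in sequentially. \<forall>t. Lg n powr (2 / 3) \<le> t \<longrightarrow>
       (\<Sum>k | k \<le> n \<and> t \<le> \<bar>D n k\<bar>. mu n k) \<le> C * real n * exp (- c * sqrt t)"
proof -
  obtain \<delta>0 C0 a b :: real where T: "\<delta>0 > 0" "C0 \<ge> 0"
    "\<And>z::complex. cmod z \<le> \<delta>0 \<Longrightarrow> cmod (exp z - 1) \<le> \<epsilon>0"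
    "\<And>z::complex. cmod z \<le> \<delta>0 \<Longrightarrow>
       cmod (f (exp z) - (1 + fp1 f * z + s2 / 2 * z ^ 2 + a * z ^ 3)) \<le> C0 * cmod z ^ 4"
    "\<And>z::complex. cmod z \<le> \<delta>0 \<Longrightarrow> cmod (g (exp z) - (1 + b * z)) \<le> C0 * cmod z ^ 2"
    using Taylor_at_1 by blast
  obtain e Ce where eC: "e > 0" "Ce \<ge> 0"
    "\<forall>\<^sub>F n in sequentially. \<forall>u. cmod (u - 1) \<le> \<epsilon>0 \<longrightarrow>
       (\<exists>r. cmod r \<le> Ce * exp (- e * Lg n) \<and> Xi M T n u = g u * exp (f u * of_real (Lg n)) * (1 + r))"
    by (rule Xi_asymp)
  define Q where "Q = s2 / 2 + \<bar>a\<bar> + C0"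
  have Q: "Q > 0" using variance_pos T(2) by (simp add: Q_def add_pos_nonneg)
  define K where "K = (1 + \<bar>b\<bar> + C0) * (1 + Ce)"
  have K: "K \<ge> 0" using T(2) eC(2) by (simp add: K_def)
  \<comment> \<open>The bound \<open>1 / (2 * Q)\<close> keeps the quadratic cost below half of the
    gain; the other two keep the tilt inside the range of the Taylor expansion.\<close>
  define \<kappa> where "\<kappa> = min (min \<delta>0 1) (1 / (2 * Q))"
  have \<kappa>: "\<kappa> > 0" "\<kappa> \<le> \<delta>0" "\<kappa> \<le> 1" "\<kappa> \<le> 1 / (2 * Q)" using T(1) Q by (auto simp: \<kappa>_def)
  have "\<forall>\<^sub>F n in sequentially. \<forall>t. Lg n powr (2 / 3) \<le> t \<longrightarrow>
       (\<Sum>k | k \<le> n \<and> t \<le> \<bar>D n k\<bar>. mu n k) \<le> 2 * K * real n * exp (- (\<kappa> / 2) * sqrt t)"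
    using eC(3) eventually_ge_at_top[of 3]
  proof eventually_elim
    case (elim n)
    define L where "L = Lg n"
    have L: "L \<ge> 1" "L > 0" by (auto simp: L_def)
    have nL: "real n = exp L" using exp_Lg[OF elim(2)] by (simp add: L_def)
    \<comment> \<open>For real \<open>\<tau>\<close>, \<open>Xi\<close> at \<open>exp \<tau>\<close>
      is an exponential moment of the level; centring at \<open>fp1 f * L\<close> removes the linear
      term of the exponent.\<close>
    have mgf: "(\<Sum>k\<le>n. mu n k * exp (\<tau> * D n k)) \<le> K * real n * exp (Q * \<tau>\<^sup>2 * L)"
      if \<tau>: "\<bar>\<tau>\<bar> \<le> \<kappa>" for \<tau>
    proof -
      let ?z = "complex_of_real \<tau>"
      have z: "cmod ?z \<le> \<delta>0" using \<tau> \<kappa> by simp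
      have t1: "\<bar>\<tau>\<bar> \<le> 1" using \<tau> \<kappa> by linarith
      have t32: "\<bar>\<tau>\<bar> ^ 3 \<le> \<tau>\<^sup>2" and t42: "\<bar>\<tau>\<bar> ^ 4 \<le> \<tau>\<^sup>2"
        using t1 power_decreasing[of 2 3 "\<bar>\<tau>\<bar>"] power_decreasing[of 2 4 "\<bar>\<tau>\<bar>"] by simp_all
      obtain r where r: "cmod r \<le> Ce * exp (- e * L)"
          "Xi M T n (exp ?z) = g (exp ?z) * exp (f (exp ?z) * of_real L) * (1 + r)"
        using elim(1) T(3)[OF z] unfolding L_def by blast
      have "exp (- e * L) \<le> 1" using eC(1) L by simp
      then have "Ce * exp (- e * L) \<le> Ce" using eC(2) by (simp add: mult_left_le)
      then have r1: "cmod (1 + r) \<le> 1 + Ce" using norm_triangle_ineq[of 1 r] r(1) by simp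
      have G: "cmod (g (exp ?z)) \<le> 1 + \<bar>b\<bar> + C0"
      proof -
        have "cmod (g (exp ?z)) \<le> cmod (1 + b * ?z) + cmod (g (exp ?z) - (1 + b * ?z))"
          by (metis add.commute diff_add_cancel norm_triangle_ineq)
        also have "cmod (1 + b * ?z) \<le> 1 + \<bar>b\<bar> * \<bar>\<tau>\<bar>"
          using norm_triangle_ineq[of 1 "b * ?z"] by (simp add: norm_mult)
        also have "\<bar>b\<bar> * \<bar>\<tau>\<bar> \<le> \<bar>b\<bar>" using t1 by (simp add: mult_left_le)
        also have "cmod (g (exp ?z) - (1 + b * ?z)) \<le> C0 * \<tau>\<^sup>2" using T(5)[OF z] by simp
        also have "\<dots> \<le> C0" using t1 T(2) by (simp add: mult_left_le abs_square_le_1)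
        finally show ?thesis by simp
      qed
      have F: "Re (f (exp ?z)) \<le> 1 + fp1 f * \<tau> + Q * \<tau>\<^sup>2"
      proof -
        let ?w = "1 + fp1 f * ?z + s2 / 2 * ?z ^ 2 + a * ?z ^ 3"
        have "Re (f (exp ?z)) - Re ?w \<le> cmod (f (exp ?z) - ?w)"
          using abs_Re_le_cmod[of "f (exp ?z) - ?w"] by (simp only: minus_complex.sel)
        also have "\<dots> \<le> C0 * \<bar>\<tau>\<bar> ^ 4" using T(4)[OF z] by simp
        also have "\<dots> \<le> C0 * \<tau>\<^sup>2" using t42 T(2) by (rule mult_left_mono)
        finally have "Re (f (exp ?z)) \<le> Re ?w + C0 * \<tau>\<^sup>2" by simp
        also have "?w = of_real (1 + fp1 f * \<tau> + s2 / 2 * \<tau>\<^sup>2 + a * \<tau> ^ 3)" by simp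
        also have "Re \<dots> = 1 + fp1 f * \<tau> + s2 / 2 * \<tau>\<^sup>2 + a * \<tau> ^ 3" by (rule Re_complex_of_real)
        also have "a * \<tau> ^ 3 \<le> \<bar>a\<bar> * \<bar>\<tau>\<bar> ^ 3"
          by (metis abs_ge_self abs_mult power_abs)
        also have "\<dots> \<le> \<bar>a\<bar> * \<tau>\<^sup>2" using t32 by (simp add: mult_left_mono)
        finally show ?thesis by (simp add: Q_def algebra_simps)
      qed
      have "Xi M T n (exp ?z) = of_real (\<Sum>k\<le>n. mu n k * exp (\<tau> * k))"
        unfolding exp_of_real Xi_of_real by (simp add: exp_of_nat2_mult)
      then have "(\<Sum>k\<le>n. mu n k * exp (\<tau> * k)) \<le> cmod (Xi M T n (exp ?z))"
        by (simp only: norm_of_real)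
      also have "\<dots> = cmod (g (exp ?z)) * exp (Re (f (exp ?z)) * L) * cmod (1 + r)"
        unfolding r(2) by (simp add: norm_mult)
      also have "\<dots> \<le> (1 + \<bar>b\<bar> + C0) * exp ((1 + fp1 f * \<tau> + Q * \<tau>\<^sup>2) * L) * (1 + Ce)"
        using F L T(2) eC(2) by (intro mult_mono r1 G) (auto simp: mult_right_mono)
      also have "\<dots> = K * exp ((1 + fp1 f * \<tau> + Q * \<tau>\<^sup>2) * L)" by (simp add: K_def)
      finally have main: "(\<Sum>k\<le>n. mu n k * exp (\<tau> * k)) \<le> K * exp ((1 + fp1 f * \<tau> + Q * \<tau>\<^sup>2) * L)" .
      have "(\<Sum>k\<le>n. mu n k * exp (\<tau> * D n k)) = exp (- (\<tau> * fp1 f * L)) * (\<Sum>k\<le>n. mu n k * exp (\<tau> * k))"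
        unfolding sum_distrib_left
      proof (rule sum.cong)
        fix k
        have "exp (\<tau> * D n k) = exp (- (\<tau> * fp1 f * L)) * exp (\<tau> * k)"
          unfolding exp_add[symmetric] by (simp add: Dlt_def L_def algebra_simps)
        then show "mu n k * exp (\<tau> * D n k) = exp (- (\<tau> * fp1 f * L)) * (mu n k * exp (\<tau> * k))" by simp
      qed simp
      also have "\<dots> \<le> exp (- (\<tau> * fp1 f * L)) * (K * exp ((1 + fp1 f * \<tau> + Q * \<tau>\<^sup>2) * L))"
        by (intro mult_left_mono main) simp
      also have "\<dots> = K * (exp (- (\<tau> * fp1 f * L)) * exp ((1 + fp1 f * \<tau> + Q * \<tau>\<^sup>2) * L))" by simp
      also have "exp (- (\<tau> * fp1 f * L)) * exp ((1 + fp1 f * \<tau> + Q * \<tau>\<^sup>2) * L) = real n * exp (Q * \<tau>\<^sup>2 * L)"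
        unfolding nL exp_add[symmetric] by (simp add: algebra_simps)
      finally show ?thesis by (simp add: mult.assoc)
    qed
    show ?case
    proof (intro allI impI)
      fix t assume t: "Lg n powr (2 / 3) \<le> t"
      define l where "l = L powr (1 / 3)"
      have l: "l \<ge> 1" "l > 0" "l ^ 3 = L" "l ^ 2 \<le> t"
      proof -
        show "l \<ge> 1" using L by (simp add: l_def ge_one_powr_ge_zero)
        then show "l > 0" by simp
        show "l ^ 3 = L" using L(2) by (simp add: l_def powr_power)
        show "l ^ 2 \<le> t" using L(2) t by (simp add: l_def L_def[symmetric] powr_power)
      qed
      have t0: "t > 0" using l by (meson less_le_trans zero_less_power)
      have lt: "l \<le> sqrt t" using l by (simp add: real_le_rsqrt)
      define \<tau> where "\<tau> = \<kappa> / l"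
      have \<tau>: "\<tau> > 0" "\<bar>\<tau>\<bar> \<le> \<kappa>" "\<bar>- \<tau>\<bar> \<le> \<kappa>" using \<kappa> l by (auto simp: \<tau>_def divide_le_eq mult_le_cancel_left1)
      have tt: "\<tau> * t \<ge> \<kappa> * sqrt t"
      proof -
        have "sqrt t * l \<le> sqrt t * sqrt t" using lt t0 by (intro mult_left_mono) auto
        then have "sqrt t * l \<le> t" using t0 by simp
        then have "\<kappa> * (sqrt t * l) \<le> \<kappa> * t" using \<kappa> by (intro mult_left_mono) auto
        then show ?thesis using l by (simp add: \<tau>_def field_simps)
      qed
      have q: "Q * \<tau>\<^sup>2 * L \<le> \<tau> * t / 2"
      proof -
        have "Q * \<tau>\<^sup>2 * L = Q * \<kappa> * (\<kappa> * l)"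
          using l(2) unfolding l(3)[symmetric] \<tau>_def by (simp add: power2_eq_square power3_eq_cube)
        also have "\<dots> \<le> 1 / 2 * (\<kappa> * l)"
          using \<kappa> l Q by (intro mult_right_mono) (auto simp: field_simps)
        also have "\<kappa> * l \<le> \<tau> * t"
        proof -
          have "\<kappa> * l\<^sup>2 \<le> \<kappa> * t" using \<kappa> l by (intro mult_left_mono) auto
          then show ?thesis using l(2) by (simp add: \<tau>_def field_simps power2_eq_square)
        qed
        finally show ?thesis by simp
      qed
      have "(\<Sum>k | k \<le> n \<and> t \<le> \<bar>D n k\<bar>. mu n k)
        \<le> (\<Sum>k\<le>n. exp (- (\<tau> * t)) * (mu n k * exp (\<tau> * D n k) + mu n k * exp (- \<tau> * D n k)))"
      proof (rule order.trans[OF sum_mono sum_mono2])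
        fix k assume k: "k \<in> {k. k \<le> n \<and> t \<le> \<bar>D n k\<bar>}"
        then have "\<tau> * t \<le> \<tau> * \<bar>D n k\<bar>" using \<tau> by (intro mult_left_mono) auto
        then have "exp (\<tau> * t) \<le> exp (\<tau> * \<bar>D n k\<bar>)" by simp
        also have "\<dots> \<le> exp (\<tau> * D n k) + exp (- \<tau> * D n k)" by (cases "D n k \<ge> 0") auto
        finally have "1 \<le> exp (- (\<tau> * t)) * (exp (\<tau> * D n k) + exp (- \<tau> * D n k))"
          by (simp add: exp_minus field_simps)
        from mult_left_mono[OF this mu_nonneg[of n k]]
        show "mu n k \<le> exp (- (\<tau> * t)) * (mu n k * exp (\<tau> * D n k) + mu n k * exp (- \<tau> * D n k))"
          by (simp add: algebra_simps)
      qed (auto intro!: add_nonneg_nonneg mult_nonneg_nonneg mu_nonneg)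
      also have "\<dots> = exp (- (\<tau> * t)) * ((\<Sum>k\<le>n. mu n k * exp (\<tau> * D n k)) + (\<Sum>k\<le>n. mu n k * exp (- \<tau> * D n k)))"
        by (simp only: sum_distrib_left[symmetric] sum.distrib)
      also have "\<dots> \<le> exp (- (\<tau> * t)) * (K * real n * exp (Q * \<tau>\<^sup>2 * L) + K * real n * exp (Q * \<tau>\<^sup>2 * L))"
        using mgf[OF \<tau>(2)] mgf[OF \<tau>(3)] by (intro mult_left_mono add_mono) auto
      also have "\<dots> = 2 * K * real n * (exp (- (\<tau> * t)) * exp (Q * \<tau>\<^sup>2 * L))" by simp
      also have "\<dots> \<le> 2 * K * real n * exp (- (\<kappa> / 2) * sqrt t)"
        unfolding exp_add[symmetric] using q tt K by (intro mult_left_mono) auto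
      finally show "(\<Sum>k | k \<le> n \<and> t \<le> \<bar>D n k\<bar>. mu n k) \<le> 2 * K * real n * exp (- (\<kappa> / 2) * sqrt t)" .
    qed
  qed
  then show ?thesis using that[of "2 * K" "\<kappa> / 2"] K \<kappa> by simp
qed

text \<open>With a negative centre every level would be farther than \<open>L powr (2/3)\<close>
  from it, so the tail bound would make the total mass less than \<open>n / 2\<close>; but (I) at
  \<open>u = 1\<close> makes it about \<open>n\<close>. Nonnegativity guarantees that some level
  lies within distance 1 of the centre.\<close>

lemma fp1_nonneg: "fp1 f \<ge> 0"
proof (rule ccontr)
  assume neg: "\<not> fp1 f \<ge> 0"
  obtain C c where C: "C \<ge> 0" "c > 0"
    "\<forall>\<^sub>F n in sequentially. \<forall>t. Lg n powr (2 / 3) \<le> t \<longrightarrow>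
       (\<Sum>k | k \<le> n \<and> t \<le> \<bar>D n k\<bar>. mu n k) \<le> C * real n * exp (- c * sqrt t)"
    by (rule mean_profile_tail)
  obtain e Ce where eC: "e > 0" "Ce \<ge> 0"
    "\<forall>\<^sub>F n in sequentially. \<forall>u. cmod (u - 1) \<le> \<epsilon>0 \<longrightarrow>
       (\<exists>r. cmod r \<le> Ce * exp (- e * Lg n) \<and> Xi M T n u = g u * exp (f u * of_real (Lg n)) * (1 + r))"
    by (rule Xi_asymp)
  define v where "v = - fp1 f"
  have "v > 0" using neg by (simp add: v_def)
  then have "\<forall>\<^sub>F x in at_top. x powr (2 / 3) \<le> v * x" by real_asymp
  then have ev1: "\<forall>\<^sub>F n in sequentially. Lg n powr (2 / 3) \<le> v * Lg n" by (rule eventually_Lg_comp)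
  have "\<forall>\<^sub>F x in at_top. C * exp (- c * sqrt (x powr (2 / 3))) < 1 / 2" using C(2) by real_asymp
  then have ev2: "\<forall>\<^sub>F n in sequentially. C * exp (- c * sqrt (Lg n powr (2 / 3))) < 1 / 2" by (rule eventually_Lg_comp)
  have "\<forall>\<^sub>F x in at_top. Ce * exp (- e * x) < 1 / 2" using eC(1) by real_asymp
  then have ev3: "\<forall>\<^sub>F n in sequentially. Ce * exp (- e * Lg n) < 1 / 2" by (rule eventually_Lg_comp)
  have "\<forall>\<^sub>F n in sequentially. False"
    using C(3) eC(3) ev1 ev2 ev3 eventually_ge_at_top[of 3]
  proof eventually_elim
    case (elim n)
    have all: "{k. k \<le> n \<and> Lg n powr (2 / 3) \<le> \<bar>D n k\<bar>} = {..n}"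
    proof -
      have "Lg n powr (2 / 3) \<le> \<bar>D n k\<bar>" for k
        using elim(3) by (simp add: Dlt_def v_def)
      then show ?thesis by auto
    qed
    have "(\<Sum>k\<le>n. mu n k) \<le> C * real n * exp (- c * sqrt (Lg n powr (2 / 3)))"
      using elim(1) all by (metis order_refl)
    also have "\<dots> = real n * (C * exp (- c * sqrt (Lg n powr (2 / 3))))" by simp
    also have "\<dots> < real n * (1 / 2)" using elim(4,6) by (intro mult_strict_left_mono) auto
    finally have up: "(\<Sum>k\<le>n. mu n k) < real n * (1 / 2)" .
    have "cmod (1 - 1) \<le> \<epsilon>0" using eps0_pos by simp
    then obtain r where r: "cmod r \<le> Ce * exp (- e * Lg n)" "Xi M T n 1 = g 1 * exp (f 1 * of_real (Lg n)) * (1 + r)"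
      using elim(2) by blast
    have "Xi M T n 1 = of_real (\<Sum>k\<le>n. mu n k)" using Xi_of_real[of n 1] by simp
    moreover have "Xi M T n 1 = of_real (real n) * (1 + r)"
      unfolding r(2) f_1 g_1 exp_Lg[OF elim(6), symmetric] by (simp add: exp_of_real)
    ultimately have "Re (of_real (\<Sum>k\<le>n. mu n k)) = Re (of_real (real n) * (1 + r))" by simp
    then have "(\<Sum>k\<le>n. mu n k) = real n * (1 + Re r)"
      unfolding Re_of_real_mult Re_complex_of_real by simp
    moreover have "Re r > - 1 / 2" using abs_Re_le_cmod[of r] r(1) elim(5) by linarith
    then have "real n * (1 / 2) < real n * (1 + Re r)" using elim(6) by (intro mult_strict_left_mono) auto
    ultimately show False using up by simp
  qed
  then show False by simp
qed

end

section \<open>Moments of the profile\<close>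

lemma Lg_nonneg [simp]: "Lg n \<ge> 0" and Lg_nonzero [simp]: "Lg n \<noteq> 0" and abs_Lg [simp]: "\<bar>Lg n\<bar> = Lg n"
  using Lg_pos[of n] by (auto simp del: Lg_pos)

text \<open>The bound must not depend on the shift \<open>x\<close>, since the centre
  \<open>fp1 f * Lg n\<close> moves with \<open>n\<close> and is not an integer. These weights carry
  all later sums over levels.\<close>

lemma sum_inverse_one_plus_square_bounded:
  obtains S :: real where "S \<ge> 0"
    "\<And>(A :: nat set) x. finite A \<Longrightarrow> (\<Sum>k\<in>A. 1 / (1 + (real k - x)\<^sup>2)) \<le> S"
proof -
  define h where "h = (\<lambda>n::nat. 1 / (1 + (real n)\<^sup>2))"
  have sm: "summable h"
  proof (rule summable_comparison_test')
    show "summable (\<lambda>n. inverse (real n ^ 2))" by (rule inverse_power_summable) simp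
    show "norm (h n) \<le> inverse (real n ^ 2)" if "n \<ge> 1" for n
    proof -
      have "h n \<le> 1 / (real n)\<^sup>2"
        unfolding h_def using that by (intro divide_left_mono mult_pos_pos add_pos_nonneg) auto
      then show ?thesis by (simp add: h_def inverse_eq_divide)
    qed
  qed
  have h0: "h n \<ge> 0" for n by (simp add: h_def)
  \<comment> \<open>On one side of \<open>x\<close>, distinct levels have distinct integers
    \<open>i k\<close> below their distance to \<open>x\<close>, so each side costs at most one full
    series.\<close>
  have part: "(\<Sum>k\<in>A. 1 / (1 + (real k - x)\<^sup>2)) \<le> suminf h"
    if A: "finite A" and i: "inj_on i A" "\<And>k. k \<in> A \<Longrightarrow> real (i k) \<le> \<bar>real k - x\<bar>" for A x and i :: "nat \<Rightarrow> nat"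
  proof -
    have "(\<Sum>k\<in>A. 1 / (1 + (real k - x)\<^sup>2)) \<le> (\<Sum>k\<in>A. h (i k))"
    proof (rule sum_mono)
      fix k assume "k \<in> A"
      then have "(real (i k))\<^sup>2 \<le> (real k - x)\<^sup>2"
        using i(2) by (simp add: abs_le_square_iff[symmetric])
      then show "1 / (1 + (real k - x)\<^sup>2) \<le> h (i k)"
        unfolding h_def by (intro divide_left_mono) (auto intro!: mult_pos_pos add_pos_nonneg)
    qed
    also have "\<dots> = sum h (i ` A)" using i(1) by (simp add: sum.reindex)
    also have "\<dots> \<le> suminf h" using A sm h0 by (intro sum_le_suminf) auto
    finally show ?thesis .
  qed
  show ?thesis
  proof (rule that[of "2 * suminf h"])
    show "0 \<le> 2 * suminf h" using suminf_nonneg[OF sm h0] by simp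
    fix A :: "nat set" and x assume A: "finite A"
    let ?A1 = "{k \<in> A. x \<le> real k}" and ?A2 = "{k \<in> A. \<not> x \<le> real k}"
    have "(\<Sum>k\<in>A. 1 / (1 + (real k - x)\<^sup>2)) =
        (\<Sum>k\<in>?A1. 1 / (1 + (real k - x)\<^sup>2)) + (\<Sum>k\<in>?A2. 1 / (1 + (real k - x)\<^sup>2))"
      using A by (subst sum.union_disjoint[symmetric]) (auto intro!: sum.cong)
    also have "(\<Sum>k\<in>?A1. 1 / (1 + (real k - x)\<^sup>2)) \<le> suminf h"
    proof (rule part[of _ "\<lambda>k. nat (int k - \<lceil>x\<rceil>)"])
      show "inj_on (\<lambda>k. nat (int k - \<lceil>x\<rceil>)) ?A1"
        by (rule inj_onI) (auto simp: ceiling_le_iff nat_eq_iff2 split: if_splits)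
      show "real (nat (int k - \<lceil>x\<rceil>)) \<le> \<bar>real k - x\<bar>" if "k \<in> ?A1" for k
        using that le_of_int_ceiling[of x] by (auto simp: ceiling_le_iff)
    qed (use A in simp)
    also have "(\<Sum>k\<in>?A2. 1 / (1 + (real k - x)\<^sup>2)) \<le> suminf h"
    proof (rule part[of _ "\<lambda>k. nat (\<lfloor>x\<rfloor> - int k)"])
      have le: "int k \<le> \<lfloor>x\<rfloor>" if "k \<in> ?A2" for k using that by (simp add: le_floor_iff)
      show "inj_on (\<lambda>k. nat (\<lfloor>x\<rfloor> - int k)) ?A2"
      proof (rule inj_onI)
        fix j k assume jk: "j \<in> ?A2" "k \<in> ?A2" "nat (\<lfloor>x\<rfloor> - int j) = nat (\<lfloor>x\<rfloor> - int k)"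
        then show "j = k" using le[OF jk(1)] le[OF jk(2)] by (simp add: eq_nat_nat_iff)
      qed
      show "real (nat (\<lfloor>x\<rfloor> - int k)) \<le> \<bar>real k - x\<bar>" if "k \<in> ?A2" for k
      proof -
        have "real (nat (\<lfloor>x\<rfloor> - int k)) = of_int \<lfloor>x\<rfloor> - real k" using le[OF that] by simp
        then show ?thesis using of_int_floor_le[of x] by linarith
      qed
    qed (use A in simp)
    finally show "(\<Sum>k\<in>A. 1 / (1 + (real k - x)\<^sup>2)) \<le> 2 * suminf h" by simp
  qed
qed

lemma power_add_le:
  fixes x y :: real
  assumes "x \<ge> 0" "y \<ge> 0"
  shows "(x + y) ^ p \<le> 2 ^ p * (x ^ p + y ^ p)"
proof -
  have "(x + y) ^ p \<le> (2 * max x y) ^ p" using assms by (intro power_mono) auto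
  also have "\<dots> = 2 ^ p * (max x y) ^ p" by (simp add: power_mult_distrib)
  also have "(max x y) ^ p \<le> x ^ p + y ^ p" using assms by (auto simp: max_def)
  finally show ?thesis by simp
qed

context profile_family
begin

lemma scale_pos: "n \<ge> 1 \<Longrightarrow> scale n > 0" and scale_nonneg: "scale n \<ge> 0"
  by (auto simp: scale_def)

definition \<kappa> :: real where "\<kappa> = 1 / sqrt (2 * pi * s2)"

lemma kappa_pos: "\<kappa> > 0" using variance_pos by (simp add: \<kappa>_def)

lemma peak_eq: "peak n = \<kappa> * scale n * Lg n"
proof -
  have "Lg n * sqrt (Lg n) \<noteq> 0" using Lg_pos[of n] by (simp del: Lg_pos)
  then show ?thesis
    unfolding peak_def scale_def \<kappa>_def powr_minus_3_2[OF Lg_pos] by (simp add: real_sqrt_mult)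
qed

lemma peak_pos: "n \<ge> 1 \<Longrightarrow> peak n > 0"
  unfolding peak_eq using kappa_pos scale_pos by simp

text \<open>The Gaussian deficit is comparable with the smaller of \<open>d^2\<close> and
  \<open>L\<close>, times \<open>scale n\<close>. For \<open>1 <= d <= L powr (2/3)\<close> both
  dominate \<open>d * sqrt d\<close>; this power still beats the local limit error, which is linear
  in \<open>d\<close>.\<close>

lemma mean_profile_gap:
  obtains c D0 where "c > 0" "D0 \<ge> 1"
    "\<forall>\<^sub>F n in sequentially. \<forall>k. D0 \<le> \<bar>D n k\<bar> \<and> \<bar>D n k\<bar> \<le> Lg n powr (2 / 3) \<longrightarrow>
       c * (\<bar>D n k\<bar> * sqrt \<bar>D n k\<bar>) * scale n \<le> peak n - mu n k"
proof -
  obtain C where C: "C \<ge> 0"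
    "\<forall>\<^sub>F n in sequentially. \<forall>k.
       \<bar>mu n k - peak n * exp (- (D n k)\<^sup>2 / (2 * (s2 * Lg n)))\<bar> \<le> C * (\<bar>D n k\<bar> + 1) * scale n"
    by (rule local_limit)
  \<comment> \<open>The final division by 2 reserves half of the Gaussian deficit for the local
    limit error.\<close>
  define c where "c = \<kappa> / (2 * s2 + 1) / 2"
  have c: "c > 0" using kappa_pos variance_pos by (simp add: c_def)
  \<comment> \<open>From \<open>D0\<close> on, \<open>2 * C <= c * sqrt d\<close>, so the error
    \<open>C * (d + 1)\<close> is at most \<open>c * d * sqrt d\<close>.\<close>
  define D0 where "D0 = max 1 ((2 * C / c)\<^sup>2)"
  have "\<forall>\<^sub>F n in sequentially. \<forall>k. D0 \<le> \<bar>D n k\<bar> \<and> \<bar>D n k\<bar> \<le> Lg n powr (2 / 3) \<longrightarrow>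
       c * (\<bar>D n k\<bar> * sqrt \<bar>D n k\<bar>) * scale n \<le> peak n - mu n k"
    using C(2) eventually_ge_at_top[of 1]
  proof eventually_elim
    case (elim n)
    show ?case
    proof (intro allI impI)
      fix k assume k: "D0 \<le> \<bar>D n k\<bar> \<and> \<bar>D n k\<bar> \<le> Lg n powr (2 / 3)"
      define L where "L = Lg n"
      have L: "L > 0" by (simp add: L_def)
      define d where "d = \<bar>D n k\<bar>"
      define w where "w = d * sqrt d"
      have d1: "d \<ge> 1" and d2: "(2 * C / c)\<^sup>2 \<le> d" and d3: "d \<le> L powr (2 / 3)"
        using k by (auto simp: d_def D0_def L_def)
      have sd: "1 \<le> sqrt d" using d1 by simp
      have w1: "0 \<le> w" "w \<le> d\<^sup>2"
      proof -
        show "0 \<le> w" using d1 by (simp add: w_def)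
        have "sqrt d * 1 \<le> sqrt d * sqrt d" using sd by (intro mult_left_mono) auto
        then have "sqrt d \<le> d" using d1 by simp
        then show "w \<le> d\<^sup>2" using d1 by (simp add: w_def power2_eq_square mult_left_mono)
      qed
      have wL: "w \<le> L"
      proof -
        have "w = d powr (3 / 2)"
        proof -
          have "d powr (3 / 2) = d powr (1 + 1 / 2)" by simp
          also have "\<dots> = d * sqrt d" using d1 by (subst powr_add) (simp add: powr_half_sqrt)
          finally show ?thesis by (simp add: w_def)
        qed
        also have "\<dots> \<le> (L powr (2 / 3)) powr (3 / 2)" using d1 d3 by (intro powr_mono2) auto
        also have "\<dots> = L" using L by (simp add: powr_powr)
        finally show ?thesis .
      qed
      define y where "y = d\<^sup>2 / (2 * (s2 * L))"
      have y0: "y \<ge> 0" using variance_pos L by (simp add: y_def)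
      have "exp (- y) \<le> 1 / (1 + y)"
        using exp_ge_add_one_self[of y] y0 by (simp add: exp_minus divide_simps)
      then have e1: "1 - exp (- y) \<ge> y / (1 + y)" using y0 by (simp add: field_simps)
      \<comment> \<open>The left side equals \<open>L * d^2 / (2 * s2 * L + d^2)\<close>, so
        bounding \<open>w\<close> by \<open>d^2\<close> against the first summand of the denominator
        and by \<open>L\<close> against the second is enough.\<close>
      have e2: "L * (y / (1 + y)) \<ge> w / (2 * s2 + 1)"
      proof -
        have eq: "L * (y / (1 + y)) = L * d\<^sup>2 / (2 * s2 * L + d\<^sup>2)"
        proof -
          have "L * (d\<^sup>2 / (2 * (v * L)) / (1 + d\<^sup>2 / (2 * (v * L)))) = L * d\<^sup>2 / (2 * v * L + d\<^sup>2)"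
            if "v > 0" for v
            using that L by (simp add: divide_simps add_pos_nonneg)
          from this[OF variance_pos] show ?thesis unfolding y_def .
        qed
        have "2 * s2 * L * w \<le> 2 * s2 * L * d\<^sup>2" using variance_pos L w1 by (intro mult_left_mono) auto
        moreover have "w * d\<^sup>2 \<le> L * d\<^sup>2" using wL by (intro mult_right_mono) auto
        ultimately have "w * (2 * s2 * L + d\<^sup>2) \<le> L * d\<^sup>2 * (2 * s2 + 1)"
          by (simp add: algebra_simps)
        moreover have "2 * s2 * L + d\<^sup>2 > 0" "2 * s2 + 1 > 0" using variance_pos L by (auto intro!: add_pos_nonneg)
        ultimately show ?thesis unfolding eq by (simp add: divide_le_eq pos_le_divide_eq)
      qed
      have dd: "(D n k)\<^sup>2 = d\<^sup>2" by (simp add: d_def)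
      have "mu n k - peak n * exp (- y) \<le> C * (d + 1) * scale n"
        using elim(1)[rule_format, of k] unfolding dd y_def L_def d_def[symmetric] by simp
      moreover have "peak n * (1 - exp (- y)) \<ge> \<kappa> * scale n * (w / (2 * s2 + 1))"
      proof -
        have "\<kappa> * scale n * (w / (2 * s2 + 1)) \<le> \<kappa> * scale n * (L * (1 - exp (- y)))"
        proof (rule mult_left_mono)
          have "L * (y / (1 + y)) \<le> L * (1 - exp (- y))" using e1 L by (intro mult_left_mono) auto
          then show "w / (2 * s2 + 1) \<le> L * (1 - exp (- y))" using e2 by linarith
        qed (use kappa_pos scale_nonneg in simp)
        then show ?thesis unfolding peak_eq L_def by (simp add: mult.assoc)
      qed
      moreover have "C * (d + 1) * scale n \<le> c * w * scale n"
      proof (rule mult_right_mono[OF _ scale_nonneg])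
        have "2 * C / c \<le> sqrt d" using d2 by (rule real_le_rsqrt)
        then have "2 * C \<le> c * sqrt d" using c by (simp add: field_simps)
        then have "2 * C * d \<le> c * sqrt d * d" using d1 by (intro mult_right_mono) auto
        moreover have "C * (d + 1) \<le> C * (2 * d)" using C d1 by (intro mult_left_mono) auto
        ultimately show "C * (d + 1) \<le> c * w" by (simp add: w_def mult_ac)
      qed
      moreover have "\<kappa> * scale n * (w / (2 * s2 + 1)) = 2 * (c * w * scale n)"
      proof -
        have "\<kappa> * scale n * (w / v) = 2 * (\<kappa> / v / 2 * w * scale n)" for v by simp
        then show ?thesis unfolding c_def .
      qed
      moreover have "peak n * (1 - exp (- y)) = peak n - peak n * exp (- y)" by (simp add: algebra_simps)
      ultimately have "c * w * scale n \<le> peak n - mu n k" by linarith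
      then show "c * (\<bar>D n k\<bar> * sqrt \<bar>D n k\<bar>) * scale n \<le> peak n - mu n k"
        by (simp only: w_def d_def)
    qed
  qed
  then show ?thesis using that[of c D0] c by (simp add: D0_def)
qed

text \<open>(III) divides by \<open>L^m\<close>, and by the local limit the mean is at most of order
  \<open>scale n * L\<close> here, so the powers of \<open>L\<close> cancel. Evenness of
  \<open>m\<close> turns the signed moments of (III) into absolute ones.\<close>

lemma profile_central_moment:
  assumes "even m"
  obtains C where "C \<ge> 0"
    "\<forall>\<^sub>F n in sequentially. \<forall>k. \<bar>D n k\<bar> \<le> Lg n powr (2 / 3) \<longrightarrow>
       (\<integral>\<omega>. \<bar>Y n k \<omega> - mu n k\<bar> ^ m \<partial>M n) \<le> C * (\<bar>D n k\<bar> * scale n) ^ m"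
proof -
  obtain C1 where C1: "C1 \<ge> 0"
    "\<forall>\<^sub>F n in sequentially. \<forall>k.
       \<bar>mu n k - peak n * exp (- (D n k)\<^sup>2 / (2 * (s2 * Lg n)))\<bar> \<le> C1 * (\<bar>D n k\<bar> + 1) * scale n"
    by (rule local_limit)
  have "((\<lambda>x. x powr (- 1 / 3)) \<longlongrightarrow> (0::real)) at_top" by real_asymp
  \<comment> \<open>An admissible null sequence for (III): multiplied by \<open>Lg n\<close> it is
    exactly the cutoff \<open>Lg n powr (2 / 3)\<close>.\<close>
  then have eta: "(\<lambda>n. Lg n powr (- 1 / 3)) \<longlonglongrightarrow> 0" by (rule filterlim_compose[OF _ Lg_at_top])
  obtain C2 where C2: "\<forall>\<^sub>F n in sequentially. \<forall>k. \<bar>D n k\<bar> \<le> Lg n powr (- 1 / 3) * Lg n \<longrightarrow>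
           \<bar>\<integral>\<omega>. (Y n k \<omega> - mu n k) ^ m \<partial>M n\<bar> \<le> C2 * (\<bar>D n k\<bar> ^ m / Lg n ^ m * mu n k ^ m)"
    using cond_III[unfolded cond_III_def, rule_format, OF eta, of m] by blast
  define K where "K = \<kappa> + 2 * C1"
  have K: "K \<ge> 0" using kappa_pos C1 by (simp add: K_def)
  have "\<forall>\<^sub>F n in sequentially. \<forall>k. \<bar>D n k\<bar> \<le> Lg n powr (2 / 3) \<longrightarrow>
       (\<integral>\<omega>. \<bar>Y n k \<omega> - mu n k\<bar> ^ m \<partial>M n) \<le> (max C2 0 * K ^ m) * (\<bar>D n k\<bar> * scale n) ^ m"
    using C1(2) C2
  proof eventually_elim
    case (elim n)
    show ?case
    proof (intro allI impI)
      fix k assume k: "\<bar>D n k\<bar> \<le> Lg n powr (2 / 3)"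
      define L where "L = Lg n"
      have L: "L > 0" "L \<ge> 1" by (simp_all add: L_def)
      have "L powr (- 1 / 3) * L = L powr (- 1 / 3) * L powr 1" using L by simp
      also have "\<dots> = L powr (2 / 3)" unfolding powr_add[symmetric] by simp
      finally have k': "\<bar>D n k\<bar> \<le> Lg n powr (- 1 / 3) * Lg n" using k by (simp add: L_def)
      have "L powr (2 / 3) \<le> L powr 1" using L by (intro powr_mono) auto
      then have dL: "\<bar>D n k\<bar> \<le> L" using k L by (simp add: L_def)
      have mu: "mu n k \<le> K * scale n * L"
      proof -
        have "mu n k \<le> peak n * exp (- (D n k)\<^sup>2 / (2 * (s2 * Lg n))) + C1 * (\<bar>D n k\<bar> + 1) * scale n"
          using elim(1)[rule_format, of k] by linarith
        also have "exp (- (D n k)\<^sup>2 / (2 * (s2 * Lg n))) \<le> 1"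
          using variance_pos by (simp add: less_imp_le)
        then have "peak n * exp (- (D n k)\<^sup>2 / (2 * (s2 * Lg n))) \<le> peak n"
          using kappa_pos scale_nonneg[of n] by (intro mult_left_le) (auto simp: peak_eq less_imp_le)
        also have "C1 * (\<bar>D n k\<bar> + 1) * scale n \<le> C1 * (2 * L) * scale n"
          using C1 dL L scale_nonneg by (intro mult_right_mono mult_left_mono) auto
        finally show ?thesis unfolding peak_eq L_def K_def by (simp add: algebra_simps)
      qed
      have "(\<integral>\<omega>. \<bar>Y n k \<omega> - mu n k\<bar> ^ m \<partial>M n) = (\<integral>\<omega>. (Y n k \<omega> - mu n k) ^ m \<partial>M n)"
        using assms by (simp add: power_even_abs)
      also have "\<dots> \<le> C2 * (\<bar>D n k\<bar> ^ m / Lg n ^ m * mu n k ^ m)"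
        using elim(2)[rule_format, OF k'] by linarith
      also have "\<dots> \<le> max C2 0 * (\<bar>D n k\<bar> ^ m / L ^ m * (K * scale n * L) ^ m)"
        unfolding L_def[symmetric] using mu mu_nonneg[of n k] L
        by (intro mult_mono mult_left_mono power_mono) (auto intro!: mult_nonneg_nonneg)
      also have "\<dots> = (max C2 0 * K ^ m) * (\<bar>D n k\<bar> * scale n) ^ m"
        using L by (simp add: power_mult_distrib)
      finally show "(\<integral>\<omega>. \<bar>Y n k \<omega> - mu n k\<bar> ^ m \<partial>M n) \<le> (max C2 0 * K ^ m) * (\<bar>D n k\<bar> * scale n) ^ m" .
    qed
  qed
  then show ?thesis using that[of "max C2 0 * K ^ m"] K by simp
qed

lemma eventually_le_Lg_powr: "\<forall>\<^sub>F n in sequentially. (x::real) \<le> Lg n powr (2 / 3)"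
proof -
  have "\<forall>\<^sub>F y in at_top. x \<le> y powr (2 / 3)" by real_asymp
  then show ?thesis by (rule eventually_Lg_comp)
qed

text \<open>At bounded distance from the centre the Gaussian factor lowers the peak by a relative
  \<open>O(1 / L)\<close> only, that is by \<open>O(scale n)\<close>; the local limit error and the
  fluctuation from (III) have the same order.\<close>

lemma central_profile_moment:
  assumes "even p" and D0: "D0 \<ge> 0"
  obtains C where "C \<ge> 0"
    "\<forall>\<^sub>F n in sequentially. \<forall>k. \<bar>D n k\<bar> \<le> D0 \<longrightarrow>
       (\<integral>\<omega>. \<bar>Y n k \<omega> - peak n\<bar> ^ p \<partial>M n) \<le> C * scale n ^ p"
proof -
  obtain C1 where C1: "C1 \<ge> 0"
    "\<forall>\<^sub>F n in sequentially. \<forall>k.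
       \<bar>mu n k - peak n * exp (- (D n k)\<^sup>2 / (2 * (s2 * Lg n)))\<bar> \<le> C1 * (\<bar>D n k\<bar> + 1) * scale n"
    by (rule local_limit)
  obtain C2 where C2: "C2 \<ge> 0"
    "\<forall>\<^sub>F n in sequentially. \<forall>k. \<bar>D n k\<bar> \<le> Lg n powr (2 / 3) \<longrightarrow>
       (\<integral>\<omega>. \<bar>Y n k \<omega> - mu n k\<bar> ^ p \<partial>M n) \<le> C2 * (\<bar>D n k\<bar> * scale n) ^ p"
    by (rule profile_central_moment[OF assms(1)])
  define B where "B = C1 * (D0 + 1) + \<kappa> * D0\<^sup>2 / (2 * s2)"
  have B: "B \<ge> 0" using C1 D0 kappa_pos variance_pos by (simp add: B_def)
  define C where "C = 2 ^ p * (C2 * D0 ^ p + B ^ p)"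
  have "\<forall>\<^sub>F n in sequentially. \<forall>k. \<bar>D n k\<bar> \<le> D0 \<longrightarrow>
       (\<integral>\<omega>. \<bar>Y n k \<omega> - peak n\<bar> ^ p \<partial>M n) \<le> C * scale n ^ p"
    using C1(2) C2(2) eventually_le_Lg_powr[of D0] eventually_ge_at_top[of 1]
  proof eventually_elim
    case (elim n)
    interpret prob_space "M n" by (rule prob_space_M[OF elim(4)])
    show ?case
    proof (intro allI impI)
      fix k assume k: "\<bar>D n k\<bar> \<le> D0"
      have d2: "(D n k)\<^sup>2 \<le> D0\<^sup>2" using k D0 by (simp add: abs_le_square_iff[symmetric])
      define y where "y = (D n k)\<^sup>2 / (2 * (s2 * Lg n))"
      have y0: "y \<ge> 0" using variance_pos by (simp add: y_def less_imp_le)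
      have "\<bar>mu n k - peak n * exp (- y)\<bar> \<le> C1 * (D0 + 1) * scale n"
      proof -
        have "C1 * (\<bar>D n k\<bar> + 1) * scale n \<le> C1 * (D0 + 1) * scale n"
          using C1 k scale_nonneg by (intro mult_right_mono mult_left_mono) auto
        then show ?thesis using elim(1)[rule_format, of k] by (simp add: y_def)
      qed
      moreover have "\<bar>peak n * exp (- y) - peak n\<bar> \<le> \<kappa> * D0\<^sup>2 / (2 * s2) * scale n"
      proof -
        have "1 - exp (- y) \<le> y" using exp_ge_add_one_self[of "- y"] by linarith
        moreover have "exp (- y) \<le> 1" using y0 by simp
        ultimately have "\<bar>1 - exp (- y)\<bar> \<le> y" by simp
        then have "peak n * \<bar>1 - exp (- y)\<bar> \<le> peak n * y"
          using peak_pos[OF elim(4)] by (intro mult_left_mono) auto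
        also have "peak n * y = \<kappa> * scale n * ((D n k)\<^sup>2 / (2 * s2))"
        proof -
          have "\<kappa> * scale n * Lg n * (x / (2 * (v * Lg n))) = \<kappa> * scale n * (x / (2 * v))" for x v
            by simp
          from this[of "(D n k)\<^sup>2" s2] show ?thesis unfolding peak_eq y_def .
        qed
        also have "\<dots> \<le> \<kappa> * scale n * (D0\<^sup>2 / (2 * s2))"
          using d2 kappa_pos scale_nonneg[of n] variance_pos
          by (intro mult_left_mono divide_right_mono) auto
        finally have "peak n * \<bar>1 - exp (- y)\<bar> \<le> \<kappa> * D0\<^sup>2 / (2 * s2) * scale n" by (simp add: mult_ac)
        moreover have "\<bar>peak n * exp (- y) - peak n\<bar> = peak n * \<bar>1 - exp (- y)\<bar>"
        proof -
          have "peak n * exp (- y) - peak n = - (peak n * (1 - exp (- y)))" by (simp add: algebra_simps)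
          then show ?thesis using peak_pos[OF elim(4)] by (simp add: abs_mult)
        qed
        ultimately show ?thesis by simp
      qed
      ultimately have mp: "\<bar>mu n k - peak n\<bar> \<le> B * scale n"
        unfolding B_def distrib_right by linarith
      have "(\<integral>\<omega>. \<bar>Y n k \<omega> - peak n\<bar> ^ p \<partial>M n) \<le> (\<integral>\<omega>. 2 ^ p * (\<bar>Y n k \<omega> - mu n k\<bar> ^ p + (B * scale n) ^ p) \<partial>M n)"
      proof (rule integral_mono')
        show "integrable (M n) (\<lambda>\<omega>. 2 ^ p * (\<bar>Y n k \<omega> - mu n k\<bar> ^ p + (B * scale n) ^ p))"
          using integrable_Y_power[OF elim(4), of k "mu n k" p] by simp
        fix \<omega>
        have "\<bar>Y n k \<omega> - peak n\<bar> ^ p \<le> (\<bar>Y n k \<omega> - mu n k\<bar> + B * scale n) ^ p"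
          using mp by (intro power_mono) auto
        also have "\<dots> \<le> 2 ^ p * (\<bar>Y n k \<omega> - mu n k\<bar> ^ p + (B * scale n) ^ p)"
          using B scale_nonneg by (intro power_add_le) auto
        finally show "\<bar>Y n k \<omega> - peak n\<bar> ^ p \<le> 2 ^ p * (\<bar>Y n k \<omega> - mu n k\<bar> ^ p + (B * scale n) ^ p)" .
      qed (use B scale_nonneg in auto)
      also have "\<dots> = 2 ^ p * ((\<integral>\<omega>. \<bar>Y n k \<omega> - mu n k\<bar> ^ p \<partial>M n) + (B * scale n) ^ p)"
        using integrable_Y_power[OF elim(4), of k "mu n k" p] by (simp add: prob_space)
      also have "(\<integral>\<omega>. \<bar>Y n k \<omega> - mu n k\<bar> ^ p \<partial>M n) \<le> C2 * (D0 * scale n) ^ p"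
      proof -
        have "\<bar>D n k\<bar> \<le> Lg n powr (2 / 3)" using k elim(3) by simp
        then have "(\<integral>\<omega>. \<bar>Y n k \<omega> - mu n k\<bar> ^ p \<partial>M n) \<le> C2 * (\<bar>D n k\<bar> * scale n) ^ p"
          using elim(2) by blast
        also have "\<dots> \<le> C2 * (D0 * scale n) ^ p"
          using C2 k scale_nonneg by (intro mult_left_mono power_mono mult_right_mono) auto
        finally show ?thesis .
      qed
      finally show "(\<integral>\<omega>. \<bar>Y n k \<omega> - peak n\<bar> ^ p \<partial>M n) \<le> C * scale n ^ p"
        by (simp add: C_def power_mult_distrib algebra_simps)
    qed
  qed
  then show ?thesis using that[of C] C2(1) D0 B by (simp add: C_def)
qed

section \<open>Moments of the width\<close>

lemma width_attained_le:
  assumes "n \<ge> 1" "\<omega> \<in> space (M n)" "profile (T n \<omega>) k = width (T n \<omega>)"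
  shows "k \<le> n"
  using profile_eq_0[OF assms(1,2), of k] assms(3) width_ge_1[of "T n \<omega>"] by (metis not_le not_one_le_zero)

text \<open>A pointwise bound replaces the maximum by a sum over levels. Below the peak, one level
  near the centre bounds the width from below. Above it, the maximising level is central,
  intermediate or far, and each case has its own summand.\<close>

lemma width_moment_peak:
  assumes p: "even p" "p \<ge> 2"
  obtains C where "C \<ge> 0"
    "\<forall>\<^sub>F n in sequentially. (\<integral>\<omega>. \<bar>W n \<omega> - peak n\<bar> ^ p \<partial>M n) \<le> C * scale n ^ p"
proof -
  obtain c D0 where gap: "c > 0" "D0 \<ge> 1"
    "\<forall>\<^sub>F n in sequentially. \<forall>k. D0 \<le> \<bar>D n k\<bar> \<and> \<bar>D n k\<bar> \<le> Lg n powr (2 / 3) \<longrightarrow>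
       c * (\<bar>D n k\<bar> * sqrt \<bar>D n k\<bar>) * scale n \<le> peak n - mu n k"
    by (rule mean_profile_gap)
  \<comment> \<open>The exponent is chosen for the intermediate levels. Dividing a moment of order
    \<open>3 p + 4\<close>, of size \<open>z^(3 p + 4)\<close>, by the power \<open>2 p + 4\<close>
    of the gap \<open>z^(3/2)\<close> leaves exactly \<open>z^-2\<close>, which is summable, and
    \<open>scale n\<close> to the power \<open>p\<close>.\<close>
  have "even (3 * p + 4)" using p by simp
  then obtain C1 where C1: "C1 \<ge> 0"
    "\<forall>\<^sub>F n in sequentially. \<forall>k. \<bar>D n k\<bar> \<le> Lg n powr (2 / 3) \<longrightarrow>
       (\<integral>\<omega>. \<bar>Y n k \<omega> - mu n k\<bar> ^ (3 * p + 4) \<partial>M n) \<le> C1 * (\<bar>D n k\<bar> * scale n) ^ (3 * p + 4)"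
    by (rule profile_central_moment)
  have "D0 \<ge> 0" using gap by simp
  then obtain C2 where C2: "C2 \<ge> 0"
    "\<forall>\<^sub>F n in sequentially. \<forall>k. \<bar>D n k\<bar> \<le> D0 \<longrightarrow>
       (\<integral>\<omega>. \<bar>Y n k \<omega> - peak n\<bar> ^ p \<partial>M n) \<le> C2 * scale n ^ p"
    by (rule central_profile_moment[OF p(1)])
  obtain C3 c3 where C3: "C3 \<ge> 0" "c3 > 0"
    "\<forall>\<^sub>F n in sequentially. \<forall>t. Lg n powr (2 / 3) \<le> t \<longrightarrow>
       (\<Sum>k | k \<le> n \<and> t \<le> \<bar>D n k\<bar>. mu n k) \<le> C3 * real n * exp (- c3 * sqrt t)"
    by (rule mean_profile_tail)
  obtain S :: real where S: "S \<ge> 0"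
    "\<And>(A :: nat set) x. finite A \<Longrightarrow> (\<Sum>k\<in>A. 1 / (1 + (real k - x)\<^sup>2)) \<le> S"
    by (rule sum_inverse_one_plus_square_bounded) blast
  \<comment> \<open>The tail at the cutoff decays faster than any power of \<open>L\<close>, so it
    pays for the factor between \<open>n^p\<close> and \<open>scale n ^ p\<close>.\<close>
  have ev1: "\<forall>\<^sub>F n in sequentially. exp (- c3 * sqrt (Lg n powr (2 / 3))) \<le> Lg n powr (- (3 / 2 * real p))"
  proof -
    define q where "q = 3 / 2 * real p"
    have "\<forall>\<^sub>F y in at_top. exp (- c3 * sqrt (y powr (2 / 3))) \<le> y powr (- q)"
      using C3(2) by real_asymp
    then show ?thesis unfolding q_def by (rule eventually_Lg_comp)
  qed
  define K where "K = node_bound"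
  define B2 where "B2 = C2 * (1 + D0\<^sup>2)"
  define B1 where "B1 = 2 * (C1 / c ^ (2 * p + 4))"
  have B: "B1 \<ge> 0" "B2 \<ge> 0" using C1 C2 gap by (auto simp: B1_def B2_def)
  define C where "C = C2 + B2 * S + B1 * S + K ^ (p - 1) * C3"
  have "\<forall>\<^sub>F n in sequentially. (\<integral>\<omega>. \<bar>W n \<omega> - peak n\<bar> ^ p \<partial>M n) \<le> C * scale n ^ p"
    using gap(3) C1(2) C2(2) C3(3) ev1 eventually_ge_at_top[of 1]
  proof eventually_elim
    case (elim n)
    note n = elim(6)
    interpret prob_space "M n" by (rule prob_space_M[OF n])
    define l where "l = Lg n powr (2 / 3)"
    define x where "x = fp1 f * Lg n"
    have Dx: "D n k = real k - x" for k by (simp add: Dlt_def x_def)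
    define A1 where "A1 = {k. k \<le> n \<and> \<bar>D n k\<bar> \<le> D0}"
    define A2 where "A2 = {k. k \<le> n \<and> D0 \<le> \<bar>D n k\<bar> \<and> \<bar>D n k\<bar> \<le> l}"
    define A3 where "A3 = {k. k \<le> n \<and> l \<le> \<bar>D n k\<bar>}"
    have fin: "finite A1" "finite A2" "finite A3" by (auto simp: A1_def A2_def A3_def)
    define k0 where "k0 = nat \<lfloor>x\<rfloor>"
    have "x \<ge> 0" using fp1_nonneg by (simp add: x_def)
    then have "\<bar>D n k0\<bar> \<le> 1" unfolding Dx k0_def by linarith
    then have k0: "\<bar>D n k0\<bar> \<le> D0" using gap(2) by linarith
    define d where "d = (\<lambda>k. peak n - mu n k)"
    define a where "a = scale n"
    have a: "a > 0" using scale_pos[OF n] by (simp add: a_def)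
    have dge: "c * (\<bar>D n k\<bar> * sqrt \<bar>D n k\<bar>) * a \<le> d k" and dpos: "d k > 0" and D1: "\<bar>D n k\<bar> \<ge> 1"
      if "k \<in> A2" for k
    proof -
      show *: "\<bar>D n k\<bar> \<ge> 1" using that gap(2) by (auto simp: A2_def)
      show "c * (\<bar>D n k\<bar> * sqrt \<bar>D n k\<bar>) * a \<le> d k"
        using elim(1) that by (simp add: A2_def l_def d_def a_def)
      moreover have "c * (\<bar>D n k\<bar> * sqrt \<bar>D n k\<bar>) * a > 0" using gap(1) a * by (intro mult_pos_pos) auto
      ultimately show "d k > 0" by linarith
    qed
    define R where "R = (\<lambda>\<omega>. \<bar>Y n k0 \<omega> - peak n\<bar> ^ p + (\<Sum>k\<in>A1. \<bar>Y n k \<omega> - peak n\<bar> ^ p)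
        + (\<Sum>k\<in>A2. \<bar>Y n k \<omega> - mu n k\<bar> ^ (3 * p + 4) / d k ^ (2 * p + 4))
        + (\<Sum>k\<in>A3. (K * real n) ^ (p - 1) * Y n k \<omega>))"
    have K0: "K \<ge> 0" by (simp add: K_def node_bound_nonneg)
    have nn: "0 \<le> (\<Sum>k\<in>A1. \<bar>Y n k \<omega> - peak n\<bar> ^ p)"
      "0 \<le> (\<Sum>k\<in>A2. \<bar>Y n k \<omega> - mu n k\<bar> ^ (3 * p + 4) / d k ^ (2 * p + 4))"
      "0 \<le> (\<Sum>k\<in>A3. (K * real n) ^ (p - 1) * Y n k \<omega>)"
      "0 \<le> \<bar>Y n k0 \<omega> - peak n\<bar> ^ p" for \<omega>
      using less_imp_le[OF dpos] K0 by (auto intro!: sum_nonneg divide_nonneg_nonneg zero_le_power)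
    have ptw: "\<bar>W n \<omega> - peak n\<bar> ^ p \<le> R \<omega>" if \<omega>: "\<omega> \<in> space (M n)" for \<omega>
    proof (cases "W n \<omega> \<le> peak n")
      case True
      have "Y n k0 \<omega> \<le> W n \<omega>" using profile_le_width by simp
      then have "\<bar>W n \<omega> - peak n\<bar> ^ p \<le> \<bar>Y n k0 \<omega> - peak n\<bar> ^ p"
        using True by (intro power_mono) auto
      then show ?thesis using nn[of \<omega>] unfolding R_def by linarith
    next
      case False
      obtain k where k: "profile (T n \<omega>) k = width (T n \<omega>)" using width_attained by blast
      then have YW: "Y n k \<omega> = W n \<omega>" by simp
      have "k \<le> n" by (rule width_attained_le[OF n \<omega> k])
      then consider "k \<in> A1" | "k \<in> A2" | "k \<in> A3"
        unfolding A1_def A2_def A3_def by fastforce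
      then show ?thesis
      proof cases
        case 1
        have "\<bar>W n \<omega> - peak n\<bar> ^ p \<le> (\<Sum>k\<in>A1. \<bar>Y n k \<omega> - peak n\<bar> ^ p)"
          using member_le_sum[OF 1, of "\<lambda>k. \<bar>Y n k \<omega> - peak n\<bar> ^ p"] fin YW by simp
        then show ?thesis using nn[of \<omega>] unfolding R_def by linarith
      next
        case 2
        let ?X = "\<bar>Y n k \<omega> - mu n k\<bar>"
        have "\<bar>W n \<omega> - peak n\<bar> \<le> ?X" "d k \<le> ?X"
          \<comment> \<open>The mean at \<open>k\<close> lies below the peak and the profile there
            equals the width, which exceeds the peak; the deviation therefore dominates both the
            excess of the width and the gap.\<close>
          using False YW dpos[OF 2] unfolding d_def by linarith+
        then have "\<bar>W n \<omega> - peak n\<bar> ^ p * d k ^ (2 * p + 4) \<le> ?X ^ p * ?X ^ (2 * p + 4)"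
          using dpos[OF 2] by (intro mult_mono power_mono) auto
        also have "\<dots> = ?X ^ (3 * p + 4)" unfolding power_add[symmetric] by (simp add: algebra_simps)
        finally have "\<bar>W n \<omega> - peak n\<bar> ^ p \<le> ?X ^ (3 * p + 4) / d k ^ (2 * p + 4)"
          using dpos[OF 2] by (simp add: pos_le_divide_eq)
        also have "\<dots> \<le> (\<Sum>k\<in>A2. \<bar>Y n k \<omega> - mu n k\<bar> ^ (3 * p + 4) / d k ^ (2 * p + 4))"
          by (rule member_le_sum[OF 2])
             (use fin less_imp_le[OF dpos] in \<open>auto intro!: divide_nonneg_nonneg zero_le_power\<close>)
        finally show ?thesis using nn[of \<omega>] unfolding R_def by linarith
      next
        case 3
        \<comment> \<open>On far levels only the first moment is small: all powers but one are
          bounded by the number of nodes.\<close>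
        have "\<bar>W n \<omega> - peak n\<bar> ^ p \<le> W n \<omega> ^ p"
          using False peak_pos[OF n] by (intro power_mono) auto
        also have "\<dots> = W n \<omega> ^ (p - 1) * W n \<omega>"
          using p(2) by (metis One_nat_def Suc_pred less_le_trans pos2 power_Suc2)
        also have "\<dots> \<le> (K * real n) ^ (p - 1) * Y n k \<omega>"
          using W_le[OF n \<omega>] unfolding YW K_def by (intro mult_right_mono power_mono) auto
        also have "\<dots> \<le> (\<Sum>k\<in>A3. (K * real n) ^ (p - 1) * Y n k \<omega>)"
          by (rule member_le_sum[OF 3]) (use fin K0 in auto)
        finally show ?thesis using nn[of \<omega>] unfolding R_def by linarith
      qed
    qed
    have int: "integrable (M n) (\<lambda>\<omega>. \<bar>Y n k0 \<omega> - peak n\<bar> ^ p)"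
      "integrable (M n) (\<lambda>\<omega>. \<Sum>k\<in>A1. \<bar>Y n k \<omega> - peak n\<bar> ^ p)"
      "integrable (M n) (\<lambda>\<omega>. \<Sum>k\<in>A2. \<bar>Y n k \<omega> - mu n k\<bar> ^ (3 * p + 4) / d k ^ (2 * p + 4))"
      "integrable (M n) (\<lambda>\<omega>. \<Sum>k\<in>A3. (K * real n) ^ (p - 1) * Y n k \<omega>)"
      by (auto intro!: Bochner_Integration.integrable_sum integrable_divide integrable_mult_right
            integrable_Y_power[OF n] integrable_Y[OF n])
    have IR: "integrable (M n) R" unfolding R_def by (intro Bochner_Integration.integrable_add int)
    have R0: "R \<omega> \<ge> 0" for \<omega> using nn[of \<omega>] unfolding R_def by linarith
    have "(\<integral>\<omega>. \<bar>W n \<omega> - peak n\<bar> ^ p \<partial>M n) \<le> (\<integral>\<omega>. R \<omega> \<partial>M n)"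
      by (rule integral_mono'[OF IR ptw R0])
    also have "\<dots> = (\<integral>\<omega>. \<bar>Y n k0 \<omega> - peak n\<bar> ^ p \<partial>M n)
        + (\<integral>\<omega>. (\<Sum>k\<in>A1. \<bar>Y n k \<omega> - peak n\<bar> ^ p) \<partial>M n)
        + (\<integral>\<omega>. (\<Sum>k\<in>A2. \<bar>Y n k \<omega> - mu n k\<bar> ^ (3 * p + 4) / d k ^ (2 * p + 4)) \<partial>M n)
        + (\<integral>\<omega>. (\<Sum>k\<in>A3. (K * real n) ^ (p - 1) * Y n k \<omega>) \<partial>M n)"
      unfolding R_def using int by (simp add: Bochner_Integration.integral_add Bochner_Integration.integrable_add)
    also have "\<dots> \<le> C2 * a ^ p + B2 * S * a ^ p + B1 * S * a ^ p + K ^ (p - 1) * C3 * a ^ p"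
    proof (intro add_mono)
      show "(\<integral>\<omega>. \<bar>Y n k0 \<omega> - peak n\<bar> ^ p \<partial>M n) \<le> C2 * a ^ p"
        using elim(3) k0 by (simp add: a_def)
      have "(\<integral>\<omega>. (\<Sum>k\<in>A1. \<bar>Y n k \<omega> - peak n\<bar> ^ p) \<partial>M n) = (\<Sum>k\<in>A1. (\<integral>\<omega>. \<bar>Y n k \<omega> - peak n\<bar> ^ p \<partial>M n))"
        by (intro Bochner_Integration.integral_sum integrable_Y_power[OF n])
      \<comment> \<open>Boundedly many levels lie in \<open>A1\<close>; the summable weights count
        them at the price \<open>1 + D0^2\<close>.\<close>
      also have "\<dots> \<le> (\<Sum>k\<in>A1. B2 * a ^ p * (1 / (1 + (real k - x)\<^sup>2)))"
      proof (rule sum_mono)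
        fix k assume "k \<in> A1"
        then have k: "\<bar>D n k\<bar> \<le> D0" by (simp add: A1_def)
        have "(real k - x)\<^sup>2 \<le> D0\<^sup>2" using k gap(2) unfolding Dx by (simp add: abs_le_square_iff[symmetric])
        then have "1 \<le> (1 + D0\<^sup>2) * (1 / (1 + (real k - x)\<^sup>2))" by (simp add: le_divide_eq add_pos_nonneg)
        then have "C2 * a ^ p * 1 \<le> C2 * a ^ p * ((1 + D0\<^sup>2) * (1 / (1 + (real k - x)\<^sup>2)))"
          using C2(1) a by (intro mult_left_mono) auto
        moreover have "(\<integral>\<omega>. \<bar>Y n k \<omega> - peak n\<bar> ^ p \<partial>M n) \<le> C2 * a ^ p" using elim(3) k by (simp add: a_def)
        ultimately show "(\<integral>\<omega>. \<bar>Y n k \<omega> - peak n\<bar> ^ p \<partial>M n) \<le> B2 * a ^ p * (1 / (1 + (real k - x)\<^sup>2))"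
          by (simp add: B2_def mult_ac)
      qed
      also have "\<dots> = B2 * a ^ p * (\<Sum>k\<in>A1. 1 / (1 + (real k - x)\<^sup>2))" by (simp only: sum_distrib_left)
      also have "\<dots> \<le> B2 * a ^ p * S" using B a fin S(2) by (intro mult_left_mono) auto
      finally show "(\<integral>\<omega>. (\<Sum>k\<in>A1. \<bar>Y n k \<omega> - peak n\<bar> ^ p) \<partial>M n) \<le> B2 * S * a ^ p" by (simp add: mult_ac)
      have "(\<integral>\<omega>. (\<Sum>k\<in>A2. \<bar>Y n k \<omega> - mu n k\<bar> ^ (3 * p + 4) / d k ^ (2 * p + 4)) \<partial>M n)
         = (\<Sum>k\<in>A2. (\<integral>\<omega>. \<bar>Y n k \<omega> - mu n k\<bar> ^ (3 * p + 4) \<partial>M n) / d k ^ (2 * p + 4))"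
        by (subst Bochner_Integration.integral_sum) (auto intro!: integrable_divide integrable_Y_power[OF n])
      also have "\<dots> \<le> (\<Sum>k\<in>A2. B1 * a ^ p * (1 / (1 + (real k - x)\<^sup>2)))"
      proof (rule sum_mono)
        fix k assume k: "k \<in> A2"
        define z where "z = \<bar>D n k\<bar>"
        have z: "z \<ge> 1" using D1[OF k] by (simp add: z_def)
        have "(\<integral>\<omega>. \<bar>Y n k \<omega> - mu n k\<bar> ^ (3 * p + 4) \<partial>M n) / d k ^ (2 * p + 4)
           \<le> C1 * (z * a) ^ (3 * p + 4) / (c * (z * sqrt z) * a) ^ (2 * p + 4)"
        proof (rule frac_le)
          show "(\<integral>\<omega>. \<bar>Y n k \<omega> - mu n k\<bar> ^ (3 * p + 4) \<partial>M n) \<le> C1 * (z * a) ^ (3 * p + 4)"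
            using elim(2) k by (simp add: A2_def l_def z_def a_def)
          show "0 \<le> C1 * (z * a) ^ (3 * p + 4)" using C1 z a by auto
          show "0 < (c * (z * sqrt z) * a) ^ (2 * p + 4)" using gap(1) z a by (intro zero_less_power mult_pos_pos) auto
          show "(c * (z * sqrt z) * a) ^ (2 * p + 4) \<le> d k ^ (2 * p + 4)"
            using dge[OF k] gap(1) z a by (intro power_mono) (auto simp: z_def)
        qed
        also have "\<dots> = C1 / c ^ (2 * p + 4) * a ^ p * (1 / z\<^sup>2)"
        proof -
          have ex: "2 * p + 4 = 2 * (p + 2)" "3 * p + 4 + 2 = 3 * (p + 2)" by simp_all
          have "(z * sqrt z) ^ (2 * p + 4) = ((z * sqrt z) ^ 2) ^ (p + 2)"
            unfolding ex(1) by (rule power_mult)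
          also have "(z * sqrt z) ^ 2 = z ^ 3" using z by (simp add: power_mult_distrib power3_eq_cube power2_eq_square)
          also have "(z ^ 3) ^ (p + 2) = z ^ (3 * p + 4) * z ^ 2"
            unfolding power_mult[symmetric] power_add[symmetric] ex(2) ..
          finally have e1: "(z * sqrt z) ^ (2 * p + 4) = z ^ (3 * p + 4) * z ^ 2" .
          have e2: "a ^ (3 * p + 4) = a ^ p * a ^ (2 * p + 4)"
            unfolding power_add[symmetric] by (simp add: algebra_simps)
          have "C1 * (z * a) ^ (3 * p + 4) / (c * (z * sqrt z) * a) ^ (2 * p + 4)
             = C1 * (z ^ (3 * p + 4) * a ^ (3 * p + 4)) / (c ^ (2 * p + 4) * (z * sqrt z) ^ (2 * p + 4) * a ^ (2 * p + 4))"
            by (simp only: power_mult_distrib)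
          also have "\<dots> = C1 / c ^ (2 * p + 4) * a ^ p * (1 / z\<^sup>2)"
            unfolding e1 e2 using z a by simp
          finally show ?thesis .
        qed
        also have "\<dots> \<le> C1 / c ^ (2 * p + 4) * a ^ p * (2 * (1 / (1 + (real k - x)\<^sup>2)))"
        proof (rule mult_left_mono)
          have "z\<^sup>2 = (real k - x)\<^sup>2" by (simp add: z_def Dx)
          moreover have "1 \<le> z\<^sup>2" using z by (simp add: one_le_power)
          ultimately show "1 / z\<^sup>2 \<le> 2 * (1 / (1 + (real k - x)\<^sup>2))" by (simp add: divide_simps add_pos_nonneg)
        qed (use C1 gap(1) a in auto)
        finally show "(\<integral>\<omega>. \<bar>Y n k \<omega> - mu n k\<bar> ^ (3 * p + 4) \<partial>M n) / d k ^ (2 * p + 4) \<le> B1 * a ^ p * (1 / (1 + (real k - x)\<^sup>2))"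
          by (simp add: B1_def mult_ac)
      qed
      also have "\<dots> = B1 * a ^ p * (\<Sum>k\<in>A2. 1 / (1 + (real k - x)\<^sup>2))" by (simp only: sum_distrib_left)
      also have "\<dots> \<le> B1 * a ^ p * S" using B a fin S(2) by (intro mult_left_mono) auto
      finally show "(\<integral>\<omega>. (\<Sum>k\<in>A2. \<bar>Y n k \<omega> - mu n k\<bar> ^ (3 * p + 4) / d k ^ (2 * p + 4)) \<partial>M n) \<le> B1 * S * a ^ p"
        by (simp add: mult_ac)
      have "(\<integral>\<omega>. (\<Sum>k\<in>A3. (K * real n) ^ (p - 1) * Y n k \<omega>) \<partial>M n) = (K * real n) ^ (p - 1) * (\<Sum>k\<in>A3. mu n k)"
        unfolding mean_profile_def sum_distrib_left
        by (subst Bochner_Integration.integral_sum) (auto intro!: integrable_mult_right integrable_Y[OF n])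
      also have "\<dots> \<le> (K * real n) ^ (p - 1) * (C3 * real n * exp (- c3 * sqrt l))"
        using elim(4) K0 by (intro mult_left_mono) (auto simp: A3_def l_def)
      also have "\<dots> \<le> (K * real n) ^ (p - 1) * (C3 * real n * Lg n powr (- (3 / 2 * real p)))"
        using elim(5) K0 C3(1) by (intro mult_left_mono) (auto simp: l_def)
      also have "\<dots> = K ^ (p - 1) * C3 * (real n ^ (p - 1) * real n) * Lg n powr (- (3 / 2 * real p))"
        by (simp add: power_mult_distrib mult_ac)
      also have "real n ^ (p - 1) * real n = real n ^ p"
        using p(2) by (metis One_nat_def Suc_pred less_le_trans pos2 power_Suc2)
      also have "K ^ (p - 1) * C3 * real n ^ p * Lg n powr (- (3 / 2 * real p)) = K ^ (p - 1) * C3 * a ^ p"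
        by (simp add: a_def scale_def power_mult_distrib powr_power mult_ac)
      finally show "(\<integral>\<omega>. (\<Sum>k\<in>A3. (K * real n) ^ (p - 1) * Y n k \<omega>) \<partial>M n) \<le> K ^ (p - 1) * C3 * a ^ p" .
    qed
    also have "\<dots> = C * scale n ^ p" by (simp add: C_def a_def algebra_simps)
    finally show ?case .
  qed
  moreover have "C \<ge> 0"
    unfolding C_def using C2(1) C3(1) S(1) B node_bound_nonneg by (simp add: K_def)
  ultimately show ?thesis using that by blast
qed

text \<open>The second moment suffices, through \<open>x <= a + x^2 / a\<close> with
  \<open>a = scale n\<close>.\<close>

lemma mean_width_peak:
  obtains C where "C \<ge> 0" "\<forall>\<^sub>F n in sequentially. \<bar>mean_width M T n - peak n\<bar> \<le> C * scale n"
proof -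
  have two: "even (2::nat)" "(2::nat) \<le> 2" by simp_all
  obtain C where C: "C \<ge> 0"
    "\<forall>\<^sub>F n in sequentially. (\<integral>\<omega>. \<bar>W n \<omega> - peak n\<bar> ^ 2 \<partial>M n) \<le> C * scale n ^ 2"
    by (rule width_moment_peak[OF two])
  have "\<forall>\<^sub>F n in sequentially. \<bar>mean_width M T n - peak n\<bar> \<le> (1 + C) * scale n"
    using C(2) eventually_ge_at_top[of 1]
  proof eventually_elim
    case (elim n)
    interpret prob_space "M n" by (rule prob_space_M[OF elim(2)])
    define a where "a = scale n"
    have a: "a > 0" using scale_pos[OF elim(2)] by (simp add: a_def)
    have "\<bar>mean_width M T n - peak n\<bar> = \<bar>\<integral>\<omega>. W n \<omega> - peak n \<partial>M n\<bar>"
      unfolding mean_width_def using integrable_W[OF elim(2)] by (simp add: prob_space)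
    also have "\<dots> \<le> (\<integral>\<omega>. a + \<bar>W n \<omega> - peak n\<bar> ^ 2 / a \<partial>M n)"
    proof (rule order.trans[OF integral_abs_bound integral_mono'])
      show "integrable (M n) (\<lambda>\<omega>. a + \<bar>W n \<omega> - peak n\<bar>\<^sup>2 / a)"
        using integrable_W_power[OF elim(2), of "peak n" 2] by simp
      fix \<omega>
      let ?x = "\<bar>W n \<omega> - peak n\<bar>"
      show "0 \<le> a + ?x\<^sup>2 / a" using a by simp
      show "?x \<le> a + ?x\<^sup>2 / a"
      proof (cases "?x \<le> a")
        case False
        then have "?x * a \<le> ?x * ?x" by (intro mult_left_mono) auto
        then have "?x \<le> ?x\<^sup>2 / a" using a by (simp add: pos_le_divide_eq power2_eq_square)
        then show ?thesis using a by linarith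
      qed (use a in \<open>auto intro: add_increasing2\<close>)
    qed
    also have "\<dots> = a + (\<integral>\<omega>. \<bar>W n \<omega> - peak n\<bar> ^ 2 \<partial>M n) / a"
      using integrable_W_power[OF elim(2), of "peak n" 2] by (simp add: prob_space)
    also have "\<dots> \<le> a + C * a\<^sup>2 / a"
      using elim(1) a by (intro add_left_mono divide_right_mono) (auto simp: a_def)
    also have "\<dots> = (1 + C) * scale n" using a by (simp add: a_def power2_eq_square algebra_simps)
    finally show ?case .
  qed
  then show ?thesis using that[of "1 + C"] C by simp
qed

lemma width_central_moment:
  assumes p: "even p" "p \<ge> 2"
  obtains C where "C \<ge> 0"
    "\<forall>\<^sub>F n in sequentially. (\<integral>\<omega>. \<bar>W n \<omega> - mean_width M T n\<bar> ^ p \<partial>M n) \<le> C * scale n ^ p"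
proof -
  obtain C1 where C1: "C1 \<ge> 0"
    "\<forall>\<^sub>F n in sequentially. (\<integral>\<omega>. \<bar>W n \<omega> - peak n\<bar> ^ p \<partial>M n) \<le> C1 * scale n ^ p"
    by (rule width_moment_peak[OF p])
  obtain C2 where C2: "C2 \<ge> 0" "\<forall>\<^sub>F n in sequentially. \<bar>mean_width M T n - peak n\<bar> \<le> C2 * scale n"
    by (rule mean_width_peak)
  have "\<forall>\<^sub>F n in sequentially. (\<integral>\<omega>. \<bar>W n \<omega> - mean_width M T n\<bar> ^ p \<partial>M n) \<le> 2 ^ p * (C1 + C2 ^ p) * scale n ^ p"
    using C1(2) C2(2) eventually_ge_at_top[of 1]
  proof eventually_elim
    case (elim n)
    interpret prob_space "M n" by (rule prob_space_M[OF elim(3)])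
    have C2n: "C2 * scale n \<ge> 0" using C2 scale_nonneg by simp
    have "(\<integral>\<omega>. \<bar>W n \<omega> - mean_width M T n\<bar> ^ p \<partial>M n) \<le>
        (\<integral>\<omega>. 2 ^ p * (\<bar>W n \<omega> - peak n\<bar> ^ p + (C2 * scale n) ^ p) \<partial>M n)"
    proof (rule integral_mono')
      show "integrable (M n) (\<lambda>\<omega>. 2 ^ p * (\<bar>W n \<omega> - peak n\<bar> ^ p + (C2 * scale n) ^ p))"
        using integrable_W_power[OF elim(3), of "peak n" p] by simp
      fix \<omega>
      have "\<bar>W n \<omega> - mean_width M T n\<bar> ^ p \<le> (\<bar>W n \<omega> - peak n\<bar> + C2 * scale n) ^ p"
        using elim(2) by (intro power_mono) auto
      also have "\<dots> \<le> 2 ^ p * (\<bar>W n \<omega> - peak n\<bar> ^ p + (C2 * scale n) ^ p)"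
        using C2n by (intro power_add_le) auto
      finally show "\<bar>W n \<omega> - mean_width M T n\<bar> ^ p \<le> 2 ^ p * (\<bar>W n \<omega> - peak n\<bar> ^ p + (C2 * scale n) ^ p)" .
      show "0 \<le> 2 ^ p * (\<bar>W n \<omega> - peak n\<bar> ^ p + (C2 * scale n) ^ p)"
        using zero_le_power[OF C2n, of p] by simp
    qed
    also have "\<dots> = 2 ^ p * ((\<integral>\<omega>. \<bar>W n \<omega> - peak n\<bar> ^ p \<partial>M n) + (C2 * scale n) ^ p)"
      using integrable_W_power[OF elim(3), of "peak n" p] by (simp add: prob_space)
    also have "\<dots> \<le> 2 ^ p * (C1 * scale n ^ p + (C2 * scale n) ^ p)"
      using elim(1) by (intro mult_left_mono add_right_mono) auto
    finally show ?case by (simp add: power_mult_distrib algebra_simps)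
  qed
  then show ?thesis using that[of "2 ^ p * (C1 + C2 ^ p)"] C1(1) C2(1) by simp
qed

text \<open>Real exponents are reduced to an even integer \<open>p >= s\<close> by treating
  deviations below and above \<open>scale n\<close> separately.\<close>

lemma abs_width_powr_moment:
  assumes "s \<ge> 0"
  shows "(\<lambda>n. \<integral>\<omega>. \<bar>W n \<omega> - mean_width M T n\<bar> powr s \<partial>M n) \<in> O(\<lambda>n. real n powr s * Lg n powr (- 3 * s / 2))"
proof -
  \<comment> \<open>Adding 1 ensures \<open>p >= 2\<close> also for \<open>s = 0\<close>.\<close>
  define p where "p = 2 * nat (\<lceil>s\<rceil> + 1)"
  have p: "even p" "p \<ge> 2" "s \<le> real p"
  proof -
    define i where "i = real_of_int \<lceil>s\<rceil>"
    have "\<lceil>s\<rceil> \<ge> 0" using assms by simp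
    then have "real p = 2 * (i + 1)" "0 \<le> i" "s \<le> i" by (simp_all add: p_def i_def)
    then have "s \<le> real p \<and> 2 \<le> real p" by auto
    then show "p \<ge> 2" "s \<le> real p" by simp_all
    show "even p" by (simp add: p_def)
  qed
  obtain C where C: "C \<ge> 0"
    "\<forall>\<^sub>F n in sequentially. (\<integral>\<omega>. \<bar>W n \<omega> - mean_width M T n\<bar> ^ p \<partial>M n) \<le> C * scale n ^ p"
    by (rule width_central_moment[OF p(1,2)])
  have "\<forall>\<^sub>F n in sequentially. norm (\<integral>\<omega>. \<bar>W n \<omega> - mean_width M T n\<bar> powr s \<partial>M n)
      \<le> (1 + C) * norm (real n powr s * Lg n powr (- 3 * s / 2))"
    using C(2) eventually_ge_at_top[of 1]
  proof eventually_elim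
    case (elim n)
    interpret prob_space "M n" by (rule prob_space_M[OF elim(2)])
    define a where "a = scale n"
    have a: "a > 0" using scale_pos[OF elim(2)] by (simp add: a_def)
    have as: "a powr s = real n powr s * Lg n powr (- 3 * s / 2)"
      by (simp add: a_def scale_def powr_mult powr_powr)
    have "(\<integral>\<omega>. \<bar>W n \<omega> - mean_width M T n\<bar> powr s \<partial>M n)
      \<le> (\<integral>\<omega>. a powr s + a powr (s - p) * \<bar>W n \<omega> - mean_width M T n\<bar> ^ p \<partial>M n)"
    proof (rule integral_mono')
      show "integrable (M n) (\<lambda>\<omega>. a powr s + a powr (s - p) * \<bar>W n \<omega> - mean_width M T n\<bar> ^ p)"
        using integrable_W_power[OF elim(2), of "mean_width M T n" p] by simp
      fix \<omega>
      let ?x = "\<bar>W n \<omega> - mean_width M T n\<bar>"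
      show "0 \<le> a powr s + a powr (s - p) * ?x ^ p" by simp
      show "?x powr s \<le> a powr s + a powr (s - p) * ?x ^ p"
      proof (cases "?x \<le> a")
        case True
        then have "?x powr s \<le> a powr s" using assms by (intro powr_mono2) auto
        then show ?thesis by (simp add: add_increasing2)
      next
        case False
        have "?x powr s = ?x powr (s - p) * ?x ^ p"
          using False a by (simp add: powr_realpow[symmetric] powr_add[symmetric])
        also have "?x powr (s - p) \<le> a powr (s - p)"
          using False a p by (intro powr_mono2') auto
        then have "?x powr (s - p) * ?x ^ p \<le> a powr (s - p) * ?x ^ p" by (intro mult_right_mono) auto
        finally show ?thesis by (simp add: add_increasing)
      qed
    qed
    also have "\<dots> = a powr s + a powr (s - p) * (\<integral>\<omega>. \<bar>W n \<omega> - mean_width M T n\<bar> ^ p \<partial>M n)"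
      using integrable_W_power[OF elim(2), of "mean_width M T n" p] by (simp add: prob_space)
    also have "\<dots> \<le> a powr s + a powr (s - p) * (C * a ^ p)"
      using elim(1) by (intro add_left_mono mult_left_mono) (auto simp: a_def)
    also have "a powr (s - p) * (C * a ^ p) = C * a powr s"
      using a by (simp add: powr_realpow[symmetric] powr_add[symmetric])
    finally show ?case unfolding as[symmetric] by (simp add: algebra_simps)
  qed
  then show ?thesis by (rule bigoI)
qed

lemma mean_width_asymptotic:
  "\<exists>r. r \<in> O(\<lambda>n. 1 / Lg n) \<and>
     (\<forall>n\<ge>1. mean_width M T n = real n / sqrt (2 * pi * (sigma_prof f)\<^sup>2 * Lg n) * (1 + r n))"
proof -
  obtain C where C: "C \<ge> 0" "\<forall>\<^sub>F n in sequentially. \<bar>mean_width M T n - peak n\<bar> \<le> C * scale n"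
    by (rule mean_width_peak)
  define r where "r = (\<lambda>n. mean_width M T n / peak n - 1)"
  have "\<forall>\<^sub>F n in sequentially. norm (r n) \<le> C / \<kappa> * norm (1 / Lg n)"
    using C(2) eventually_ge_at_top[of 1]
  proof eventually_elim
    case (elim n)
    have pk: "peak n > 0" using peak_pos[OF elim(2)] .
    have "\<bar>r n\<bar> = \<bar>mean_width M T n - peak n\<bar> / peak n"
    proof -
      have "r n = (mean_width M T n - peak n) / peak n" using pk by (simp add: r_def diff_divide_distrib)
      then show ?thesis using pk by (simp add: abs_divide)
    qed
    also have "\<dots> \<le> C * scale n / peak n" using elim(1) pk by (intro divide_right_mono) auto
    also have "\<dots> = C / \<kappa> * (1 / Lg n)" using scale_pos[OF elim(2)] by (simp add: peak_eq)
    finally show ?case by simp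
  qed
  then have "r \<in> O(\<lambda>n. 1 / Lg n)" by (rule bigoI)
  moreover have "mean_width M T n = real n / sqrt (2 * pi * (sigma_prof f)\<^sup>2 * Lg n) * (1 + r n)" if "n \<ge> 1" for n
  proof -
    have "real n / sqrt (2 * pi * (sigma_prof f)\<^sup>2 * Lg n) = peak n"
      using variance_pos by (simp add: peak_def sigma_prof_def)
    then show ?thesis using peak_pos[OF that] by (simp add: r_def)
  qed
  ultimately show ?thesis by blast
qed

end

section \<open>The level of maximal width\<close>

lemma (in prob_space) power_Markov_inequality:
  fixes X :: "'a \<Rightarrow> real"
  assumes "integrable M (\<lambda>\<omega>. \<bar>X \<omega>\<bar> ^ m)" "\<delta> > 0"
  shows "prob {\<omega> \<in> space M. \<delta> \<le> \<bar>X \<omega>\<bar>} \<le> expectation (\<lambda>\<omega>. \<bar>X \<omega>\<bar> ^ m) / \<delta> ^ m"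
proof -
  have "{\<omega> \<in> space M. \<delta> \<le> \<bar>X \<omega>\<bar>} \<subseteq> {\<omega> \<in> space M. \<delta> ^ m \<le> \<bar>X \<omega>\<bar> ^ m}"
    using assms(2) by (auto intro!: power_mono)
  then have "prob {\<omega> \<in> space M. \<delta> \<le> \<bar>X \<omega>\<bar>} \<le> prob {\<omega> \<in> space M. \<delta> ^ m \<le> \<bar>X \<omega>\<bar> ^ m}"
    using borel_measurable_integrable[OF assms(1)] by (intro finite_measure_mono) auto
  also have "\<dots> \<le> expectation (\<lambda>\<omega>. \<bar>X \<omega>\<bar> ^ m) / \<delta> ^ m"
    using integral_Markov_inequality_measure[OF assms(1), of "{}" "\<delta> ^ m"] assms(2) by simp
  finally show ?thesis .
qed

text \<open>The extra factor \<open>x\<close> leaves room for absorbing quantities such as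
  \<open>sqrt L\<close> that are at most \<open>x\<close> in the tail estimate below.\<close>

lemma exp_neg_sqrt_bound:
  fixes q B :: real
  assumes "q > 0"
  obtains C where "C \<ge> 0" "\<And>x. x \<ge> 1 \<Longrightarrow> x * exp (- q * sqrt x) \<le> C * x powr (- B)"
proof -
  define i where "i = nat \<lceil>B\<rceil> + 1"
  have "real i \<ge> B + 1" using le_of_int_ceiling[of B] unfolding i_def by linarith
  obtain C where C: "C \<ge> 0" "\<And>y. y \<ge> 0 \<Longrightarrow> y ^ (2 * i) \<le> C * exp (q * y)"
    using power_le_exp_mult[OF assms] by blast
  have "x * exp (- q * sqrt x) \<le> C * x powr (- B)" if x: "x \<ge> 1" for x
  proof -
    have "x * x powr B = x powr (B + 1)" using x by (simp add: powr_add)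
    also have "\<dots> \<le> x powr (real i)" using x \<open>real i \<ge> B + 1\<close> by (intro powr_mono) auto
    also have "\<dots> = sqrt x ^ (2 * i)" using x by (simp add: powr_realpow power_mult)
    also have "\<dots> \<le> C * exp (q * sqrt x)" using x by (intro C(2)) auto
    finally have "x * x powr B * (exp (- q * sqrt x) * x powr (- B)) \<le> C * exp (q * sqrt x) * (exp (- q * sqrt x) * x powr (- B))"
      by (rule mult_right_mono) simp
    moreover have "x powr B * x powr (- B) = 1" using x by (simp add: powr_add[symmetric])
    moreover have "exp (q * sqrt x) * exp (- q * sqrt x) = 1" by (simp add: exp_add[symmetric])
    ultimately show ?thesis by (simp add: algebra_simps) (metis mult.assoc mult.left_commute mult.right_neutral)
  qed
  then show ?thesis using that C(1) by blast
qed

context profile_family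
begin

text \<open>If an intermediate level attains the width, then either its profile is half the gap
  above its mean or the width is half the gap below the peak; Markov bounds for both are summed over
  the levels. Far levels are handled together through the number of nodes on them.\<close>

lemma level_of_width_tail:
  fixes kstar :: "nat \<Rightarrow> 'a \<Rightarrow> nat"
  assumes meas: "\<And>n. n \<ge> 1 \<Longrightarrow> kstar n \<in> measurable (M n) (count_space UNIV)"
    and att: "\<And>n \<omega>. n \<ge> 1 \<Longrightarrow> \<omega> \<in> space (M n) \<Longrightarrow> profile (T n \<omega>) (kstar n \<omega>) = width (T n \<omega>)"
    and B: "B > 0"
  shows "\<exists>T0>1. \<exists>C. \<forall>n\<ge>1. \<forall>t>T0.
    measure (M n) {\<omega> \<in> space (M n). \<bar>real (kstar n \<omega>) - fp1 f * Lg n\<bar> \<ge> t} \<le> C * t powr (- B)"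
proof -
  \<comment> \<open>Deviation over gap is of order \<open>z powr (-1/2)\<close>, so moments of order
    \<open>2 j\<close> give \<open>z^-j\<close>. Of this, \<open>z^-2\<close> is spent on the sum
    over levels and the remaining power, at least \<open>B\<close>, gives the decay in
    \<open>t\<close>.\<close>
  define j where "j = nat \<lceil>B\<rceil> + 2"
  define m where "m = 2 * j"
  have jB: "real (j - 2) \<ge> B" using le_of_int_ceiling[of B] unfolding j_def by linarith
  have m: "even m" "m \<ge> 2" "real m \<ge> 2 * B" using jB by (auto simp: m_def j_def)
  obtain c D0 where gap: "c > 0" "D0 \<ge> 1"
    "\<forall>\<^sub>F n in sequentially. \<forall>k. D0 \<le> \<bar>D n k\<bar> \<and> \<bar>D n k\<bar> \<le> Lg n powr (2 / 3) \<longrightarrow>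
       c * (\<bar>D n k\<bar> * sqrt \<bar>D n k\<bar>) * scale n \<le> peak n - mu n k"
    by (rule mean_profile_gap)
  obtain C1 where C1: "C1 \<ge> 0"
    "\<forall>\<^sub>F n in sequentially. \<forall>k. \<bar>D n k\<bar> \<le> Lg n powr (2 / 3) \<longrightarrow>
       (\<integral>\<omega>. \<bar>Y n k \<omega> - mu n k\<bar> ^ m \<partial>M n) \<le> C1 * (\<bar>D n k\<bar> * scale n) ^ m"
    by (rule profile_central_moment[OF m(1)])
  obtain C2 where C2: "C2 \<ge> 0"
    "\<forall>\<^sub>F n in sequentially. (\<integral>\<omega>. \<bar>W n \<omega> - peak n\<bar> ^ m \<partial>M n) \<le> C2 * scale n ^ m"
    by (rule width_moment_peak[OF m(1,2)])
  obtain C3 c3 where C3: "C3 \<ge> 0" "c3 > 0"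
    "\<forall>\<^sub>F n in sequentially. \<forall>t. Lg n powr (2 / 3) \<le> t \<longrightarrow>
       (\<Sum>k | k \<le> n \<and> t \<le> \<bar>D n k\<bar>. mu n k) \<le> C3 * real n * exp (- c3 * sqrt t)"
    by (rule mean_profile_tail)
  obtain S :: real where S: "S \<ge> 0"
    "\<And>(A :: nat set) x. finite A \<Longrightarrow> (\<Sum>k\<in>A. 1 / (1 + (real k - x)\<^sup>2)) \<le> S"
    by (rule sum_inverse_one_plus_square_bounded) blast
  have "c3 / 2 > 0" using C3 by simp
  then obtain C4 where C4: "C4 \<ge> 0" "\<And>x. x \<ge> 1 \<Longrightarrow> x * exp (- (c3 / 2) * sqrt x) \<le> C4 * x powr (- B)"
    by (rule exp_neg_sqrt_bound) blast
  \<comment> \<open>For \<open>t' >= Q * L^2\<close> half of the tail exponent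
    \<open>c3 * sqrt t'\<close> is at least \<open>L\<close>, and so cancels the factor
    \<open>n = exp L\<close>.\<close>
  define Q where "Q = (2 / c3)\<^sup>2"
  have Q: "Q > 0" using C3 by (simp add: Q_def)
  define G where "G = (C1 + C2) * (2 / c) ^ m"
  have G: "G \<ge> 0" using C1 C2 gap by (simp add: G_def)
  define C where "C = 2 * G * S + (C3 * C4 + C2 * (2 / \<kappa>) ^ m * Q powr B + 2 * C3 / \<kappa> * C4)"
  have summ: "0 \<le> 2 * G * S" "0 \<le> C3 * C4" "0 \<le> C2 * (2 / \<kappa>) ^ m * Q powr B" "0 \<le> 2 * C3 / \<kappa> * C4"
    using G S(1) C3(1) C4(1) C2(1) kappa_pos by auto
  have C0: "C \<ge> 0" using summ by (simp add: C_def)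
  have "\<forall>\<^sub>F n in sequentially. \<forall>t>D0.
    measure (M n) {\<omega> \<in> space (M n). t \<le> \<bar>D n (kstar n \<omega>)\<bar>} \<le> C * t powr (- B)"
    using gap(3) C1(2) C2(2) C3(3) eventually_ge_at_top[of 3]
  proof eventually_elim
    case (elim n)
    have n: "n \<ge> 1" using elim(5) by simp
    interpret prob_space "M n" by (rule prob_space_M[OF n])
    have mk [measurable]: "kstar n \<in> measurable (M n) (count_space UNIV)" by (rule meas[OF n])
    have mY [measurable]: "(\<lambda>\<omega>. Y n k \<omega>) \<in> borel_measurable (M n)" for k
      using measurable_of_tree[OF n, of "\<lambda>t. real (profile t k)"] .
    have mW [measurable]: "(\<lambda>\<omega>. W n \<omega>) \<in> borel_measurable (M n)"
      using measurable_of_tree[OF n, of "\<lambda>t. real (width t)"] .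
    have ms: "{\<omega> \<in> space (M n). P (kstar n \<omega>)} \<in> events" for P by measurable
    define L where "L = Lg n"
    have L: "L \<ge> 1" "L > 0" by (simp_all add: L_def)
    define l where "l = L powr (2 / 3)"
    define a where "a = scale n"
    have a: "a > 0" using scale_pos[OF n] by (simp add: a_def)
    have pk: "peak n = \<kappa> * a * L" "peak n > 0" using peak_pos[OF n] by (simp_all add: peak_eq a_def L_def)
    define x where "x = fp1 f * Lg n"
    have Dx: "D n k = real k - x" for k by (simp add: Dlt_def x_def)
    show ?case
    proof (intro allI impI)
      fix t assume tD: "t > D0"
      then have t1: "t \<ge> 1" using gap by simp
      \<comment> \<open>The tail bound is available only from the cutoff on; since
        \<open>t' >= t\<close>, decay in \<open>t'\<close> is at least as good as decay in
        \<open>t\<close>.\<close>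
      define t' where "t' = max t l"
      have t': "t' \<ge> t" "t' \<ge> l" "t' \<ge> 1" using t1 by (auto simp: t'_def)
      define A where "A = {k. k \<le> n \<and> t \<le> \<bar>D n k\<bar> \<and> \<bar>D n k\<bar> \<le> l}"
      have finA: "finite A" by (simp add: A_def)
      define E where "E = (\<lambda>k. {\<omega> \<in> space (M n). kstar n \<omega> = k})"
      define F where "F = {\<omega> \<in> space (M n). t' \<le> \<bar>D n (kstar n \<omega>)\<bar>}"
      have Em: "E k \<in> events" for k unfolding E_def by (rule ms)
      have Fm: "F \<in> events" unfolding F_def by (rule ms)
      have sub: "{\<omega> \<in> space (M n). t \<le> \<bar>D n (kstar n \<omega>)\<bar>} \<subseteq> (\<Union>k\<in>A. E k) \<union> F"
        using width_attained_le[OF n _ att[OF n]] by (auto simp: E_def F_def A_def t'_def)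
      have "prob {\<omega> \<in> space (M n). t \<le> \<bar>D n (kstar n \<omega>)\<bar>} \<le> prob ((\<Union>k\<in>A. E k) \<union> F)"
        by (rule finite_measure_mono[OF sub]) (use Em Fm finA in auto)
      also have "\<dots> \<le> prob (\<Union>k\<in>A. E k) + prob F"
        by (rule measure_Un_le) (use Em Fm finA in auto)
      also have "prob (\<Union>k\<in>A. E k) \<le> (\<Sum>k\<in>A. prob (E k))"
        by (rule finite_measure_subadditive_finite) (use Em finA in auto)
      also have "\<dots> \<le> (\<Sum>k\<in>A. 2 * G * t powr (- B) * (1 / (1 + (real k - x)\<^sup>2)))"
      proof (rule sum_mono)
        fix k assume k: "k \<in> A"
        define z where "z = \<bar>D n k\<bar>"
        have z: "z \<ge> t" "z \<ge> 1" using k t1 by (auto simp: A_def z_def)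
        define \<delta> where "\<delta> = c * (z * sqrt z) * a / 2"
        have \<delta>0: "\<delta> > 0" using gap(1) z a by (auto simp: \<delta>_def intro!: mult_pos_pos)
        have d: "2 * \<delta> \<le> peak n - mu n k"
          using elim(1) k tD by (auto simp: A_def l_def L_def z_def a_def \<delta>_def)
        have "E k \<subseteq> {\<omega> \<in> space (M n). \<delta> \<le> \<bar>Y n k \<omega> - mu n k\<bar>} \<union> {\<omega> \<in> space (M n). \<delta> \<le> \<bar>W n \<omega> - peak n\<bar>}"
        proof
          fix \<omega> assume "\<omega> \<in> E k"
          then have w: "\<omega> \<in> space (M n)" "Y n k \<omega> = W n \<omega>" using att[OF n] by (auto simp: E_def)
          then have "\<delta> \<le> \<bar>Y n k \<omega> - mu n k\<bar> \<or> \<delta> \<le> \<bar>W n \<omega> - peak n\<bar>" using d by linarith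
          then show "\<omega> \<in> {\<omega> \<in> space (M n). \<delta> \<le> \<bar>Y n k \<omega> - mu n k\<bar>} \<union> {\<omega> \<in> space (M n). \<delta> \<le> \<bar>W n \<omega> - peak n\<bar>}"
            using w(1) by simp
        qed
        then have "prob (E k) \<le> prob ({\<omega> \<in> space (M n). \<delta> \<le> \<bar>Y n k \<omega> - mu n k\<bar>} \<union> {\<omega> \<in> space (M n). \<delta> \<le> \<bar>W n \<omega> - peak n\<bar>})"
          by (rule finite_measure_mono) measurable
        also have "\<dots> \<le> prob {\<omega> \<in> space (M n). \<delta> \<le> \<bar>Y n k \<omega> - mu n k\<bar>} + prob {\<omega> \<in> space (M n). \<delta> \<le> \<bar>W n \<omega> - peak n\<bar>}"
          by (rule measure_Un_le) measurable
        also have "\<dots> \<le> C1 * (z * a) ^ m / \<delta> ^ m + C2 * a ^ m / \<delta> ^ m"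
        proof (rule add_mono)
          have "prob {\<omega> \<in> space (M n). \<delta> \<le> \<bar>Y n k \<omega> - mu n k\<bar>} \<le> expectation (\<lambda>\<omega>. \<bar>Y n k \<omega> - mu n k\<bar> ^ m) / \<delta> ^ m"
            by (rule power_Markov_inequality[OF integrable_Y_power[OF n] \<delta>0])
          also have "\<dots> \<le> C1 * (z * a) ^ m / \<delta> ^ m"
            using elim(2) k \<delta>0 by (intro divide_right_mono) (auto simp: A_def l_def L_def z_def a_def)
          finally show "prob {\<omega> \<in> space (M n). \<delta> \<le> \<bar>Y n k \<omega> - mu n k\<bar>} \<le> C1 * (z * a) ^ m / \<delta> ^ m" .
          have "prob {\<omega> \<in> space (M n). \<delta> \<le> \<bar>W n \<omega> - peak n\<bar>} \<le> expectation (\<lambda>\<omega>. \<bar>W n \<omega> - peak n\<bar> ^ m) / \<delta> ^ m"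
            by (rule power_Markov_inequality[OF integrable_W_power[OF n] \<delta>0])
          also have "\<dots> \<le> C2 * a ^ m / \<delta> ^ m"
            using elim(3) \<delta>0 by (intro divide_right_mono) (auto simp: a_def)
          finally show "prob {\<omega> \<in> space (M n). \<delta> \<le> \<bar>W n \<omega> - peak n\<bar>} \<le> C2 * a ^ m / \<delta> ^ m" .
        qed
        also have "C2 * a ^ m / \<delta> ^ m \<le> C2 * (z * a) ^ m / \<delta> ^ m"
          using C2(1) a z \<delta>0 by (intro divide_right_mono mult_left_mono power_mono) auto
        also have "C1 * (z * a) ^ m / \<delta> ^ m + C2 * (z * a) ^ m / \<delta> ^ m = (C1 + C2) * ((z * a) / \<delta>) ^ m"
          by (simp add: power_divide algebra_simps add_divide_distrib)
        also have "(z * a) / \<delta> = (2 / c) * (1 / sqrt z)"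
          using z a by (simp add: \<delta>_def)
        also have "(C1 + C2) * ((2 / c) * (1 / sqrt z)) ^ m = G * (1 / z ^ j)"
        proof -
          have "sqrt z ^ m = z ^ j" using z by (simp add: m_def power_mult)
          then have "(1 / sqrt z) ^ m = 1 / z ^ j" by (simp add: power_one_over)
          then show ?thesis by (simp only: G_def power_mult_distrib mult.assoc)
        qed
        also have "\<dots> \<le> G * (t powr (- B) * (2 * (1 / (1 + (real k - x)\<^sup>2))))"
        proof (rule mult_left_mono[OF _ G])
          have "t powr B \<le> t powr real (j - 2)" using t1 jB by (intro powr_mono) auto
          also have "\<dots> = t ^ (j - 2)" using t1 by (simp add: powr_realpow)
          also have "\<dots> \<le> z ^ (j - 2)" using z t1 by (intro power_mono) auto
          finally have zB: "t powr B \<le> z ^ (j - 2)" .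
          have zj: "z ^ j = z ^ (j - 2) * z\<^sup>2" unfolding power_add[symmetric] by (simp add: j_def)
          have z2: "z\<^sup>2 = (real k - x)\<^sup>2" by (simp add: z_def Dx)
          have "1 \<le> z\<^sup>2" using z by (simp add: one_le_power)
          have "1 / z ^ j = 1 / z ^ (j - 2) * (1 / z\<^sup>2)" unfolding zj by simp
          also have "\<dots> \<le> 1 / t powr B * (2 * (1 / (1 + (real k - x)\<^sup>2)))"
          proof (rule mult_mono)
            show "1 / z ^ (j - 2) \<le> 1 / t powr B" using zB t1 z by (intro divide_left_mono) auto
            show "1 / z\<^sup>2 \<le> 2 * (1 / (1 + (real k - x)\<^sup>2))"
              using \<open>1 \<le> z\<^sup>2\<close> unfolding z2[symmetric] by (simp add: divide_simps add_pos_nonneg)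
          qed (use t1 in auto)
          finally show "1 / z ^ j \<le> t powr (- B) * (2 * (1 / (1 + (real k - x)\<^sup>2)))"
            by (simp add: powr_minus_divide)
        qed
        finally show "prob (E k) \<le> 2 * G * t powr (- B) * (1 / (1 + (real k - x)\<^sup>2))" by (simp add: mult_ac)
      qed
      also have "\<dots> = 2 * G * t powr (- B) * (\<Sum>k\<in>A. 1 / (1 + (real k - x)\<^sup>2))" by (simp only: sum_distrib_left)
      also have "\<dots> \<le> 2 * G * t powr (- B) * S" using G finA S(2) by (intro mult_left_mono) auto
      also have "prob F \<le> (C3 * C4 + C2 * (2 / \<kappa>) ^ m * Q powr B + 2 * C3 / \<kappa> * C4) * t' powr (- B)"
      proof -
        define A' where "A' = {k. k \<le> n \<and> t' \<le> \<bar>D n k\<bar>}"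
        have finA': "finite A'" by (simp add: A'_def)
        \<comment> \<open>\<open>V\<close> counts the nodes on the far levels. On \<open>F\<close>
          it dominates the width, and its mean is a tail of the mean profile.\<close>
        define V where "V = (\<lambda>\<omega>. \<Sum>k\<in>A'. Y n k \<omega>)"
        have Vint: "integrable (M n) V" unfolding V_def by (intro Bochner_Integration.integrable_sum integrable_Y n)
        have V0: "V \<omega> \<ge> 0" for \<omega> unfolding V_def by (intro sum_nonneg) auto
        have VW: "W n \<omega> \<le> V \<omega>" if "\<omega> \<in> F" for \<omega>
        proof -
          have w: "\<omega> \<in> space (M n)" "t' \<le> \<bar>D n (kstar n \<omega>)\<bar>" using that by (auto simp: F_def)
          have "kstar n \<omega> \<in> A'" using w width_attained_le[OF n w(1) att[OF n w(1)]] by (simp add: A'_def)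
          then have "Y n (kstar n \<omega>) \<omega> \<le> V \<omega>" unfolding V_def using finA' by (intro member_le_sum) auto
          then show ?thesis using att[OF n w(1)] by simp
        qed
        have EV: "expectation V \<le> C3 * real n * exp (- c3 * sqrt t')"
        proof -
          have "expectation V = (\<Sum>k\<in>A'. mu n k)"
            unfolding V_def mean_profile_def by (intro Bochner_Integration.integral_sum integrable_Y n)
          also have "\<dots> \<le> C3 * real n * exp (- c3 * sqrt t')"
            using elim(4) t'(2) by (simp add: A'_def l_def L_def)
          finally show ?thesis .
        qed
        have PV: "prob {\<omega> \<in> space (M n). v \<le> V \<omega>} \<le> C3 * real n * exp (- c3 * sqrt t') / v" if "v > 0" for v
        proof -
          have "prob {\<omega> \<in> space (M n). v \<le> V \<omega>} \<le> expectation V / v"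
            using integral_Markov_inequality_measure[OF Vint, of "{}" v] that V0 by simp
          also have "\<dots> \<le> C3 * real n * exp (- c3 * sqrt t') / v" using EV that by (intro divide_right_mono) auto
          finally show ?thesis .
        qed
        have mV [measurable]: "V \<in> borel_measurable (M n)" using Vint by (rule borel_measurable_integrable)
        have split: "exp (- c3 * sqrt t') = exp (- (c3 / 2) * sqrt t') * exp (- (c3 / 2) * sqrt t')"
          unfolding exp_add[symmetric] by (simp add: field_simps)
        show ?thesis
        proof (cases "Q * L\<^sup>2 \<le> t'")
          \<comment> \<open>So far out that the expected number of nodes itself is tiny: a nonempty
            level forces \<open>V >= 1\<close>, and the first moment of \<open>V\<close>
            decides.\<close>
          case True
          have "F \<subseteq> {\<omega> \<in> space (M n). 1 \<le> V \<omega>}"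
          proof
            fix \<omega> assume w: "\<omega> \<in> F"
            have "1 \<le> V \<omega>" using VW[OF w] width_ge_1[of "T n \<omega>"] by linarith
            then show "\<omega> \<in> {\<omega> \<in> space (M n). 1 \<le> V \<omega>}" using w by (simp add: F_def)
          qed
          then have "prob F \<le> prob {\<omega> \<in> space (M n). 1 \<le> V \<omega>}" by (rule finite_measure_mono) measurable
          also have "\<dots> \<le> C3 * real n * exp (- c3 * sqrt t')" using PV[of 1] by simp
          also have "\<dots> = C3 * (real n * exp (- (c3 / 2) * sqrt t')) * exp (- (c3 / 2) * sqrt t')"
            unfolding split by simp
          also have "real n * exp (- (c3 / 2) * sqrt t') \<le> t'"
          proof -
            have "(2 / c3 * L)\<^sup>2 \<le> t'" using True by (simp only: Q_def power_mult_distrib)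
            then have "2 / c3 * L \<le> sqrt t'" by (rule real_le_rsqrt)
            then have "L \<le> c3 / 2 * sqrt t'" using C3(2) by (simp add: field_simps)
            then have "exp L * exp (- (c3 / 2) * sqrt t') \<le> exp 0" unfolding exp_add[symmetric] by simp
            moreover have "real n = exp L" using exp_Lg[OF elim(5)] by (simp add: L_def)
            ultimately show ?thesis using t'(3) by simp
          qed
          then have "C3 * (real n * exp (- (c3 / 2) * sqrt t')) * exp (- (c3 / 2) * sqrt t') \<le> C3 * t' * exp (- (c3 / 2) * sqrt t')"
            using C3(1) by (intro mult_right_mono mult_left_mono) auto
          also have "C3 * t' * exp (- (c3 / 2) * sqrt t') \<le> C3 * (C4 * t' powr (- B))"
            using C4(2)[OF t'(3)] C3(1) by (simp add: mult.assoc mult_left_mono)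
          also have "\<dots> \<le> (C3 * C4 + C2 * (2 / \<kappa>) ^ m * Q powr B + 2 * C3 / \<kappa> * C4) * t' powr (- B)"
            unfolding mult.assoc[symmetric] using summ by (intro mult_right_mono) auto
          finally show ?thesis .
        next
          \<comment> \<open>Now \<open>t' < Q * L^2\<close>, so \<open>L^-m\<close> with
            \<open>m >= 2 * B\<close> counts as \<open>t' powr (- B)\<close>. Either the width
            misses the peak by half, which has such a probability by its moment of order
            \<open>m\<close>, or \<open>V\<close> is at least half the peak; there the ratio of
            \<open>n\<close> to the peak is only of order \<open>sqrt L\<close>, hence at most a
            constant times \<open>t'\<close>.\<close>
          case False
          have p2: "peak n / 2 > 0" using pk by simp
          have "F \<subseteq> {\<omega> \<in> space (M n). peak n / 2 \<le> \<bar>W n \<omega> - peak n\<bar>} \<union> {\<omega> \<in> space (M n). peak n / 2 \<le> V \<omega>}"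
          proof
            fix \<omega> assume w: "\<omega> \<in> F"
            have "peak n / 2 \<le> \<bar>W n \<omega> - peak n\<bar> \<or> peak n / 2 \<le> V \<omega>" using VW[OF w] by linarith
            then show "\<omega> \<in> {\<omega> \<in> space (M n). peak n / 2 \<le> \<bar>W n \<omega> - peak n\<bar>} \<union> {\<omega> \<in> space (M n). peak n / 2 \<le> V \<omega>}"
              using w by (simp add: F_def)
          qed
          then have "prob F \<le> prob ({\<omega> \<in> space (M n). peak n / 2 \<le> \<bar>W n \<omega> - peak n\<bar>} \<union> {\<omega> \<in> space (M n). peak n / 2 \<le> V \<omega>})"
            by (rule finite_measure_mono) measurable
          also have "\<dots> \<le> prob {\<omega> \<in> space (M n). peak n / 2 \<le> \<bar>W n \<omega> - peak n\<bar>} + prob {\<omega> \<in> space (M n). peak n / 2 \<le> V \<omega>}"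
            by (rule measure_Un_le) measurable
          also have "prob {\<omega> \<in> space (M n). peak n / 2 \<le> \<bar>W n \<omega> - peak n\<bar>} \<le> C2 * (2 / \<kappa>) ^ m * Q powr B * t' powr (- B)"
          proof -
            have "prob {\<omega> \<in> space (M n). peak n / 2 \<le> \<bar>W n \<omega> - peak n\<bar>} \<le> expectation (\<lambda>\<omega>. \<bar>W n \<omega> - peak n\<bar> ^ m) / (peak n / 2) ^ m"
              by (rule power_Markov_inequality[OF integrable_W_power[OF n] p2])
            also have "\<dots> \<le> C2 * a ^ m / (peak n / 2) ^ m"
              using elim(3) p2 by (intro divide_right_mono) (auto simp: a_def)
            also have "\<dots> = C2 * (a / (peak n / 2)) ^ m" by (simp add: power_divide)
            also have "a / (peak n / 2) = 2 / \<kappa> * (1 / L)" using a by (simp add: pk(1))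
            also have "C2 * (2 / \<kappa> * (1 / L)) ^ m = C2 * (2 / \<kappa>) ^ m * (1 / L ^ m)"
              by (simp only: power_mult_distrib power_one_over mult.assoc)
            also have "\<dots> \<le> C2 * (2 / \<kappa>) ^ m * (Q powr B * t' powr (- B))"
            proof (rule mult_left_mono)
              have "t' powr B \<le> (Q * L\<^sup>2) powr B" using False t' B by (intro powr_mono2) auto
              also have "\<dots> = Q powr B * L powr (2 * B)" using Q L by (simp add: powr_mult powr_powr flip: powr_numeral)
              also have "\<dots> \<le> Q powr B * L powr (real m)" using m(3) L by (intro mult_left_mono powr_mono) auto
              also have "\<dots> = Q powr B * L ^ m" using L by (simp add: powr_realpow)
              finally have *: "t' powr B \<le> Q powr B * L ^ m" .
              have "t' powr B > 0" using t' by simp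
              then show "1 / L ^ m \<le> Q powr B * t' powr (- B)"
                using * L by (simp add: powr_minus_divide divide_simps)
            qed (use C2(1) kappa_pos in simp)
            finally show ?thesis by (simp add: mult.assoc)
          qed
          also have "prob {\<omega> \<in> space (M n). peak n / 2 \<le> V \<omega>} \<le> 2 * C3 / \<kappa> * C4 * t' powr (- B)"
          proof -
            have "prob {\<omega> \<in> space (M n). peak n / 2 \<le> V \<omega>} \<le> C3 * real n * exp (- c3 * sqrt t') / (peak n / 2)"
              by (rule PV[OF p2])
            also have "\<dots> = 2 * C3 / \<kappa> * (real n / (a * L)) * exp (- c3 * sqrt t')" by (simp add: pk(1) mult_ac)
            also have "\<dots> \<le> 2 * C3 / \<kappa> * t' * exp (- (c3 / 2) * sqrt t')"
            proof (rule mult_mono)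
              have "real n / (a * L) = sqrt L"
                using n L unfolding a_def scale_def L_def[symmetric] powr_minus_3_2[OF L(2)] by simp
              also have "\<dots> = L powr (1 / 2)" using L by (simp add: powr_half_sqrt)
              also have "\<dots> \<le> l" unfolding l_def using L by (intro powr_mono) auto
              also have "\<dots> \<le> t'" by (rule t')
              finally show "2 * C3 / \<kappa> * (real n / (a * L)) \<le> 2 * C3 / \<kappa> * t'"
                using C3(1) kappa_pos by (intro mult_left_mono) auto
              show "exp (- c3 * sqrt t') \<le> exp (- (c3 / 2) * sqrt t')" using C3(2) t' by simp
            qed (use C3(1) kappa_pos t' in auto)
            also have "\<dots> \<le> 2 * C3 / \<kappa> * (C4 * t' powr (- B))"
              using C4(2)[OF t'(3)] C3(1) kappa_pos unfolding mult.assoc[of "2 * C3 / \<kappa>"]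
              by (intro mult_left_mono) auto
            finally show ?thesis by (simp add: mult.assoc)
          qed
          also have "C2 * (2 / \<kappa>) ^ m * Q powr B * t' powr (- B) + 2 * C3 / \<kappa> * C4 * t' powr (- B)
             \<le> (C3 * C4 + C2 * (2 / \<kappa>) ^ m * Q powr B + 2 * C3 / \<kappa> * C4) * t' powr (- B)"
            unfolding distrib_right[symmetric] using summ by (intro mult_right_mono) auto
          finally show ?thesis by simp
        qed
      qed
      also have "\<dots> \<le> (C3 * C4 + C2 * (2 / \<kappa>) ^ m * Q powr B + 2 * C3 / \<kappa> * C4) * t powr (- B)"
        using summ t' t1 B by (intro mult_left_mono powr_mono2') auto
      finally show "prob {\<omega> \<in> space (M n). t \<le> \<bar>D n (kstar n \<omega>)\<bar>} \<le> C * t powr (- B)"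
        by (simp add: C_def algebra_simps)
    qed
  qed
  then obtain N where N: "\<And>n t. n \<ge> N \<Longrightarrow> t > D0 \<Longrightarrow>
    measure (M n) {\<omega> \<in> space (M n). t \<le> \<bar>D n (kstar n \<omega>)\<bar>} \<le> C * t powr (- B)"
    unfolding eventually_sequentially by blast
  \<comment> \<open>The asymptotic estimates fail to cover finitely many \<open>n < N\<close>. There
    both \<open>kstar\<close> and the centre lie between 0 and bounds depending on \<open>N\<close>
    alone, so beyond \<open>T0\<close> the event is empty.\<close>
  define T0 where "T0 = D0 + (1 + real N + fp1 f * Lg N)"
  have fN: "fp1 f * Lg N \<ge> 0" using fp1_nonneg by simp
  have T0: "T0 > 1" "T0 \<ge> D0" "T0 \<ge> real N + fp1 f * Lg N" using gap(2) fN by (auto simp: T0_def)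
  have "measure (M n) {\<omega> \<in> space (M n). \<bar>real (kstar n \<omega>) - fp1 f * Lg n\<bar> \<ge> t} \<le> C * t powr (- B)"
    if n: "n \<ge> 1" and t: "t > T0" for n t
  proof (cases "n \<ge> N")
    case True
    then show ?thesis using N[of n t] t T0 by (simp add: Dlt_def)
  next
    case False
    have "\<bar>real (kstar n \<omega>) - fp1 f * Lg n\<bar> < t" if w: "\<omega> \<in> space (M n)" for \<omega>
    proof -
      have "kstar n \<omega> \<le> n" by (rule width_attained_le[OF n w att[OF n w]])
      then have "real (kstar n \<omega>) \<le> real N" using False by linarith
      moreover have "fp1 f * Lg n \<le> fp1 f * Lg N"
        using Lg_mono[of n N] False n fp1_nonneg by (intro mult_left_mono) auto
      moreover have "fp1 f * Lg n \<ge> 0" using fp1_nonneg by simp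
      moreover have "real (kstar n \<omega>) \<ge> 0" by simp
      ultimately show ?thesis using t T0(3) fN unfolding abs_less_iff by linarith
    qed
    then have e: "{\<omega> \<in> space (M n). \<bar>real (kstar n \<omega>) - fp1 f * Lg n\<bar> \<ge> t} = {}" by (auto simp: not_le)
    show ?thesis unfolding e using C0 by simp
  qed
  then show ?thesis using T0(1) by blast
qed

end

section \<open>Almost sure convergence\<close>

text \<open>The subsequence along which the width is controlled by Borel--Cantelli: sparse enough for
  \<open>Lg\<close> to grow polynomially in the index, dense enough for consecutive terms to differ by
  \<open>O(n / Lg n)\<close>, which is negligible against the width.\<close>

definition exp_sqrt :: "nat \<Rightarrow> nat" where
  "exp_sqrt j = nat \<lceil>exp (sqrt (real j))\<rceil>"

text \<open>The index inverts \<open>exp (sqrt j)\<close> up to rounding down, so for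
  \<open>n >= 3\<close> this is a term of the subsequence that is at most \<open>n\<close> and
  within \<open>n / Lg n\<close> of it.\<close>

definition exp_sqrt_below :: "nat \<Rightarrow> nat" where
  "exp_sqrt_below n = exp_sqrt (nat \<lfloor>(ln (real n))\<^sup>2\<rfloor>)"

lemma exp_sqrt_ge: "exp (sqrt (real j)) \<le> real (exp_sqrt j)"
  unfolding exp_sqrt_def by (simp add: of_nat_nat le_of_int_ceiling less_imp_le)

lemma exp_sqrt_ge_1: "exp_sqrt j \<ge> 1"
proof -
  have "1 \<le> exp (sqrt (real j))" by simp
  then have "1 \<le> real (exp_sqrt j)" using exp_sqrt_ge[of j] by (rule order.trans)
  then show ?thesis by simp
qed

lemma Lg_exp_sqrt_ge: "sqrt (real j) \<le> Lg (exp_sqrt j)"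
proof -
  have "sqrt (real j) = ln (exp (sqrt (real j)))" by simp
  also have "\<dots> \<le> ln (real (exp_sqrt j))"
    using exp_sqrt_ge[of j] exp_sqrt_ge_1[of j] by (subst ln_le_cancel_iff) auto
  also have "\<dots> \<le> Lg (exp_sqrt j)" by (simp add: Lg_def)
  finally show ?thesis .
qed

lemma exp_sqrt_below_bounds:
  assumes n: "n \<ge> 3"
  shows "exp_sqrt_below n \<ge> 1" "exp_sqrt_below n \<le> n"
    "real n * (1 - 1 / Lg n) \<le> real (exp_sqrt_below n)"
    "Lg n - 1 / Lg n \<le> Lg (exp_sqrt_below n)" "Lg (exp_sqrt_below n) \<le> Lg n"
proof -
  define L where "L = Lg n"
  have L: "L \<ge> 1" "L > 0" "L = ln (real n)" "exp L = real n"
    using Lg_eq_ln[OF n] exp_Lg[OF n] Lg_ge_1[of n] Lg_pos[of n] unfolding L_def by blast+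
  define J where "J = nat \<lfloor>L\<^sup>2\<rfloor>"
  have J: "real J \<le> L\<^sup>2" "L\<^sup>2 - 1 \<le> real J" unfolding J_def by (auto simp: of_nat_nat)
  have N: "exp_sqrt_below n = exp_sqrt J" by (simp add: exp_sqrt_below_def J_def L)
  show "exp_sqrt_below n \<ge> 1" unfolding N by (rule exp_sqrt_ge_1)
  have "sqrt (real J) \<le> L" using J(1) L(2) by (simp add: real_le_lsqrt)
  then have "exp (sqrt (real J)) \<le> real n" unfolding L(4)[symmetric] by simp
  then show le: "exp_sqrt_below n \<le> n" unfolding N exp_sqrt_def by (simp add: nat_le_iff ceiling_le_iff)
  \<comment> \<open>Rounding the index loses at most 1 in the square of \<open>L\<close>, hence at
    most \<open>1 / L\<close> in its root.\<close>
  have low: "L - 1 / L \<le> sqrt (real J)"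
  proof (rule real_le_rsqrt)
    have "(L - 1 / L)\<^sup>2 = L\<^sup>2 - 2 + 1 / L\<^sup>2" using L(2) by (simp add: power2_diff power_divide)
    also have "1 / L\<^sup>2 \<le> 1" using L(1) by (simp add: divide_le_eq_1 one_le_power)
    finally show "(L - 1 / L)\<^sup>2 \<le> real J" using J(2) by linarith
  qed
  then have "L - 1 / L \<le> Lg (exp_sqrt J)" using Lg_exp_sqrt_ge[of J] by linarith
  then show "Lg n - 1 / Lg n \<le> Lg (exp_sqrt_below n)" unfolding N L_def .
  show "Lg (exp_sqrt_below n) \<le> Lg n" using le exp_sqrt_ge_1[of J] unfolding N by (intro Lg_mono) auto
  have "real n * (1 - 1 / L) \<le> real n * exp (- (1 / L))"
    using exp_ge_add_one_self[of "- (1 / L)"] by (intro mult_left_mono) auto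
  also have "\<dots> = exp (L - 1 / L)" unfolding L(4)[symmetric] exp_add[symmetric] by simp
  also have "\<dots> \<le> exp (sqrt (real J))" using low by simp
  also have "\<dots> \<le> real (exp_sqrt_below n)" unfolding N by (rule exp_sqrt_ge)
  finally show "real n * (1 - 1 / Lg n) \<le> real (exp_sqrt_below n)" by (simp add: L_def)
qed

lemma exp_sqrt_index_at_top: "filterlim (\<lambda>n. nat \<lfloor>(ln (real n))\<^sup>2\<rfloor>) at_top sequentially"
proof (rule filterlim_compose[OF filterlim_nat_sequentially])
  have "filterlim (\<lambda>n. (ln (real n))\<^sup>2) at_top sequentially" by real_asymp
  then show "filterlim (\<lambda>n. \<lfloor>(ln (real n))\<^sup>2\<rfloor>) at_top sequentially"
    by (rule filterlim_compose[OF filterlim_floor_sequentially])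
qed

lemma abs_diff_le_of_bounded_increments:
  fixes w :: "nat \<Rightarrow> real"
  assumes "\<And>n. n \<ge> 1 \<Longrightarrow> \<bar>w (Suc n) - w n\<bar> \<le> C" and "1 \<le> m" "m \<le> n"
  shows "\<bar>w n - w m\<bar> \<le> C * (real n - real m)"
  using assms(3)
proof (induction n rule: dec_induct)
  case (step n)
  have "\<bar>w (Suc n) - w m\<bar> \<le> \<bar>w (Suc n) - w n\<bar> + \<bar>w n - w m\<bar>" by linarith
  also have "\<dots> \<le> C + C * (real n - real m)" using step assms(1)[of n] assms(2) by (intro add_mono) auto
  finally show ?case by (simp add: algebra_simps)
qed simp

context profile_family
begin

lemma mean_width_over_peak: "(\<lambda>n. mean_width M T n / peak n) \<longlonglongrightarrow> 1"
proof -
  obtain C where C: "C \<ge> 0" "\<forall>\<^sub>F n in sequentially. \<bar>mean_width M T n - peak n\<bar> \<le> C * scale n"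
    by (rule mean_width_peak)
  have "(\<lambda>n. mean_width M T n / peak n - 1) \<longlonglongrightarrow> 0"
  proof (rule Lim_null_comparison)
    show "\<forall>\<^sub>F n in sequentially. norm (mean_width M T n / peak n - 1) \<le> C / \<kappa> / Lg n"
      using C(2) eventually_ge_at_top[of 1]
    proof eventually_elim
      case (elim n)
      have pk: "peak n > 0" using peak_pos[OF elim(2)] .
      have "mean_width M T n / peak n - 1 = (mean_width M T n - peak n) / peak n"
        using pk by (simp add: diff_divide_distrib)
      then have "norm (mean_width M T n / peak n - 1) = \<bar>mean_width M T n - peak n\<bar> / peak n"
        using pk by (simp add: abs_divide)
      also have "\<dots> \<le> C * scale n / peak n" using elim(1) pk by (intro divide_right_mono) auto
      also have "\<dots> = C / \<kappa> / Lg n" using scale_pos[OF elim(2)] by (simp add: peak_eq)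
      finally show ?case .
    qed
    show "(\<lambda>n. C / \<kappa> / Lg n) \<longlonglongrightarrow> 0"
      by (intro tendsto_divide_0[OF tendsto_const] filterlim_at_top_imp_at_infinity Lg_at_top)
  qed
  then show ?thesis by (simp add: LIM_zero_iff)
qed

lemma peak_exp_sqrt_below: "(\<lambda>n. peak (exp_sqrt_below n) / peak n) \<longlonglongrightarrow> 1"
proof -
  have L0: "(\<lambda>n. 1 / Lg n) \<longlonglongrightarrow> 0"
    by (intro tendsto_divide_0[OF tendsto_const] filterlim_at_top_imp_at_infinity Lg_at_top)
  have a: "(\<lambda>n. real (exp_sqrt_below n) / real n) \<longlonglongrightarrow> 1"
  proof (rule tendsto_sandwich)
    show "(\<lambda>n. 1 - 1 / Lg n) \<longlonglongrightarrow> 1" using tendsto_diff[OF tendsto_const L0, of 1] by simp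
    show "\<forall>\<^sub>F n in sequentially. 1 - 1 / Lg n \<le> real (exp_sqrt_below n) / real n"
      using eventually_ge_at_top[of 3]
      by eventually_elim (use exp_sqrt_below_bounds(3) in \<open>auto simp: pos_le_divide_eq mult.commute\<close>)
    show "\<forall>\<^sub>F n in sequentially. real (exp_sqrt_below n) / real n \<le> 1"
      using eventually_ge_at_top[of 3]
      by eventually_elim (use exp_sqrt_below_bounds(2) in auto)
  qed simp
  have b: "(\<lambda>n. Lg (exp_sqrt_below n) / Lg n) \<longlonglongrightarrow> 1"
  proof (rule tendsto_sandwich)
    show "(\<lambda>n. 1 - 1 / Lg n * (1 / Lg n)) \<longlonglongrightarrow> 1"
      using tendsto_diff[OF tendsto_const tendsto_mult[OF L0 L0], of 1] by simp
    show "\<forall>\<^sub>F n in sequentially. 1 - 1 / Lg n * (1 / Lg n) \<le> Lg (exp_sqrt_below n) / Lg n"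
      using eventually_ge_at_top[of 3]
    proof eventually_elim
      case (elim n)
      have "1 - 1 / Lg n * (1 / Lg n) = (Lg n - 1 / Lg n) / Lg n" by (simp add: diff_divide_distrib)
      also have "\<dots> \<le> Lg (exp_sqrt_below n) / Lg n"
        by (intro divide_right_mono exp_sqrt_below_bounds elim) simp
      finally show ?case .
    qed
    show "\<forall>\<^sub>F n in sequentially. Lg (exp_sqrt_below n) / Lg n \<le> 1"
      using eventually_ge_at_top[of 3]
      by eventually_elim (use exp_sqrt_below_bounds(5) in auto)
  qed simp
  have "(\<lambda>n. real (exp_sqrt_below n) / real n / sqrt (Lg (exp_sqrt_below n) / Lg n)) \<longlonglongrightarrow> 1 / sqrt 1"
    by (intro tendsto_intros a b) simp
  moreover have "\<forall>\<^sub>F n in sequentially. real (exp_sqrt_below n) / real n / sqrt (Lg (exp_sqrt_below n) / Lg n) = peak (exp_sqrt_below n) / peak n"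
    using eventually_ge_at_top[of 3]
  proof eventually_elim
    case (elim n)
    have "sqrt (2 * pi * s2) \<noteq> 0" using variance_pos by simp
    moreover have "peak m = real m / (sqrt (2 * pi * s2) * sqrt (Lg m))" for m
      unfolding peak_def by (simp only: real_sqrt_mult)
    ultimately show ?case by (simp add: real_sqrt_divide)
  qed
  ultimately show ?thesis by (simp add: Lim_transform_eventually)
qed

text \<open>The tolerance \<open>peak / sqrt L\<close> is negligible against the peak, yet larger
  than \<open>scale n\<close> by a factor of order \<open>sqrt L\<close>, which a moment bound
  exploits.\<close>

lemma width_subsequence_tendsto:
  assumes M: "\<And>n. n \<ge> 1 \<Longrightarrow> M n = M 1"
  shows "AE \<omega> in M 1. (\<lambda>j. W (exp_sqrt j) \<omega> / peak (exp_sqrt j)) \<longlonglongrightarrow> 1"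
proof -
  interpret prob_space "M 1" by (rule prob_space_M) simp
  \<comment> \<open>The eighth moment bounds the exceptional probability by a constant times
    \<open>L^-4\<close>, and \<open>L >= sqrt j\<close> turns this into \<open>j^-2\<close>.\<close>
  have eight: "even (8::nat)" "(8::nat) \<ge> 2" by simp_all
  obtain C where C: "C \<ge> 0"
    "\<forall>\<^sub>F n in sequentially. (\<integral>\<omega>. \<bar>W n \<omega> - peak n\<bar> ^ 8 \<partial>M n) \<le> C * scale n ^ 8"
    by (rule width_moment_peak[OF eight])
  define n where "n = exp_sqrt"
  define L where "L = (\<lambda>j. Lg (n j))"
  have n1: "n j \<ge> 1" for j unfolding n_def by (rule exp_sqrt_ge_1)
  have nM: "M (n j) = M 1" for j by (rule M[OF n1])
  have Lj: "sqrt (real j) \<le> L j" for j by (simp add: L_def n_def Lg_exp_sqrt_ge)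
  have ntop: "filterlim n at_top sequentially"
    unfolding filterlim_at_top
  proof
    fix Z
    have "\<forall>\<^sub>F j in sequentially. real Z \<le> exp (sqrt (real j))" by real_asymp
    then show "\<forall>\<^sub>F j in sequentially. Z \<le> n j"
    proof eventually_elim
      case (elim j)
      then have "real Z \<le> real (n j)" using exp_sqrt_ge[of j] unfolding n_def by linarith
      then show ?case by simp
    qed
  qed
  define A where "A = (\<lambda>j. {\<omega> \<in> space (M 1). peak (n j) / sqrt (L j) \<le> \<bar>W (n j) \<omega> - peak (n j)\<bar>})"
  have mW: "(\<lambda>\<omega>. W (n j) \<omega>) \<in> borel_measurable (M 1)" for j
    using measurable_of_tree[OF n1, of "\<lambda>t. real (width t)" j] unfolding nM .
  have Am: "A j \<in> events" for j unfolding A_def using mW by measurable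
  have L1: "L j \<ge> 1" "L j > 0" for j by (simp_all add: L_def)
  have "summable (\<lambda>j. prob (A j))"
  proof (rule summable_comparison_test_ev)
    show "summable (\<lambda>j. C / \<kappa> ^ 8 * inverse (real j ^ 2))"
      by (intro summable_mult inverse_power_summable) simp
    have "\<forall>\<^sub>F j in sequentially. (\<integral>\<omega>. \<bar>W (n j) \<omega> - peak (n j)\<bar> ^ 8 \<partial>M (n j)) \<le> C * scale (n j) ^ 8"
      using C(2) ntop unfolding filterlim_iff by blast
    then show "\<forall>\<^sub>F j in sequentially. norm (prob (A j)) \<le> C / \<kappa> ^ 8 * inverse (real j ^ 2)"
      using eventually_ge_at_top[of 1]
    proof eventually_elim
      case (elim j)
      define a where "a = scale (n j)"
      have a: "a > 0" using scale_pos[OF n1] by (simp add: a_def)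
      have pk: "peak (n j) = \<kappa> * a * L j" by (simp add: peak_eq a_def L_def)
      have p0: "peak (n j) / sqrt (L j) > 0" using peak_pos[OF n1] L1 by simp
      have "prob (A j) \<le> expectation (\<lambda>\<omega>. \<bar>W (n j) \<omega> - peak (n j)\<bar> ^ 8) / (peak (n j) / sqrt (L j)) ^ 8"
        unfolding A_def
        by (rule power_Markov_inequality[OF integrable_W_power[OF n1, of j, unfolded nM] p0])
      also have "\<dots> \<le> C * a ^ 8 / (peak (n j) / sqrt (L j)) ^ 8"
        using elim(1) p0 unfolding nM a_def by (intro divide_right_mono) auto
      also have "\<dots> = C / \<kappa> ^ 8 * (1 / L j ^ 4)"
      proof -
        have "sqrt (L j) ^ 8 = (sqrt (L j) ^ 2) ^ 4" by (simp only: power_mult[symmetric]) simp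
        then have s: "sqrt (L j) ^ 8 = L j ^ 4" using L1 by (simp add: less_imp_le)
        have "(peak (n j) / sqrt (L j)) ^ 8 = \<kappa> ^ 8 * a ^ 8 * (L j ^ 4 * L j ^ 4) / L j ^ 4"
          unfolding power_divide s pk power_mult_distrib power_add[symmetric] by simp
        also have "v * (y * y) / y = v * y" if "y \<noteq> 0" for v y :: real using that by simp
        then have "\<kappa> ^ 8 * a ^ 8 * (L j ^ 4 * L j ^ 4) / L j ^ 4 = \<kappa> ^ 8 * a ^ 8 * L j ^ 4"
          using L1(2)[of j] by (metis less_irrefl power_not_zero)
        finally show ?thesis using a by simp
      qed
      also have "\<dots> \<le> C / \<kappa> ^ 8 * (1 / (real j) ^ 2)"
      proof (rule mult_left_mono)
        have "(real j)\<^sup>2 = sqrt (real j) ^ 4"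
        proof -
          have "sqrt (real j) ^ 4 = (sqrt (real j) ^ 2) ^ 2" by (simp only: power_mult[symmetric]) simp
          then show ?thesis by simp
        qed
        also have "\<dots> \<le> L j ^ 4" using Lj by (intro power_mono) auto
        finally show "1 / L j ^ 4 \<le> 1 / (real j)\<^sup>2" using elim(2) L1(2)[of j] by (intro divide_left_mono mult_pos_pos zero_less_power) auto
      qed (use C(1) kappa_pos in simp)
      finally show ?case by (simp add: inverse_eq_divide)
    qed
  qed
  then have "AE \<omega> in M 1. \<forall>\<^sub>F j in sequentially. \<omega> \<in> space (M 1) - A j"
    by (intro borel_cantelli_AE1 Am) (simp_all add: emeasure_eq_measure del: One_nat_def)
  then show ?thesis
  proof eventually_elim
    case (elim \<omega>)
    have "(\<lambda>j. W (n j) \<omega> / peak (n j) - 1) \<longlonglongrightarrow> 0"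
    proof (rule Lim_null_comparison)
      show "\<forall>\<^sub>F j in sequentially. norm (W (n j) \<omega> / peak (n j) - 1) \<le> 1 / sqrt (L j)"
        using elim
      proof eventually_elim
        case (elim j)
        have pk: "peak (n j) > 0" by (rule peak_pos[OF n1])
        have "\<bar>W (n j) \<omega> - peak (n j)\<bar> \<le> peak (n j) / sqrt (L j)" using elim by (auto simp: A_def)
        then have "\<bar>W (n j) \<omega> - peak (n j)\<bar> / peak (n j) \<le> peak (n j) / sqrt (L j) / peak (n j)"
          using pk by (intro divide_right_mono) auto
        moreover have "W (n j) \<omega> / peak (n j) - 1 = (W (n j) \<omega> - peak (n j)) / peak (n j)"
          using pk by (simp add: diff_divide_distrib)
        ultimately show ?case using pk by (simp add: abs_divide)
      qed
      have "((\<lambda>x. 1 / sqrt x) \<longlongrightarrow> 0) at_top" by real_asymp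
      then show "(\<lambda>j. 1 / sqrt (L j)) \<longlonglongrightarrow> 0"
        unfolding L_def by (rule filterlim_compose) (rule filterlim_compose[OF Lg_at_top ntop])
    qed
    then show ?case by (simp add: LIM_zero_iff n_def)
  qed
qed

text \<open>Each \<open>n\<close> is compared with the term of the subsequence just below it: the
  increments change the width by at most \<open>C * n / L\<close> in between, which is smaller than
  the peak by a factor of order \<open>1 / sqrt L\<close>. The peaks at the two sizes are
  asymptotically equal.\<close>

lemma width_almost_surely:
  assumes M: "\<And>n. n \<ge> 1 \<Longrightarrow> M n = M 1"
    and inc: "\<And>n. n \<ge> 1 \<Longrightarrow> AE \<omega> in M 1. \<bar>W (Suc n) \<omega> - W n \<omega>\<bar> \<le> C"
  shows "AE \<omega> in M 1. (\<lambda>n. W n \<omega> / mean_width M T n) \<longlonglongrightarrow> 1"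
proof -
  have "AE \<omega> in M 1. \<forall>n. n \<ge> 1 \<longrightarrow> \<bar>W (Suc n) \<omega> - W n \<omega>\<bar> \<le> C"
    unfolding AE_all_countable using inc by (auto intro: AE_mp)
  moreover have "AE \<omega> in M 1. (\<lambda>j. W (exp_sqrt j) \<omega> / peak (exp_sqrt j)) \<longlonglongrightarrow> 1"
    by (rule width_subsequence_tendsto) (rule M)
  ultimately show ?thesis
  proof eventually_elim
    case (elim \<omega>)
    let ?w = "\<lambda>n. W n \<omega>"
    let ?N = exp_sqrt_below
    have C0: "C \<ge> 0" using elim(1)[rule_format, of 1] by (meson abs_ge_zero order.refl order.trans)
    have "(\<lambda>n. ?w (?N n) / peak (?N n)) \<longlonglongrightarrow> 1"
      using filterlim_compose[OF elim(2) exp_sqrt_index_at_top] by (simp add: exp_sqrt_below_def)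
    from tendsto_mult[OF this peak_exp_sqrt_below]
    have "(\<lambda>n. ?w (?N n) / peak (?N n) * (peak (?N n) / peak n)) \<longlonglongrightarrow> 1" by simp
    moreover have "\<forall>\<^sub>F n in sequentially. ?w (?N n) / peak (?N n) * (peak (?N n) / peak n) = ?w (?N n) / peak n"
      using eventually_ge_at_top[of 3]
    proof eventually_elim
      case (elim n)
      then show ?case using peak_pos[OF exp_sqrt_below_bounds(1)[OF elim]] by simp
    qed
    ultimately have l1: "(\<lambda>n. ?w (?N n) / peak n) \<longlonglongrightarrow> 1" by (rule Lim_transform_eventually)
    have l2: "(\<lambda>n. (?w n - ?w (?N n)) / peak n) \<longlonglongrightarrow> 0"
    proof (rule Lim_null_comparison)
      show "\<forall>\<^sub>F n in sequentially. norm ((?w n - ?w (?N n)) / peak n) \<le> C / \<kappa> * (1 / sqrt (Lg n))"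
        using eventually_ge_at_top[of 3]
      proof eventually_elim
        case n: (elim n)
        note b = exp_sqrt_below_bounds[OF n]
        have n1: "n \<ge> 1" using n by simp
        have pk: "peak n > 0" using peak_pos[OF n1] .
        have "\<bar>?w n - ?w (?N n)\<bar> \<le> C * (real n - real (?N n))"
          by (rule abs_diff_le_of_bounded_increments) (use elim(1) b in auto)
        also have "\<dots> \<le> C * (real n / Lg n)"
          using b(3) C0 by (intro mult_left_mono) (auto simp: algebra_simps)
        finally have "\<bar>?w n - ?w (?N n)\<bar> / peak n \<le> C * (real n / Lg n) / peak n"
          using pk by (intro divide_right_mono) auto
        also have "\<dots> = C / \<kappa> * (1 / sqrt (Lg n))"
        proof -
          have "peak n = \<kappa> * real n / sqrt (Lg n)"
            using Lg_pos[of n] unfolding peak_eq scale_def powr_minus_3_2[OF Lg_pos] by simp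
          moreover have "C * (v / (q * q)) / (\<kappa> * v / q) = C / \<kappa> * (1 / q)" if "v > 0" "q > 0" for v q
            using that kappa_pos by (simp add: field_simps)
          from this[of "real n" "sqrt (Lg n)"] have "C * (real n / Lg n) / (\<kappa> * real n / sqrt (Lg n)) = C / \<kappa> * (1 / sqrt (Lg n))"
            using n by simp
          ultimately show ?thesis by (simp only:)
        qed
        finally show ?case using pk by (simp add: abs_divide)
      qed
      have "((\<lambda>x. 1 / sqrt x) \<longlongrightarrow> 0) at_top" by real_asymp
      then have "((\<lambda>x. C / \<kappa> * (1 / sqrt x)) \<longlongrightarrow> 0) at_top" by (rule tendsto_mult_right_zero)
      then show "(\<lambda>n. C / \<kappa> * (1 / sqrt (Lg n))) \<longlonglongrightarrow> 0" by (rule filterlim_compose[OF _ Lg_at_top])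
    qed
    have "(\<lambda>n. ?w (?N n) / peak n + (?w n - ?w (?N n)) / peak n) \<longlonglongrightarrow> 1 + 0"
      by (rule tendsto_add[OF l1 l2])
    then have l3: "(\<lambda>n. ?w n / peak n) \<longlonglongrightarrow> 1" by (simp add: add_divide_distrib[symmetric])
    have "(\<lambda>n. (?w n / peak n) / (mean_width M T n / peak n)) \<longlonglongrightarrow> 1 / 1"
      by (intro tendsto_divide l3 mean_width_over_peak) simp
    moreover have "\<forall>\<^sub>F n in sequentially. (?w n / peak n) / (mean_width M T n / peak n) = ?w n / mean_width M T n"
      using eventually_ge_at_top[of 1]
    proof eventually_elim
      case (elim n)
      then show ?case using peak_pos[OF elim] by simp
    qed
    ultimately have "(\<lambda>n. ?w n / mean_width M T n) \<longlonglongrightarrow> 1 / 1" by (rule Lim_transform_eventually)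
    then show ?case by simp
  qed
qed

end

theorem theorem4p1:
  fixes M :: "nat \<Rightarrow> 'a measure"
    and T :: "nat \<Rightarrow> 'a \<Rightarrow> rtree"
    and f g :: "complex \<Rightarrow> complex"
    and \<epsilon>0 :: real
    and kstar :: "nat \<Rightarrow> 'a \<Rightarrow> nat"
  assumes "random_tree_family M T"
    and "cond_I M T f g \<epsilon>0"
    and "small_radius f \<epsilon>0"
    and "cond_II M T \<epsilon>0"
    and "cond_III M T f"
    and "fp1 f + fpp1 f > 0"
    and "\<And>n. n \<ge> 1 \<Longrightarrow> kstar n \<in> measurable (M n) (count_space UNIV)"
    and "\<And>n \<omega>. n \<ge> 1 \<Longrightarrow> \<omega> \<in> space (M n) \<Longrightarrow>
           profile (T n \<omega>) (kstar n \<omega>) = width (T n \<omega>)"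
  shows "(\<exists>r. r \<in> O(\<lambda>n. 1 / Lg n) \<and>
            (\<forall>n\<ge>1. mean_width M T n =
               real n / sqrt (2 * pi * (sigma_prof f)\<^sup>2 * Lg n) * (1 + r n)))
       \<and> (\<forall>s\<ge>0. (\<lambda>n. \<integral>\<omega>. \<bar>real (width (T n \<omega>)) - mean_width M T n\<bar> powr s \<partial>M n)
            \<in> O(\<lambda>n. real n powr s * Lg n powr (- 3 * s / 2)))
       \<and> (\<forall>B>0. \<exists>T0>1. \<exists>C. \<forall>n\<ge>1. \<forall>t>T0.
            measure (M n) {\<omega> \<in> space (M n). \<bar>real (kstar n \<omega>) - fp1 f * Lg n\<bar> \<ge> t}
              \<le> C * t powr (- B))
       \<and> ((\<forall>n\<ge>1. M n = M 1) \<and>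
            (\<exists>C. \<forall>n\<ge>1. AE \<omega> in M 1.
               \<bar>real (width (T (Suc n) \<omega>)) - real (width (T n \<omega>))\<bar> \<le> C)
          \<longrightarrow> (AE \<omega> in M 1.
                 (\<lambda>n. real (width (T n \<omega>)) / mean_width M T n) \<longlonglongrightarrow> 1))"
proof -
  interpret profile_family M T f g \<epsilon>0
    using assms(1-6) by unfold_locales
  show ?thesis
  proof (intro conjI impI)
    show "\<forall>B>0. \<exists>T0>1. \<exists>C. \<forall>n\<ge>1. \<forall>t>T0.
            measure (M n) {\<omega> \<in> space (M n). \<bar>real (kstar n \<omega>) - fp1 f * Lg n\<bar> \<ge> t}
              \<le> C * t powr (- B)"
      using level_of_width_tail[OF assms(7,8)] by blast
    show "AE \<omega> in M 1. (\<lambda>n. real (width (T n \<omega>)) / mean_width M T n) \<longlonglongrightarrow> 1"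
      if "(\<forall>n\<ge>1. M n = M 1) \<and> (\<exists>C. \<forall>n\<ge>1. AE \<omega> in M 1.
               \<bar>real (width (T (Suc n) \<omega>)) - real (width (T n \<omega>))\<bar> \<le> C)"
      using that width_almost_surely by blast
  qed (use mean_width_asymptotic abs_width_powr_moment in auto)
qed

end
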